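(* Let $(\mathcal{M},\tau)$ be a semifinite von Neumann algebra, let $A,B\in L^1(\mathcal{M},\tau)$ be selfadjoint such that $A$, $B$ and $A^{-1}$ are positive and bounded, and let $x\in\mathcal{M}$. For any continuous $f\colon[0,\infty)\to\mathbb{R}$, $$\int_0^\infty\tau\big(x^*\,f(t)\,(B-tA)_+\,x\big)\,dt=\int_0^\infty\tau\Big(x^*\sqrt{\tfrac{s}{A+s}}\;[C_{A,B}(s)]^2\,f\big(C_{A,B}(s)\big)\,\sqrt{\tfrac{s}{A+s}}\;x\Big)\,ds,$$ where $C_{A,B}(s)=(A+s)^{-1/2}B(A+s)^{-1/2}\ge0$.
   Context: A semifinite von Neumann algebra $(\mathcal{M},\tau)$ is a von Neumann algebra $\mathcal{M}$ with a faithful normal semifinite tracial weight $\tau$. $L^1(\mathcal{M},\tau)$ is the completion of $\mathcal{M}_\tau=\mathrm{span}\{y\in\mathcal{M}_+:\tau(y)<\infty\}$ in the norm $\tau(|y|)$, realized as a space of ($\tau$-measurable) operators affiliated with $\mathcal{M}$, to which $\tau$ extends continuously. $X_+$ is the positive part of a selfadjoint operator $X$; functions of operators such as $\sqrt{s/(A+s)}$ and $f(C_{A,B}(s))$ are defined by functional calculus. *)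

theory Defs
  imports "HOL-Analysis.Analysis" "HOL-Computational_Algebra.Polynomial"
begin

section \<open>Complex Hilbert spaces and bounded operators\<close>

text \<open>The real inner product of the underlying real Hilbert space is the real part of the complex
  one, so norm, topology and completeness are those of the library. The complex inner product is
  linear in the second argument.\<close>

class complex_hilbert = real_inner + complete_space +
  fixes scaleC :: "complex \<Rightarrow> 'a \<Rightarrow> 'a" (infixr "*C" 75)
    and cinner :: "'a \<Rightarrow> 'a \<Rightarrow> complex"
  assumes scaleC_add_right: "c *C (x + y) = c *C x + c *C y"
    and scaleC_add_left: "(c + d) *C x = c *C x + d *C x"
    and scaleC_scaleC: "c *C d *C x = (c * d) *C x"
    and scaleC_of_real: "complex_of_real r *C x = r *\<^sub>R x"
    and cinner_add_right: "cinner x (y + z) = cinner x y + cinner x z"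
    and cinner_scaleC_right: "cinner x (c *C y) = c * cinner x y"
    and cinner_commute: "cinner x y = cnj (cinner y x)"
    and Re_cinner: "Re (cinner x y) = inner x y"

text \<open>The type \<open>'h \<Rightarrow>\<^sub>L 'h\<close> consists of the bounded real-linear maps; B(H) is the following subset,
  with the same norm.\<close>

type_synonym 'h op = "'h \<Rightarrow>\<^sub>L 'h"

definition bounded_ops :: "'h::complex_hilbert op set" where
  "bounded_ops = {T :: 'h op. \<forall>c x. T (c *C x) = c *C T x}"

definition scalar_op :: "complex \<Rightarrow> 'h::complex_hilbert op" where
  "scalar_op c = Blinfun (\<lambda>x. c *C x)"

definition adj :: "'h::complex_hilbert op \<Rightarrow> 'h op" where
  "adj T = (THE S :: 'h op. \<forall>x y. cinner (S x) y = cinner x (T y))"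

definition selfadjoint :: "'h::complex_hilbert op \<Rightarrow> bool" where
  "selfadjoint T \<longleftrightarrow> T \<in> bounded_ops \<and> adj T = T"

definition positive_op :: "'h::complex_hilbert op \<Rightarrow> bool" where
  "positive_op T \<longleftrightarrow> T \<in> bounded_ops \<and> (\<forall>x. cinner x (T x) \<in> \<real>\<^sub>\<ge>\<^sub>0)"

definition op_le :: "'h::complex_hilbert op \<Rightarrow> 'h op \<Rightarrow> bool" where
  "op_le S T \<longleftrightarrow> positive_op (T - S)"


section \<open>Continuous functional calculus\<close>

definition spectrum :: "'h::complex_hilbert op \<Rightarrow> complex set" where
  "spectrum T = {c. \<not> (\<exists>R\<in>bounded_ops. R o\<^sub>L (T - scalar_op c) = id_blinfun
                                     \<and> (T - scalar_op c) o\<^sub>L R = id_blinfun)}"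

definition poly_op :: "real poly \<Rightarrow> 'h::complex_hilbert op \<Rightarrow> 'h op" where
  "poly_op p T = (\<Sum>i\<le>degree p. coeff p i *\<^sub>R (((o\<^sub>L) T ^^ i) id_blinfun))"

text \<open>For selfadjoint \<open>T\<close> (whose spectrum is real) and real \<open>f\<close> continuous on the spectrum, \<open>f(T)\<close>
  is the norm limit of \<open>p\<^sub>n(T)\<close> for polynomials \<open>p\<^sub>n\<close> converging to \<open>f\<close> uniformly on the spectrum.\<close>

definition fun_calc :: "(real \<Rightarrow> real) \<Rightarrow> 'h::complex_hilbert op \<Rightarrow> 'h op" where
  "fun_calc f T = (THE S. \<exists>p :: nat \<Rightarrow> real poly.
      uniform_limit {r. complex_of_real r \<in> spectrum T} (\<lambda>n. poly (p n)) f sequentially \<and>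
      (\<lambda>n. poly_op (p n) T) \<longlonglongrightarrow> S)"

definition pos_part :: "'h::complex_hilbert op \<Rightarrow> 'h op" where
  "pos_part T = fun_calc (\<lambda>r. max r 0) T"

definition abs_op :: "'h::complex_hilbert op \<Rightarrow> 'h op" where
  "abs_op T = fun_calc sqrt (adj T o\<^sub>L T)"


section \<open>Semifinite von Neumann algebras\<close>

definition commutant :: "'h::complex_hilbert op set \<Rightarrow> 'h op set" where
  "commutant S = {T \<in> bounded_ops. \<forall>U\<in>S. T o\<^sub>L U = U o\<^sub>L T}"

text \<open>A bicommutant is automatically a unital, weakly closed subalgebra of B(H).\<close>

definition von_neumann_algebra :: "'h::complex_hilbert op set \<Rightarrow> bool" where
  "von_neumann_algebra M \<longleftrightarrow>
     M \<subseteq> bounded_ops \<and> (\<forall>T\<in>M. adj T \<in> M) \<and> commutant (commutant M) = M"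

definition pos_cone :: "'h::complex_hilbert op set \<Rightarrow> 'h op set" where
  "pos_cone M = {T \<in> M. positive_op T}"

definition directed_up :: "'h::complex_hilbert op set \<Rightarrow> bool" where
  "directed_up D \<longleftrightarrow> D \<noteq> {} \<and> (\<forall>a\<in>D. \<forall>b\<in>D. \<exists>c\<in>D. op_le a c \<and> op_le b c)"

definition is_lub :: "'h::complex_hilbert op set \<Rightarrow> 'h op set \<Rightarrow> 'h op \<Rightarrow> bool" where
  "is_lub M D a \<longleftrightarrow> a \<in> pos_cone M \<and> (\<forall>d\<in>D. op_le d a) \<and>
     (\<forall>b\<in>pos_cone M. (\<forall>d\<in>D. op_le d b) \<longrightarrow> op_le a b)"

text \<open>A weight is defined on the positive cone only: the values of \<open>tau\<close> elsewhere are irrelevant.\<close>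

locale semifinite_von_neumann_algebra =
  fixes M :: "'h::complex_hilbert op set" and tau :: "'h op \<Rightarrow> ennreal"
  assumes vna: "von_neumann_algebra M"
    and tau_add: "\<And>a b. a \<in> pos_cone M \<Longrightarrow> b \<in> pos_cone M \<Longrightarrow> tau (a + b) = tau a + tau b"
    and tau_scale: "\<And>r a. r \<ge> 0 \<Longrightarrow> a \<in> pos_cone M \<Longrightarrow> tau (r *\<^sub>R a) = ennreal r * tau a"
    and tau_tracial: "\<And>y. y \<in> M \<Longrightarrow> tau (adj y o\<^sub>L y) = tau (y o\<^sub>L adj y)"
    and tau_faithful: "\<And>a. a \<in> pos_cone M \<Longrightarrow> tau a = 0 \<Longrightarrow> a = 0"
    and tau_normal: "\<And>D a. D \<subseteq> pos_cone M \<Longrightarrow> directed_up D \<Longrightarrow> is_lub M D a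
                        \<Longrightarrow> tau a = (SUP d\<in>D. tau d)"
    and tau_semifinite: "\<And>a. a \<in> pos_cone M \<Longrightarrow> a \<noteq> 0
                        \<Longrightarrow> \<exists>b\<in>pos_cone M. b \<noteq> 0 \<and> op_le b a \<and> tau b < \<infinity>"

definition fin_pos :: "'h::complex_hilbert op set \<Rightarrow> ('h op \<Rightarrow> ennreal) \<Rightarrow> 'h op set" where
  "fin_pos M tau = {y \<in> pos_cone M. tau y < \<infinity>}"

definition M_tau :: "'h::complex_hilbert op set \<Rightarrow> ('h op \<Rightarrow> ennreal) \<Rightarrow> 'h op set" where
  "M_tau M tau = {\<Sum>i<n. scalar_op (c i) o\<^sub>L a i | (n::nat) c a. \<forall>i<n. a i \<in> fin_pos M tau}"

text \<open>The linear extension of \<open>tau\<close> to the span \<open>M_tau\<close>, i.e. the restriction to \<open>M_tau\<close> of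
  the extension of \<open>tau\<close> to L1; every operator in \<open>M_tau\<close> is bounded.\<close>

definition tau_ext :: "'h::complex_hilbert op set \<Rightarrow> ('h op \<Rightarrow> ennreal) \<Rightarrow> 'h op \<Rightarrow> complex" where
  "tau_ext M tau y = (THE z. \<exists>(n::nat) c a. (\<forall>i<n. a i \<in> fin_pos M tau) \<and>
      y = (\<Sum>i<n. scalar_op (c i) o\<^sub>L a i) \<and>
      z = (\<Sum>i<n. c i * complex_of_real (enn2real (tau (a i)))))"


section \<open>The space L1 as a space of measurable operators\<close>

text \<open>Unbounded operators are represented by their graphs.\<close>

definition op_graph :: "'h::complex_hilbert op \<Rightarrow> ('h \<times> 'h) set" where
  "op_graph T = {(x, T x) | x. True}"

definition closed_densely_defined :: "('h::complex_hilbert \<times> 'h) set \<Rightarrow> bool" where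
  "closed_densely_defined T \<longleftrightarrow> single_valued T \<and> closed T \<and> closure (Domain T) = UNIV \<and>
     (\<forall>x u y v. (x, u) \<in> T \<longrightarrow> (y, v) \<in> T \<longrightarrow> (x + y, u + v) \<in> T) \<and>
     (\<forall>c x u. (x, u) \<in> T \<longrightarrow> (c *C x, c *C u) \<in> T)"

definition affiliated :: "'h::complex_hilbert op set \<Rightarrow> ('h \<times> 'h) set \<Rightarrow> bool" where
  "affiliated M T \<longleftrightarrow> (\<forall>U\<in>commutant M. \<forall>(x, u)\<in>T. (U x, U u) \<in> T)"

definition projections :: "'h::complex_hilbert op set \<Rightarrow> 'h op set" where
  "projections M = {p \<in> M. adj p = p \<and> p o\<^sub>L p = p}"

definition tau_measurable ::
  "'h::complex_hilbert op set \<Rightarrow> ('h op \<Rightarrow> ennreal) \<Rightarrow> ('h \<times> 'h) set \<Rightarrow> bool" where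
  "tau_measurable M tau T \<longleftrightarrow> closed_densely_defined T \<and> affiliated M T \<and>
     (\<forall>\<delta>>0. \<exists>p\<in>projections M. range (blinfun_apply p) \<subseteq> Domain T \<and> tau (id_blinfun - p) \<le> ennreal \<delta>)"

text \<open>Convergence of bounded operators \<open>y n\<close> to \<open>T\<close> in measure: up to projections \<open>1 - p\<close> of small
  trace, \<open>(T - y n) p\<close> is everywhere defined and has small norm.\<close>

definition tends_in_measure :: "'h::complex_hilbert op set \<Rightarrow> ('h op \<Rightarrow> ennreal)
    \<Rightarrow> (nat \<Rightarrow> 'h op) \<Rightarrow> ('h \<times> 'h) set \<Rightarrow> bool" where
  "tends_in_measure M tau y T \<longleftrightarrow>
     (\<forall>\<epsilon>>0. \<forall>\<delta>>0. \<exists>N. \<forall>n\<ge>N. \<exists>p\<in>projections M.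
        range (blinfun_apply p) \<subseteq> Domain T \<and> tau (id_blinfun - p) \<le> ennreal \<delta> \<and>
        (\<forall>x u. (p x, u) \<in> T \<longrightarrow> norm (u - y n (p x)) \<le> \<epsilon> * norm x))"

text \<open>The completion of \<open>M_tau\<close> in the norm \<open>tau (abs_op y)\<close>, realized inside the
  \<open>tau\<close>-measurable operators: the limits in measure of the Cauchy sequences for that norm.\<close>

definition L1 ::
  "'h::complex_hilbert op set \<Rightarrow> ('h op \<Rightarrow> ennreal) \<Rightarrow> ('h \<times> 'h) set set" where
  "L1 M tau = {T. tau_measurable M tau T \<and>
     (\<exists>y :: nat \<Rightarrow> 'h op. (\<forall>n. y n \<in> M_tau M tau) \<and>
        (\<forall>\<epsilon>>0. \<exists>N. \<forall>m\<ge>N. \<forall>n\<ge>N. tau (abs_op (y m - y n)) < ennreal \<epsilon>) \<and>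
        tends_in_measure M tau y T)}"


section \<open>The operators of the integral formula\<close>

definition C_op :: "'h::complex_hilbert op \<Rightarrow> 'h op \<Rightarrow> real \<Rightarrow> 'h op" where
  "C_op A B s = (let R = fun_calc (\<lambda>a. 1 / sqrt a) (A + s *\<^sub>R id_blinfun) in R o\<^sub>L B o\<^sub>L R)"

definition sqrt_ratio :: "'h::complex_hilbert op \<Rightarrow> real \<Rightarrow> 'h op" where
  "sqrt_ratio A s = fun_calc (\<lambda>a. sqrt (s / (a + s))) A"

end

theory Submission
  imports Defs "HOL-Computational_Algebra.Fundamental_Theorem_Algebra"
begin

text \<open>Since \<open>A\<close> is bounded below, its membership in \<open>L1\<close> forces \<open>tau\<close> to be finite, so that \<open>tau\<close>
  extends to a bounded positive tracial functional on \<open>M\<close>. Let \<open>N(Y)\<close> be the trace of the spectral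
  projection of \<open>Y\<close> for \<open>(0, \<infinity>)\<close>. It is invariant under congruence (Sylvester's law of inertia), hence
  \<open>N(C(s) - r) = N(B - r A - r s)\<close>. By the layer-cake formula and the substitution \<open>l = r s\<close> in
  \<open>\<integral>\<integral> f(r) l N(B - r A - l) dl dr\<close> one gets
  \<open>\<integral> f(r) tau(((B - r A)\<^sub>+)\<^sup>2 / 2) dr = \<integral> s tau(H(C(s))) ds\<close> with \<open>H'(u) = u\<^sup>2 f(u)\<close>. This holds
  with \<open>B + e x x\<^sup>*\<close> in place of \<open>B\<close>; the derivative at \<open>e = 0\<close> is the claim, because
  \<open>tau(G(Y + e X))\<close> has derivative \<open>tau(G'(Y) X)\<close>.\<close>

section \<open>Bounded operators and adjoints\<close>

text \<open>Inertia controls only traces of functions of a single operator, whereas the claim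
  sandwiches such functions between \<open>adj x\<close> and \<open>x\<close>. By cyclicity the
  sandwich is a trace against \<open>X = x o\<^sub>L adj x\<close>, which is what a first derivative
  in the direction X produces; hence the detour through an identity one degree higher. As C(s) is
  linear in B, its derivative is S X S, where S is the inverse square root of A + s. Inertia applies
  because S (A + s) S = 1, so that C(s) - r is the congruence of B - r A - r s by S.

  Two obstacles shape the work. The continuous calculus has no spectral projections, so N is a
  supremum over continuous cutoffs, and inertia becomes an inequality between traces of cutoffs of
  different slopes. And the derivative must pass through both integrals: if c > 0 is a lower bound
  of A, the left integrand vanishes for r > (norm B + norm X) / c, and the right difference
  quotients are bounded by a multiple of 1 / (c + s)^2. Tonelli asks for nonnegative f; a general f
  is split into its two signs.\<close>

instance complex_hilbert \<subseteq> banach ..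

interpretation blinfun_compose: bounded_bilinear blinfun_compose
  by (rule bounded_bilinear_blinfun_compose)

lemma inner_scaleC_left: "inner (c *C x) y = inner x (cnj c *C (y::'h::complex_hilbert))"
  by (metis Re_cinner cinner_commute cinner_scaleC_right complex_cnj_mult)

lemma Im_cinner: "Im (cinner x y) = - inner x (\<i> *C (y::'h::complex_hilbert))"
  by (simp add: Re_cinner[symmetric] cinner_scaleC_right)

text \<open>The imaginary part of the complex inner product is minus the real one after
  multiplication by i, so complex identities become pairs of real ones.\<close>

lemma cinner_eq_iff: "cinner x y = cinner z w \<longleftrightarrow> inner x y = inner z w \<and> inner x (\<i> *C y) = inner z (\<i> *C (w::'h::complex_hilbert))"
  by (auto simp: complex_eq_iff Im_cinner Re_cinner)

lemma scaleC_one: "1 *C x = (x::'h::complex_hilbert)"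
  using scaleC_of_real[of 1 x] by simp

lemma norm_scaleC: "norm (c *C x) = norm c * norm (x::'h::complex_hilbert)"
proof -
  have "inner (c *C x) (c *C x) = inner x ((cnj c * c) *C x)"
    by (simp add: inner_scaleC_left scaleC_scaleC)
  also have "cnj c * c = complex_of_real ((norm c)\<^sup>2)"
    by (metis complex_norm_square mult.commute)
  finally have "(norm (c *C x))\<^sup>2 = (norm c * norm x)\<^sup>2"
    by (simp add: scaleC_of_real power2_norm_eq_inner power_mult_distrib del: of_real_power)
  then show ?thesis by (simp add: power2_eq_iff_nonneg)
qed

lemma bounded_linear_scaleC: "bounded_linear (\<lambda>x::'h::complex_hilbert. c *C x)"
proof (rule bounded_linear_intro[of _ "norm c"])
  show "c *C r *\<^sub>R x = r *\<^sub>R c *C x" for r and x :: 'h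
    by (metis mult.commute scaleC_of_real scaleC_scaleC)
qed (auto simp: scaleC_add_right norm_scaleC mult.commute)

lemma scalar_op_apply [simp]: "scalar_op c (x::'h::complex_hilbert) = c *C x"
  by (simp add: scalar_op_def bounded_linear_Blinfun_apply bounded_linear_scaleC)

lemma scalar_op_of_real: "scalar_op (complex_of_real r) = (r *\<^sub>R id_blinfun :: 'h::complex_hilbert op)"
  by (rule blinfun_eqI) (simp add: scaleC_of_real blinfun.scaleR_left)

lemma bounded_opsD: "T \<in> bounded_ops \<Longrightarrow> T (c *C x) = c *C T x"
  by (simp add: bounded_ops_def)

lemma scaleC_scaleR: "c *C r *\<^sub>R x = r *\<^sub>R c *C (x::'h::complex_hilbert)"
  by (rule linear_simps(5)[OF bounded_linear_scaleC])

lemma scaleC_diff_right: "c *C (x - y) = c *C x - c *C (y::'h::complex_hilbert)"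
  by (rule linear_simps(2)[OF bounded_linear_scaleC])

lemma scaleC_zero_right: "c *C 0 = (0::'h::complex_hilbert)"
  by (rule linear_simps(3)[OF bounded_linear_scaleC])

lemma bounded_ops_0: "0 \<in> bounded_ops"
  and bounded_ops_id: "id_blinfun \<in> bounded_ops"
  and bounded_ops_scalar: "scalar_op c \<in> bounded_ops"
  by (auto simp: bounded_ops_def scaleC_scaleC mult.commute scaleC_zero_right)

lemma bounded_ops_add: "S \<in> bounded_ops \<Longrightarrow> T \<in> bounded_ops \<Longrightarrow> S + T \<in> bounded_ops"
  and bounded_ops_diff: "S \<in> bounded_ops \<Longrightarrow> T \<in> bounded_ops \<Longrightarrow> S - T \<in> bounded_ops"
  and bounded_ops_scaleR: "T \<in> bounded_ops \<Longrightarrow> r *\<^sub>R T \<in> bounded_ops"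
  and bounded_ops_compose: "S \<in> bounded_ops \<Longrightarrow> T \<in> bounded_ops \<Longrightarrow> S o\<^sub>L T \<in> bounded_ops"
  by (auto simp: bounded_ops_def blinfun.bilinear_simps scaleC_add_right scaleC_diff_right scaleC_scaleR)

lemma bounded_ops_uminus: "T \<in> bounded_ops \<Longrightarrow> - T \<in> bounded_ops"
  using bounded_ops_scaleR[of T "-1"] by simp

lemma bounded_ops_limit:
  assumes "\<And>n. X n \<in> bounded_ops" "X \<longlonglongrightarrow> T" shows "T \<in> bounded_ops"
proof -
  have "T (c *C x) = c *C T x" for c x
  proof (rule LIMSEQ_unique)
    show "(\<lambda>n. X n (c *C x)) \<longlonglongrightarrow> T (c *C x)"
      by (intro blinfun.tendsto assms tendsto_const)
    have "(\<lambda>n. c *C X n x) \<longlonglongrightarrow> c *C T x"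
      by (intro bounded_linear.tendsto[OF bounded_linear_scaleC] blinfun.tendsto assms tendsto_const)
    then show "(\<lambda>n. X n (c *C x)) \<longlonglongrightarrow> c *C T x"
      using assms by (simp add: bounded_opsD)
  qed
  then show ?thesis by (simp add: bounded_ops_def)
qed

section \<open>Riesz representation\<close>

lemma riesz_representation:
  fixes g :: "'a::{real_inner, complete_space} \<Rightarrow> real"
  assumes g: "bounded_linear g"
  shows "\<exists>y. \<forall>x. g x = inner y x"
proof (cases "\<forall>x. g x = 0")
  case True then show ?thesis by (intro exI[of _ 0]) simp
next
  case False
  interpret g: bounded_linear g by fact
  from False obtain x0 where "g x0 \<noteq> 0" by blast
  \<comment> \<open>The representing vector is a multiple of the point of least norm on this
    hyperplane; a minimising sequence will be shown to be Cauchy.\<close>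
  define S where "S = {x. g x = 1}"
  have "x0 /\<^sub>R g x0 \<in> S" using \<open>g x0 \<noteq> 0\<close> by (simp add: S_def g.scaleR)
  then have ne: "S \<noteq> {}" by blast
  define d where "d = (INF x\<in>S. (norm x)\<^sup>2)"
  have bdd: "bdd_below ((\<lambda>x. (norm x)\<^sup>2) ` S)" by (auto intro!: bdd_belowI2[of _ 0])
  have dle: "d \<le> (norm x)\<^sup>2" if "x \<in> S" for x
    unfolding d_def using bdd that by (rule cINF_lower)
  have "\<exists>x\<in>S. (norm x)\<^sup>2 < d + 1 / real (Suc n)" for n
    using cINF_less_iff[OF ne bdd, of "d + 1 / real (Suc n)"] by (simp add: d_def)
  then obtain X where X: "\<And>n. X n \<in> S" "\<And>n. (norm (X n))\<^sup>2 < d + 1 / real (Suc n)" by metis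
  have mid: "4 * d \<le> (norm (x + y))\<^sup>2" if "x \<in> S" "y \<in> S" for x y
  proof -
    have "(1/2) *\<^sub>R (x + y) \<in> S" using that by (simp add: S_def g.scaleR g.add)
    from dle[OF this] show ?thesis by (simp add: power_divide)
  qed
  \<comment> \<open>Parallelogram law: midpoints of points of \<open>S\<close> stay in
    \<open>S\<close>, so a sum of two of them has squared norm at least
    \<open>4 * d\<close>.\<close>
  have XX: "(norm (X n - X m))\<^sup>2 \<le> 2 / real (Suc n) + 2 / real (Suc m)" for n m
  proof -
    have "(norm (X n - X m))\<^sup>2 = 2 * (norm (X n))\<^sup>2 + 2 * (norm (X m))\<^sup>2 - (norm (X n + X m))\<^sup>2"
      unfolding power2_norm_eq_inner by (simp add: inner_simps inner_commute)
    with mid[OF X(1)[of n] X(1)[of m]] X(2)[of n] X(2)[of m] show ?thesis by simp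
  qed
  have "Cauchy X"
  proof (rule CauchyI)
    fix e :: real assume e: "0 < e"
    obtain N where N: "4 / e\<^sup>2 < real (Suc N)" using reals_Archimedean2 less_trans
      by (metis of_nat_less_iff lessI)
    then have N': "4 / real (Suc N) < e\<^sup>2"
      using e by (simp add: field_simps)
    have "norm (X m - X n) < e" if "m \<ge> N" "n \<ge> N" for m n
    proof -
      have "2 / real (Suc m) \<le> 2 / real (Suc N)" "2 / real (Suc n) \<le> 2 / real (Suc N)"
        using that by (auto intro!: divide_left_mono)
      with XX[of m n] N' have "(norm (X m - X n))\<^sup>2 < e\<^sup>2" by simp
      then show ?thesis using e by (simp add: power2_less_imp_less)
    qed
    then show "\<exists>M. \<forall>m\<ge>M. \<forall>n\<ge>M. norm (X m - X n) < e" by blast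
  qed
  then obtain y where y: "X \<longlonglongrightarrow> y" using Cauchy_convergent convergent_def by blast
  have gy: "g y = 1"
    using LIMSEQ_unique[OF g.tendsto[OF y]] X(1) by (simp add: S_def)
  have "(\<lambda>n. (norm (X n))\<^sup>2) \<longlonglongrightarrow> (norm y)\<^sup>2" by (intro tendsto_intros y)
  moreover have "(\<lambda>n. d + 1 / real (Suc n)) \<longlonglongrightarrow> d + 0"
    by (intro tendsto_intros lim_1_over_n[THEN LIMSEQ_Suc])
  ultimately have "(norm y)\<^sup>2 \<le> d + 0"
    by (rule LIMSEQ_le) (use X(2) less_imp_le in blast)
  then have yd: "(norm y)\<^sup>2 \<le> d" by simp
  have orth: "inner y v = 0" if "g v = 0" for v
  proof (rule ccontr)
    assume a: "inner y v \<noteq> 0"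
    then have v: "inner v v > 0" by (metis inner_gt_zero_iff inner_zero_right)
    \<comment> \<open>The minimiser of the norm along the line through \<open>y\<close> in direction
      \<open>v\<close>; it would beat the minimum unless \<open>inner y v = 0\<close>.\<close>
    define t where "t = - inner y v / inner v v"
    have "y + t *\<^sub>R v \<in> S" using gy that by (simp add: S_def g.scaleR g.add)
    then have "(norm y)\<^sup>2 \<le> (norm (y + t *\<^sub>R v))\<^sup>2" using dle yd order_trans by blast
    also have "\<dots> = (norm y)\<^sup>2 + 2 * t * inner y v + t\<^sup>2 * inner v v"
      unfolding power2_norm_eq_inner by (simp add: inner_simps inner_commute power2_eq_square)
    also have "\<dots> = (norm y)\<^sup>2 - (inner y v)\<^sup>2 / inner v v"
      using v by (simp add: t_def field_simps power2_eq_square)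
    finally have "(inner y v)\<^sup>2 / inner v v \<le> 0" by simp
    moreover have "(inner y v)\<^sup>2 / inner v v > 0" using a v by simp
    ultimately show False by simp
  qed
  have y0: "inner y y > 0" using gy g.zero by (metis inner_gt_zero_iff zero_neq_one)
  have "g x = inner ((1 / inner y y) *\<^sub>R y) x" for x
  proof -
    \<comment> \<open>Every \<open>x\<close> is \<open>g x *\<^sub>R y\<close> plus an element of
      the kernel of \<open>g\<close>, to which \<open>y\<close> is orthogonal.\<close>
    have "g (x - g x *\<^sub>R y) = 0" by (simp add: g.diff g.scaleR gy)
    from orth[OF this] show ?thesis using y0 by (simp add: inner_simps field_simps)
  qed
  then show ?thesis by blast
qed

section \<open>Adjoint operators\<close>

lemma real_adjoint_exists:
  fixes T :: "'a::{real_inner, complete_space} \<Rightarrow>\<^sub>L 'a"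
  shows "\<exists>S :: 'a \<Rightarrow>\<^sub>L 'a. \<forall>x y. inner (S x) y = inner x (T y)"
proof -
  have "\<exists>z. \<forall>y. inner x (T y) = inner z y" for x
    by (rule riesz_representation) (rule bounded_linear_compose[OF bounded_linear_inner_right blinfun.bounded_linear_right])
  then obtain S where S: "\<And>x y. inner x (T y) = inner (S x) y" by metis
  have "bounded_linear S"
  proof (rule bounded_linear_intro[of _ "norm T"])
    show "S (x + y) = S x + S y" for x y
      by (rule vector_eq_rdot[THEN iffD1]) (simp add: S[symmetric] inner_simps)
    show "S (r *\<^sub>R x) = r *\<^sub>R S x" for r x
      by (rule vector_eq_rdot[THEN iffD1]) (simp add: S[symmetric] inner_simps)
    show "norm (S x) \<le> norm x * norm T" for x
    proof (cases "S x = 0")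
      case False
      have "(norm (S x))\<^sup>2 = inner x (T (S x))" by (simp add: S power2_norm_eq_inner)
      also have "\<dots> \<le> norm x * norm (T (S x))" by (rule norm_cauchy_schwarz)
      also have "\<dots> \<le> norm x * (norm T * norm (S x))" by (intro mult_left_mono norm_blinfun) simp
      finally have "norm (S x) * norm (S x) \<le> (norm x * norm T) * norm (S x)"
        by (simp add: power2_eq_square mult_ac)
      then show ?thesis using False by simp
    qed simp
  qed
  then show ?thesis
    by (intro exI[of _ "Blinfun S"]) (simp add: bounded_linear_Blinfun_apply S)
qed

text \<open>The real adjoint of a complex-linear \<open>T\<close> is also its complex adjoint:
  \<open>T\<close> commutes with multiplication by i, so the imaginary part of the defining identity
  follows from the real part. Hence the description in \<open>adj\<close> has exactly one candidate,
  the one supplied by Riesz.\<close>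

lemma adj_characterization:
  fixes S T :: "'h::complex_hilbert op"
  assumes T: "T \<in> bounded_ops"
  shows adj_bounded_ops: "adj T \<in> bounded_ops"
    and inner_adj_left: "inner (adj T x) y = inner x (T y)"
    and adj_unique: "(\<And>x y. inner (S x) y = inner x (T y)) \<Longrightarrow> adj T = S"
proof -
  obtain S0 :: "'h op" where S0: "\<And>x y. inner (S0 x) y = inner x (T y)"
    using real_adjoint_exists[of T] by blast
  have eq: "(\<forall>x y. cinner (S x) y = cinner x (T y)) \<longleftrightarrow> S = S0" for S :: "'h op"
  proof
    assume "\<forall>x y. cinner (S x) y = cinner x (T y)"
    then have "inner (S x) y = inner (S0 x) y" for x y by (simp add: S0 cinner_eq_iff)
    then have "S x = S0 x" for x by (rule vector_eq_rdot[THEN iffD1, OF allI])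
    then show "S = S0" by (rule blinfun_eqI)
  next
    assume "S = S0"
    then show "\<forall>x y. cinner (S x) y = cinner x (T y)"
      by (simp add: cinner_eq_iff S0 bounded_opsD[OF T])
  qed
  have adj: "adj T = S0" unfolding adj_def eq by simp
  show "inner (adj T x) y = inner x (T y)" by (simp add: adj S0)
  have "S0 (c *C x) = c *C S0 x" for c x
    by (rule vector_eq_rdot[THEN iffD1]) (simp add: S0 inner_scaleC_left bounded_opsD[OF T])
  then show "adj T \<in> bounded_ops" by (simp add: adj bounded_ops_def)
  assume S: "\<And>x y. inner (S x) y = inner x (T y)"
  have "inner (S x) y = inner (S0 x) y" for x y by (simp add: S S0)
  then have "S x = S0 x" for x by (rule vector_eq_rdot[THEN iffD1, OF allI])
  then show "adj T = S" unfolding adj by (metis blinfun_eqI)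
qed

lemma inner_adj_right: "T \<in> bounded_ops \<Longrightarrow> inner x (adj T y) = inner (T x) (y::'h::complex_hilbert)"
  by (metis inner_adj_left inner_commute)

lemma adj_eqI:
  fixes S T :: "'h::complex_hilbert op"
  assumes "T \<in> bounded_ops" "S \<in> bounded_ops" "\<And>x y. inner (S x) y = inner x (T y)"
  shows "adj T = S"
  using assms adj_unique by blast

lemma adj_add: "S \<in> bounded_ops \<Longrightarrow> T \<in> bounded_ops \<Longrightarrow> adj (S + T) = adj S + adj (T :: 'h::complex_hilbert op)"
  and adj_diff: "S \<in> bounded_ops \<Longrightarrow> T \<in> bounded_ops \<Longrightarrow> adj (S - T) = adj S - adj (T :: 'h::complex_hilbert op)"
  and adj_scaleR: "T \<in> bounded_ops \<Longrightarrow> adj (r *\<^sub>R T) = r *\<^sub>R adj T"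
  and adj_compose: "S \<in> bounded_ops \<Longrightarrow> T \<in> bounded_ops \<Longrightarrow> adj (S o\<^sub>L T) = adj T o\<^sub>L adj S"
  and adj_adj: "T \<in> bounded_ops \<Longrightarrow> adj (adj T) = T"
  by (intro adj_eqI; simp add: bounded_ops_add bounded_ops_diff bounded_ops_scaleR bounded_ops_compose adj_bounded_ops
      blinfun.bilinear_simps inner_simps inner_adj_left inner_adj_right)+

lemma norm_adj_le: "T \<in> bounded_ops \<Longrightarrow> norm (adj T) \<le> norm (T :: 'h::complex_hilbert op)"
proof (rule norm_blinfun_bound)
  fix x assume T: "T \<in> bounded_ops"
  show "norm (adj T x) \<le> norm T * norm x"
  proof (cases "adj T x = 0")
    case False
    have "(norm (adj T x))\<^sup>2 = inner x (T (adj T x))" by (simp add: T inner_adj_left power2_norm_eq_inner)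
    also have "\<dots> \<le> norm x * norm (T (adj T x))" by (rule norm_cauchy_schwarz)
    also have "\<dots> \<le> norm x * (norm T * norm (adj T x))" by (intro mult_left_mono norm_blinfun) simp
    finally have "norm (adj T x) * norm (adj T x) \<le> (norm T * norm x) * norm (adj T x)"
      by (simp add: power2_eq_square mult_ac)
    then show ?thesis using False by simp
  qed simp
qed simp

section \<open>Selfadjoint and positive operators\<close>

lemma selfadjoint_iff:
  "selfadjoint T \<longleftrightarrow> T \<in> bounded_ops \<and> (\<forall>x y. inner (T x) y = inner x (T (y::'h::complex_hilbert)))"
  unfolding selfadjoint_def using inner_adj_left adj_unique by metis

lemma selfadjoint_bounded_ops: "selfadjoint T \<Longrightarrow> T \<in> bounded_ops"
  by (simp add: selfadjoint_def)

lemma selfadjoint_inner: "selfadjoint T \<Longrightarrow> inner (T x) y = inner x (T (y::'h::complex_hilbert))"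
  by (simp add: selfadjoint_iff)

lemma selfadjoint_0: "selfadjoint 0"
  and selfadjoint_id: "selfadjoint id_blinfun"
  by (auto simp: selfadjoint_iff bounded_ops_0 bounded_ops_id)

lemma selfadjoint_add: "selfadjoint S \<Longrightarrow> selfadjoint T \<Longrightarrow> selfadjoint (S + T)"
  and selfadjoint_diff: "selfadjoint S \<Longrightarrow> selfadjoint T \<Longrightarrow> selfadjoint (S - T)"
  and selfadjoint_scaleR: "selfadjoint T \<Longrightarrow> selfadjoint (r *\<^sub>R T)"
  by (auto simp: selfadjoint_iff bounded_ops_add bounded_ops_diff bounded_ops_scaleR blinfun.bilinear_simps inner_simps)

lemma selfadjoint_sandwich: "selfadjoint T \<Longrightarrow> Z \<in> bounded_ops \<Longrightarrow> selfadjoint (adj Z o\<^sub>L T o\<^sub>L Z)"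
  by (auto simp: selfadjoint_iff bounded_ops_compose adj_bounded_ops inner_adj_left inner_adj_right)

lemma selfadjoint_conj: "selfadjoint T \<Longrightarrow> selfadjoint Z \<Longrightarrow> selfadjoint (Z o\<^sub>L T o\<^sub>L Z)"
  using selfadjoint_sandwich[of T Z] by (simp add: selfadjoint_def)

lemma selfadjoint_limit:
  assumes "\<And>n. selfadjoint (X n)" "X \<longlonglongrightarrow> T" shows "selfadjoint T"
  unfolding selfadjoint_iff
proof (intro conjI allI)
  show "T \<in> bounded_ops" using bounded_ops_limit[of X T] assms by (simp add: selfadjoint_iff)
  fix x y
  have "(\<lambda>n. inner (X n x) y) \<longlonglongrightarrow> inner (T x) y" "(\<lambda>n. inner x (X n y)) \<longlonglongrightarrow> inner x (T y)"
    by (intro tendsto_intros blinfun.tendsto assms)+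
  then show "inner (T x) y = inner x (T y)"
    using LIMSEQ_unique assms(1) by (force simp: selfadjoint_inner)
qed

text \<open>On a complex space a quadratic form with real values is symmetric, by polarisation.
  Conversely, symmetry and complex linearity make the imaginary part of
  \<open>cinner x (T x)\<close> equal to its own negative.\<close>

lemma positive_op_iff:
  "positive_op T \<longleftrightarrow> selfadjoint T \<and> (\<forall>x::'h::complex_hilbert. 0 \<le> inner x (T x))"
proof
  assume T: "positive_op T"
  then have bT: "T \<in> bounded_ops" and pos: "\<And>x. cinner x (T x) \<in> \<real>\<^sub>\<ge>\<^sub>0" by (auto simp: positive_op_def)
  have im: "inner x (\<i> *C T x) = 0" for x
    using pos[of x] Im_cinner[of x "T x"] by (auto simp: complex_nonneg_Reals_iff)
  have "inner (T x) y = inner x (T y)" for x y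
  proof -
    \<comment> \<open>Evaluating the vanishing imaginary part at \<open>x - \<i> *C y\<close> leaves
      exactly the cross terms that express symmetry.\<close>
    let ?w = "(- \<i>) *C y"
    have "inner (x + ?w) (\<i> *C T (x + ?w)) = 0" by (rule im)
    moreover have "\<i> *C T ?w = T y"
      by (simp add: bounded_opsD[OF bT] scaleC_scaleC scaleC_one)
    ultimately have "inner x (T y) + inner ?w (\<i> *C T x) = 0"
      using im[of x] im[of ?w] by (simp add: blinfun.add_right scaleC_add_right inner_simps)
    moreover have "inner ?w (\<i> *C T x) = - inner y (T x)"
      using scaleC_of_real[of "-1" "T x"] by (simp add: inner_scaleC_left scaleC_scaleC)
    ultimately show ?thesis by (simp add: inner_commute)
  qed
  then show "selfadjoint T \<and> (\<forall>x. 0 \<le> inner x (T x))"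
    using bT pos by (auto simp: selfadjoint_iff complex_nonneg_Reals_iff Re_cinner)
next
  assume T: "selfadjoint T \<and> (\<forall>x. 0 \<le> inner x (T x))"
  have "inner x (\<i> *C T x) = 0" for x
  proof -
    have "inner x (\<i> *C T x) = inner x (T (\<i> *C x))" using T by (simp add: bounded_opsD selfadjoint_bounded_ops)
    also have "\<dots> = inner (T x) (\<i> *C x)" using T by (simp add: selfadjoint_inner)
    also have "\<dots> = - inner x (\<i> *C T x)"
    proof -
      have "inner (\<i> *C x) (T x) = inner x ((-\<i>) *C T x)" by (simp add: inner_scaleC_left)
      also have "(-\<i>) *C T x = - (\<i> *C T x)"
        using scaleC_of_real[of "-1" "\<i> *C T x"] by (simp add: scaleC_scaleC)
      finally show ?thesis by (simp add: inner_commute)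
    qed
    finally show ?thesis by simp
  qed
  then show "positive_op T"
    using T by (auto simp: positive_op_def selfadjoint_iff complex_nonneg_Reals_iff Re_cinner Im_cinner)
qed

lemma positive_opD: "positive_op T \<Longrightarrow> 0 \<le> inner x (T (x::'h::complex_hilbert))"
  and positive_op_selfadjoint: "positive_op T \<Longrightarrow> selfadjoint T"
  by (auto simp: positive_op_iff)

lemma positive_op_0: "positive_op 0"
  and positive_op_id: "positive_op id_blinfun"
  by (auto simp: positive_op_iff selfadjoint_0 selfadjoint_id)

lemma positive_op_add: "positive_op S \<Longrightarrow> positive_op T \<Longrightarrow> positive_op (S + T)"
  and positive_op_scaleR: "r \<ge> 0 \<Longrightarrow> positive_op T \<Longrightarrow> positive_op (r *\<^sub>R T)"
  by (auto simp: positive_op_iff selfadjoint_add selfadjoint_scaleR blinfun.bilinear_simps inner_simps)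

lemma positive_op_sandwich: "positive_op T \<Longrightarrow> Z \<in> bounded_ops \<Longrightarrow> positive_op (adj Z o\<^sub>L T o\<^sub>L Z)"
  by (simp add: positive_op_iff selfadjoint_sandwich inner_adj_right)

lemma positive_op_conj: "positive_op T \<Longrightarrow> selfadjoint Z \<Longrightarrow> positive_op (Z o\<^sub>L T o\<^sub>L Z)"
  using positive_op_sandwich[of T Z] by (simp add: selfadjoint_def)

lemma positive_op_adj_self: "Z \<in> bounded_ops \<Longrightarrow> positive_op (adj Z o\<^sub>L Z)"
  by (simp add: positive_op_iff selfadjoint_iff bounded_ops_compose adj_bounded_ops inner_adj_left inner_adj_right)

lemma positive_op_self_adj: "Z \<in> bounded_ops \<Longrightarrow> positive_op (Z o\<^sub>L adj Z)"
  using positive_op_adj_self[of "adj Z"] by (simp add: adj_adj adj_bounded_ops)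

lemma inner_op_le_norm:
  fixes T :: "'h::complex_hilbert op"
  shows "\<bar>inner x (T x)\<bar> \<le> norm T * (norm x)\<^sup>2"
proof -
  have "\<bar>inner x (T x)\<bar> \<le> norm x * norm (T x)" by (rule Cauchy_Schwarz_ineq2)
  also have "\<dots> \<le> norm x * (norm T * norm x)" by (intro mult_left_mono norm_blinfun) simp
  finally show ?thesis by (simp add: power2_eq_square mult_ac)
qed

text \<open>Expand \<open>0 \<le> \<langle>K x - T x, T (K x - T x)\<rangle>\<close>.\<close>

lemma positive_op_norm_sq_le:
  fixes T :: "'h::complex_hilbert op"
  assumes T: "positive_op T" and K: "\<And>x. inner x (T x) \<le> K * (norm x)\<^sup>2"
  shows "(norm (T x))\<^sup>2 \<le> K * inner x (T x)"
proof -
  have sa: "\<And>x y. inner (T x) y = inner x (T y)" using T by (simp add: positive_op_iff selfadjoint_inner)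
  have K0: "K \<ge> 0 \<or> (\<forall>x::'h. x = 0)"
  proof (rule ccontr)
    assume "\<not> ?thesis"
    then obtain x :: 'h where "K < 0" "x \<noteq> 0" by auto
    then have "K * (norm x)\<^sup>2 < 0" by (simp add: mult_neg_pos)
    with K[of x] positive_opD[OF T, of x] show False by simp
  qed
  show ?thesis
  proof (cases "K > 0")
    case True
    have "0 \<le> inner (K *\<^sub>R x - T x) (T (K *\<^sub>R x - T x))" by (rule positive_opD[OF T])
    also have "\<dots> = K\<^sup>2 * inner x (T x) - 2 * K * (norm (T x))\<^sup>2 + inner (T x) (T (T x))"
      by (simp add: blinfun.bilinear_simps inner_simps dot_square_norm power2_eq_square sa[of x "T x", symmetric] algebra_simps)
    also have "\<dots> \<le> K\<^sup>2 * inner x (T x) - 2 * K * (norm (T x))\<^sup>2 + K * (norm (T x))\<^sup>2"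
      using K[of "T x"] by simp
    finally have "K * (K * inner x (T x) - (norm (T x))\<^sup>2) \<ge> 0" by (simp add: power2_eq_square algebra_simps)
    then show ?thesis using True by (simp add: zero_le_mult_iff)
  next
    case False
    show ?thesis
    proof (cases "\<forall>x::'h. x = 0")
      case True
      then have "T x = 0" "x = 0" by blast+
      then show ?thesis by simp
    next
      case nz: False
      then have "K = 0" using K0 False by auto
      have z: "inner y (T y) = 0" for y using K[of y] positive_opD[OF T, of y] \<open>K = 0\<close> by simp
      \<comment> \<open>The form vanishes identically here, and its cross term at
        \<open>x + T x\<close> is twice the squared norm of \<open>T x\<close>.\<close>
      have "inner (x + T x) (T (x + T x)) = 0" by (rule z)
      then have "2 * inner (T x) (T x) = 0" using z[of x] z[of "T x"]
        by (simp add: blinfun.bilinear_simps inner_simps sa[of x "T x", symmetric])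
      then show ?thesis using \<open>K = 0\<close> by simp
    qed
  qed
qed

section \<open>Continuous functional calculus\<close>

text \<open>Bounds on the numerical range rather than on the spectrum: they add, survive convex
  combinations, and confine the real spectrum to \<open>{a..b}\<close>.\<close>

definition op_between :: "real \<Rightarrow> real \<Rightarrow> 'h::complex_hilbert op \<Rightarrow> bool" where
  "op_between a b T \<longleftrightarrow> selfadjoint T \<and>
     (\<forall>x. a * (norm x)\<^sup>2 \<le> inner x (T x) \<and> inner x (T x) \<le> b * (norm x)\<^sup>2)"

lemma op_betweenD:
  assumes "op_between a b T"
  shows "selfadjoint T" "a * (norm x)\<^sup>2 \<le> inner x (T x)" "inner x (T x) \<le> b * (norm x)\<^sup>2"
  using assms by (auto simp: op_between_def)

lemma op_between_mono:
  "op_between a b T \<Longrightarrow> a' \<le> a \<Longrightarrow> b \<le> b' \<Longrightarrow> op_between a' b' T"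
  unfolding op_between_def by (meson mult_right_mono order_trans zero_le_power2)

lemma op_between_norm: "selfadjoint T \<Longrightarrow> norm T \<le> K \<Longrightarrow> op_between (- K) K T"
  unfolding op_between_def
proof (intro conjI allI)
  fix x assume K: "norm T \<le> K"
  have "\<bar>inner x (T x)\<bar> \<le> norm T * (norm x)\<^sup>2" by (rule inner_op_le_norm)
  also have "\<dots> \<le> K * (norm x)\<^sup>2" using K by (intro mult_right_mono) auto
  finally show "- K * (norm x)\<^sup>2 \<le> inner x (T x)" "inner x (T x) \<le> K * (norm x)\<^sup>2" by auto
qed

lemma op_between_add:
  "op_between a b S \<Longrightarrow> op_between c d T \<Longrightarrow> op_between (a + c) (b + d) (S + T)"
  unfolding op_between_def
  by (auto simp: selfadjoint_add blinfun.bilinear_simps inner_simps distrib_right intro!: add_mono)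

lemma op_between_scaleR:
  "r \<ge> 0 \<Longrightarrow> op_between a b T \<Longrightarrow> op_between (r * a) (r * b) (r *\<^sub>R T)"
  unfolding op_between_def
  by (auto simp: selfadjoint_scaleR blinfun.bilinear_simps mult.assoc intro!: mult_left_mono)

lemma op_between_id: "op_between r r (r *\<^sub>R id_blinfun)"
  by (simp add: op_between_def selfadjoint_scaleR selfadjoint_id blinfun.bilinear_simps power2_norm_eq_inner)

lemma positive_op_between: "positive_op T \<Longrightarrow> norm T \<le> K \<Longrightarrow> op_between 0 K T"
  using op_between_norm[of T K] by (auto simp: op_between_def positive_op_iff)

lemma op_between_positive: "op_between a b T \<Longrightarrow> 0 \<le> a \<Longrightarrow> positive_op T"
  unfolding op_between_def positive_op_iff by (meson mult_nonneg_nonneg order_trans zero_le_power2)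

lemma op_between_segment:
  assumes "op_between a b S" "op_between a b (S + T)" "0 \<le> u" "u \<le> 1"
  shows "op_between a b (S + u *\<^sub>R T)"
proof -
  have "op_between ((1-u) * a + u * a) ((1-u) * b + u * b) ((1-u) *\<^sub>R S + u *\<^sub>R (S + T))"
    using assms by (intro op_between_add op_between_scaleR) auto
  then show ?thesis by (simp add: algebra_simps)
qed

text \<open>Lax--Milgram for a symmetric form: \<open>x \<mapsto> x - \<alpha> (T x - y)\<close> is a contraction for small \<open>\<alpha>\<close>.\<close>

lemma coercive_invertible:
  fixes T :: "'h::complex_hilbert op"
  assumes T: "T \<in> bounded_ops" and d: "0 < d" and co: "\<And>x. d * (norm x)\<^sup>2 \<le> inner x (T x)"
  shows "\<exists>R\<in>bounded_ops. R o\<^sub>L T = id_blinfun \<and> T o\<^sub>L R = id_blinfun"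
proof -
  \<comment> \<open>Adding \<open>d\<close> gives \<open>d \<le> K\<close>, so that the square root
    below is taken of a nonnegative number.\<close>
  define K where "K = norm T + d"
  have K: "K > 0" "norm T \<le> K" "d \<le> K" using d by (auto simp: K_def add_nonneg_pos)
  \<comment> \<open>This step size minimises the bound \<open>1 - 2 * a * d + (a * K)^2\<close> for
    the squared contraction factor; the minimum is \<open>1 - (d / K)^2\<close>.\<close>
  define a where "a = d / K\<^sup>2"
  define c where "c = sqrt (1 - d\<^sup>2 / K\<^sup>2)"
  have dK: "d\<^sup>2 / K\<^sup>2 \<le> 1" "d\<^sup>2 / K\<^sup>2 > 0" using d K by (auto simp: power_mono)
  have c: "0 \<le> c" "c < 1" "c\<^sup>2 = 1 - d\<^sup>2 / K\<^sup>2" using dK by (auto simp: c_def real_sqrt_lt_1_iff)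
  have contr: "norm (x - a *\<^sub>R T x) \<le> c * norm x" for x
  proof -
    have "(norm (T x))\<^sup>2 \<le> (K * norm x)\<^sup>2"
      using order_trans[OF norm_blinfun[of T x] mult_right_mono[OF K(2)]] by (intro power_mono) auto
    then have 1: "a\<^sup>2 * (norm (T x))\<^sup>2 \<le> a\<^sup>2 * (K\<^sup>2 * (norm x)\<^sup>2)" by (intro mult_left_mono) (auto simp: power_mult_distrib)
    have 2: "a * (d * (norm x)\<^sup>2) \<le> a * inner x (T x)" using co d K by (intro mult_left_mono) (auto simp: a_def)
    have "(norm (x - a *\<^sub>R T x))\<^sup>2 = (norm x)\<^sup>2 - 2 * (a * inner x (T x)) + a\<^sup>2 * (norm (T x))\<^sup>2"
      unfolding power2_norm_eq_inner by (simp add: inner_simps inner_commute power2_eq_square)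
    also have "\<dots> \<le> (norm x)\<^sup>2 - 2 * (a * (d * (norm x)\<^sup>2)) + a\<^sup>2 * (K\<^sup>2 * (norm x)\<^sup>2)" using 1 2 by linarith
    also have "\<dots> = c\<^sup>2 * (norm x)\<^sup>2" using K unfolding c(3) a_def by (simp add: field_simps power2_eq_square)
    finally have "(norm (x - a *\<^sub>R T x))\<^sup>2 \<le> (c * norm x)\<^sup>2" by (simp add: power_mult_distrib)
    then show ?thesis by (rule power2_le_imp_le) (use c in simp)
  qed
  have a: "a > 0" using d K by (simp add: a_def)
  have sol: "\<exists>x. T x = y" for y
  proof -
    have "\<exists>!x. x - a *\<^sub>R (T x - y) = x"
    proof (rule banach_fix_type[OF c(1,2)], intro allI)
      fix x x'
      have "dist (x - a *\<^sub>R (T x - y)) (x' - a *\<^sub>R (T x' - y)) = norm ((x - x') - a *\<^sub>R T (x - x'))"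
        by (simp add: dist_norm blinfun.diff_right algebra_simps)
      then show "dist (x - a *\<^sub>R (T x - y)) (x' - a *\<^sub>R (T x' - y)) \<le> c * dist x x'"
        using contr[of "x - x'"] by (simp add: dist_norm)
    qed
    then obtain x where "x - a *\<^sub>R (T x - y) = x" by blast
    then have "a *\<^sub>R (T x - y) = 0" by simp
    then show ?thesis using a by auto
  qed
  have low: "d * norm x \<le> norm (T x)" for x
  proof (cases "x = 0")
    case False
    have "d * (norm x)\<^sup>2 \<le> norm x * norm (T x)"
      using co[of x] norm_cauchy_schwarz[of x "T x"] by linarith
    then have "norm x * (d * norm x) \<le> norm x * norm (T x)" by (simp add: power2_eq_square mult_ac)
    then show ?thesis using False by simp
  qed simp
  have inj: "x = y" if "T x = T y" for x y
    using low[of "x - y"] that d by (simp add: blinfun.diff_right mult_le_0_iff)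
  from sol obtain R where R: "\<And>y. T (R y) = y" by metis
  have "bounded_linear R"
  proof (rule bounded_linear_intro[of _ "1 / d"])
    show "R (x + y) = R x + R y" for x y by (rule inj) (simp add: R blinfun.add_right)
    show "R (r *\<^sub>R x) = r *\<^sub>R R x" for r x by (rule inj) (simp add: R blinfun.scaleR_right)
    show "norm (R x) \<le> norm x * (1 / d)" for x using low[of "R x"] d by (simp add: R field_simps)
  qed
  then have ap: "blinfun_apply (Blinfun R) = R" by (rule bounded_linear_Blinfun_apply)
  have "R (c *C x) = c *C R x" for c x by (rule inj) (simp add: R bounded_opsD[OF T])
  then have "Blinfun R \<in> bounded_ops" by (simp add: bounded_ops_def ap)
  moreover have "Blinfun R o\<^sub>L T = id_blinfun" by (rule blinfun_eqI) (simp add: ap R inj)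
  moreover have "T o\<^sub>L Blinfun R = id_blinfun" by (rule blinfun_eqI) (simp add: ap R)
  ultimately show ?thesis by blast
qed

text \<open>For real \<open>r\<close> below \<open>a\<close> the operator \<open>T - r\<close> is
  coercive, and for \<open>r\<close> above \<open>b\<close> its negative is; coercive operators are
  invertible.\<close>

lemma real_spectrum_subset:
  fixes T :: "'h::complex_hilbert op"
  assumes T: "op_between a b T"
  shows "{r. complex_of_real r \<in> spectrum T} \<subseteq> {a..b}"
proof
  fix r assume r: "r \<in> {r. complex_of_real r \<in> spectrum T}"
  let ?S = "T - r *\<^sub>R id_blinfun"
  have bT: "T \<in> bounded_ops" using T by (simp add: op_between_def selfadjoint_iff)
  have bS: "?S \<in> bounded_ops" by (intro bounded_ops_diff bounded_ops_scaleR bounded_ops_id bT)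
  have no: "\<not> (\<exists>R\<in>bounded_ops. R o\<^sub>L ?S = id_blinfun \<and> ?S o\<^sub>L R = id_blinfun)"
    using r by (simp add: spectrum_def scalar_op_of_real)
  have in_eq: "inner x (?S x) = inner x (T x) - r * (norm x)\<^sup>2" for x
    by (simp add: blinfun.bilinear_simps inner_simps power2_norm_eq_inner)
  have "\<not> r < a"
  proof
    assume "r < a"
    have "(a - r) * (norm x)\<^sup>2 \<le> inner x (?S x)" for x
      unfolding in_eq using op_betweenD(2)[OF T, of x] by (simp add: algebra_simps)
    with coercive_invertible[OF bS, of "a - r"] \<open>r < a\<close> no show False by simp
  qed
  moreover have "\<not> b < r"
  proof
    assume "b < r"
    have "(r - b) * (norm x)\<^sup>2 \<le> inner x ((- ?S) x)" for x
      unfolding blinfun.minus_left inner_minus_right in_eq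
      using op_betweenD(3)[OF T, of x] by (simp add: algebra_simps)
    with coercive_invertible[OF bounded_ops_uminus[OF bS], of "r - b"] \<open>b < r\<close>
    obtain R where R: "R \<in> bounded_ops" "R o\<^sub>L (- ?S) = id_blinfun" "(- ?S) o\<^sub>L R = id_blinfun" by auto
    have "(- R) o\<^sub>L ?S = id_blinfun" "?S o\<^sub>L (- R) = id_blinfun"
      using R(2,3) by (auto simp: fun_eq_iff blinfun.bilinear_simps simp flip: blinfun_apply_inject)
    with no bounded_ops_uminus[OF R(1)] show False by blast
  qed
  ultimately show "r \<in> {a..b}" by simp
qed

section \<open>Polynomials of an operator\<close>

lemma poly_op_altdef:
  assumes "degree p \<le> n"
  shows "poly_op p T = (\<Sum>i\<le>n. coeff p i *\<^sub>R (((o\<^sub>L) T ^^ i) id_blinfun))"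
  unfolding poly_op_def
  by (rule sum.mono_neutral_left) (use assms in \<open>auto simp: coeff_eq_0\<close>)

lemma poly_op_0 [simp]: "poly_op 0 T = 0"
  by (simp add: poly_op_def)

text \<open>Horner form: it turns the later facts about \<open>poly_op\<close> into inductions on
  the polynomial.\<close>

lemma poly_op_pCons [simp]: "poly_op (pCons a p) T = a *\<^sub>R id_blinfun + (T o\<^sub>L poly_op p T)"
proof -
  have "poly_op (pCons a p) T = (\<Sum>i\<le>Suc (degree p). coeff (pCons a p) i *\<^sub>R (((o\<^sub>L) T ^^ i) id_blinfun))"
    by (rule poly_op_altdef) (simp add: degree_pCons_le)
  also have "\<dots> = a *\<^sub>R id_blinfun + (\<Sum>i\<le>degree p. coeff p i *\<^sub>R (T o\<^sub>L (((o\<^sub>L) T ^^ i) id_blinfun)))"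
    by (subst sum.atMost_Suc_shift) simp
  also have "(\<Sum>i\<le>degree p. coeff p i *\<^sub>R (T o\<^sub>L (((o\<^sub>L) T ^^ i) id_blinfun))) = T o\<^sub>L poly_op p T"
    by (rule blinfun_eqI) (simp add: poly_op_def blinfun.bilinear_simps blinfun.sum_left blinfun.sum_right)
  finally show ?thesis .
qed

lemma poly_op_add: "poly_op (p + q) T = poly_op p T + poly_op q T"
proof (induction p arbitrary: q)
  case (pCons a p)
  show ?case
  proof (cases q)
    case (pCons b q')
    with pCons.IH[of q'] show ?thesis
      by (intro blinfun_eqI) (simp add: blinfun.bilinear_simps algebra_simps)
  qed
qed simp

lemma poly_op_smult: "poly_op (smult c p) T = c *\<^sub>R poly_op p T"
  by (induction p) (auto intro!: blinfun_eqI simp: blinfun.bilinear_simps algebra_simps)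

lemma poly_op_minus: "poly_op (- p) T = - poly_op p T"
  using poly_op_smult[of "-1" p T] by simp

lemma poly_op_diff: "poly_op (p - q) T = poly_op p T - poly_op q T"
  using poly_op_add[of p "- q" T] by (simp add: poly_op_minus)

lemma poly_op_mult: "poly_op (p * q) T = poly_op p T o\<^sub>L poly_op q T"
proof (induction p)
  case (pCons a p)
  show ?case unfolding mult_pCons_left poly_op_add poly_op_smult poly_op_pCons pCons.IH
    by (intro blinfun_eqI) (simp add: blinfun.bilinear_simps)
qed simp

lemma poly_op_commute: "S o\<^sub>L T = T o\<^sub>L S \<Longrightarrow> S o\<^sub>L poly_op p T = poly_op p T o\<^sub>L S"
proof (induction p)
  case (pCons a p)
  show ?case
  proof (rule blinfun_eqI)
    fix x
    have "S (T y) = T (S y)" "S (poly_op p T y) = poly_op p T (S y)" for y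
      using pCons.prems pCons.IH[OF pCons.prems] by (metis blinfun_apply_blinfun_compose)+
    then show "(S o\<^sub>L poly_op (pCons a p) T) x = (poly_op (pCons a p) T o\<^sub>L S) x"
      by (simp add: blinfun.bilinear_simps)
  qed
qed simp

lemma selfadjoint_poly_op: "selfadjoint T \<Longrightarrow> selfadjoint (poly_op p T)"
proof (induction p)
  case (pCons a p)
  have c: "T o\<^sub>L poly_op p T = poly_op p T o\<^sub>L T" by (rule poly_op_commute) simp
  have "selfadjoint (T o\<^sub>L poly_op p T)"
    unfolding selfadjoint_iff
  proof (intro conjI allI)
    show "T o\<^sub>L poly_op p T \<in> bounded_ops"
      using pCons by (simp add: bounded_ops_compose selfadjoint_bounded_ops)
    fix x y
    have "inner ((T o\<^sub>L poly_op p T) x) y = inner x (poly_op p T (T y))"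
      using pCons by (simp add: selfadjoint_inner)
    also have "poly_op p T (T y) = (T o\<^sub>L poly_op p T) y" unfolding c by simp
    finally show "inner ((T o\<^sub>L poly_op p T) x) y = inner x ((T o\<^sub>L poly_op p T) y)" .
  qed
  then show ?case by (simp add: selfadjoint_add selfadjoint_scaleR selfadjoint_id)
qed (simp add: selfadjoint_0)

section \<open>The norm of a polynomial of an operator and the spectrum\<close>

definition bounded_below :: "('a::real_normed_vector \<Rightarrow>\<^sub>L 'b::real_normed_vector) \<Rightarrow> bool" where
  "bounded_below T \<longleftrightarrow> (\<exists>d>0. \<forall>x. d * norm x \<le> norm (T x))"

lemma bounded_below_compose: "bounded_below S \<Longrightarrow> bounded_below T \<Longrightarrow> bounded_below (S o\<^sub>L T)"
proof -
  assume "bounded_below S" "bounded_below T"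
  then obtain d e where de: "d > 0" "e > 0" "\<And>x. d * norm x \<le> norm (S x)" "\<And>x. e * norm x \<le> norm (T x)"
    unfolding bounded_below_def by blast
  have "d * e * norm x \<le> norm (S (T x))" for x
    using order_trans[OF mult_left_mono[OF de(4)[of x], of d] de(3)[of "T x"]] de(1) by (simp add: mult.assoc)
  then show ?thesis unfolding bounded_below_def using de by (intro exI[of _ "d * e"]) auto
qed

lemma map_poly_of_real_add:
  "map_poly complex_of_real (p + q) = map_poly complex_of_real p + map_poly complex_of_real q"
  by (intro poly_eqI) (simp add: coeff_map_poly)

lemma map_poly_of_real_mult:
  "map_poly complex_of_real (p * q) = map_poly complex_of_real p * map_poly complex_of_real q"
  by (intro poly_eqI) (simp add: coeff_map_poly coeff_mult)

lemma poly_map_poly_of_real: "poly (map_poly complex_of_real p) (of_real r) = of_real (poly p r)"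
  by (induction p) (auto simp: map_poly_pCons)

text \<open>Half of the spectral mapping theorem, by splitting off factors. The notion passes to
  products at once, with no question of surjectivity. A real root gives a linear factor, bounded
  below by assumption; a nonreal root \<open>a + \<i> b\<close> gives the factor
  \<open>(x - a)^2 + b^2\<close>, whose quadratic form on a selfadjoint operator is at least
  \<open>b^2\<close>.\<close>

lemma bounded_below_poly_op:
  fixes T :: "'h::complex_hilbert op"
  assumes T: "selfadjoint T" and q: "q \<noteq> 0"
    and roots: "\<And>r. poly q r = 0 \<Longrightarrow> bounded_below (T - r *\<^sub>R id_blinfun)"
  shows "bounded_below (poly_op q T)"
  using q roots
proof (induction "degree q" arbitrary: q rule: less_induct)
  case less
  show ?case
  proof (cases "degree q = 0")
    case True
    then obtain c where q: "q = [:c:]" by (rule degree_eq_zeroE)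
    then have "c \<noteq> 0" using less.prems by simp
    then show ?thesis unfolding bounded_below_def
      by (intro exI[of _ "\<bar>c\<bar>"]) (simp add: q blinfun.bilinear_simps)
  next
    case False
    have step: "bounded_below (poly_op q T)" if ql: "q = l * q1" and l: "bounded_below (poly_op l T)" "degree l > 0" for l q1
    proof -
      have "q1 \<noteq> 0" "l \<noteq> 0" using less.prems ql by auto
      then have "degree q1 < degree q" using l by (simp add: ql degree_mult_eq)
      moreover have "bounded_below (T - r *\<^sub>R id_blinfun)" if "poly q1 r = 0" for r
        using less.prems(2)[of r] that by (simp add: ql)
      ultimately have "bounded_below (poly_op q1 T)" using less.hyps \<open>q1 \<noteq> 0\<close> by blast
      then show ?thesis unfolding ql poly_op_mult using l by (intro bounded_below_compose)
    qed
    let ?Q = "map_poly complex_of_real q"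
    have "\<not> constant (poly ?Q)"
      using False by (simp add: constant_degree degree_map_poly)
    then obtain z where z: "poly ?Q z = 0" using fundamental_theorem_of_algebra by blast
    show ?thesis
    proof (cases "Im z = 0")
      case True
      then have "z = of_real (Re z)" by (simp add: complex_eq_iff)
      then have r: "poly q (Re z) = 0" using z by (metis of_real_eq_0_iff poly_map_poly_of_real)
      then obtain q1 where q1: "q = [:- Re z, 1:] * q1" by (metis poly_eq_0_iff_dvd dvdE)
      have "poly_op [:- Re z, 1:] T = T - Re z *\<^sub>R id_blinfun"
        by (intro blinfun_eqI) (simp add: blinfun.bilinear_simps)
      then show ?thesis using step[OF q1] less.prems(2)[OF r] by simp
    next
      case False
      define a b where "a = Re z" and "b = Im z"
      \<comment> \<open>The real polynomial with roots \<open>z\<close> and its conjugate.\<close>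
      define l where "l = [:a\<^sup>2 + b\<^sup>2, - 2 * a, 1:]"
      have L: "map_poly complex_of_real l = [:- z, 1:] * [:- cnj z, 1:]"
        by (simp add: l_def a_def b_def map_poly_pCons complex_eq_iff power2_eq_square)
      obtain m where m: "q = l * (q div l) + q mod l" by simp
      define s where "s = q mod l"
      \<comment> \<open>The remainder modulo \<open>l\<close> has degree at most one and vanishes at
        the nonreal \<open>z\<close>, so it is zero and \<open>l\<close> divides
        \<open>q\<close>.\<close>
      have "degree s < 2 \<or> s = 0" using degree_mod_less[of l q] by (auto simp: s_def l_def)
      then have "degree s \<le> 1" by auto
      then have "s = [:coeff s 0, coeff s 1:]"
        by (intro poly_eqI) (auto simp: coeff_pCons coeff_eq_0 split: nat.split)
      then obtain c0 c1 where s: "s = [:c0, c1:]" by blast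
      have "poly (map_poly complex_of_real (l * (q div l) + s)) z = 0" using z m s_def by simp
      then have "poly (map_poly complex_of_real s) z = 0"
        by (simp add: map_poly_of_real_add map_poly_of_real_mult L algebra_simps)
      then have "of_real c0 + z * of_real c1 = 0" by (simp add: s map_poly_pCons)
      then have "s = 0" using False s by (auto simp: complex_eq_iff)
      then have ql: "q = l * (q div l)" unfolding s_def by (metis dvd_mult_div_cancel mod_0_imp_dvd)
      have "bounded_below (poly_op l T)"
      proof -
        have "b\<^sup>2 * norm x \<le> norm (poly_op l T x)" for x
        proof (cases "x = 0")
          case nz: False
          let ?y = "T x - a *\<^sub>R x"
          have "inner x (poly_op l T x) = inner ?y ?y + b\<^sup>2 * inner x x"
            using selfadjoint_inner[OF T, of x x] selfadjoint_inner[OF T, of x "T x"]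
            by (simp add: l_def blinfun.bilinear_simps inner_simps inner_commute power2_eq_square algebra_simps)
          then have "b\<^sup>2 * inner x x \<le> inner x (poly_op l T x)" by simp
          also have "\<dots> \<le> norm x * norm (poly_op l T x)" by (rule norm_cauchy_schwarz)
          finally have "norm x * (b\<^sup>2 * norm x) \<le> norm x * norm (poly_op l T x)"
            by (simp add: power2_norm_eq_inner[symmetric] power2_eq_square mult_ac)
          then show ?thesis using nz by simp
        qed simp
        moreover have "b\<^sup>2 > 0" using False by (simp add: b_def)
        ultimately show ?thesis unfolding bounded_below_def by blast
      qed
      then show ?thesis using step[OF ql] by (simp add: l_def)
    qed
  qed
qed

text \<open>The squared norm is an approximate eigenvalue of \<open>S o\<^sub>L S\<close>. With
  \<open>c = norm S\<close>, a gap \<open>d\<close> would give, on expanding the square, the bound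
  \<open>c^2 - d^2 / c^2\<close> for the squared norm of \<open>S\<close>, against the choice of
  \<open>c\<close>.\<close>

lemma not_bounded_below_norm:
  fixes S :: "'h::complex_hilbert op"
  assumes S: "selfadjoint S" and nz: "S \<noteq> 0"
  shows "\<not> bounded_below ((S o\<^sub>L S) - (norm S)\<^sup>2 *\<^sub>R id_blinfun)"
proof
  assume "bounded_below ((S o\<^sub>L S) - (norm S)\<^sup>2 *\<^sub>R id_blinfun)"
  then obtain d where d: "d > 0" "\<And>x. d * norm x \<le> norm (S (S x) - (norm S)\<^sup>2 *\<^sub>R x)"
    unfolding bounded_below_def by (auto simp: blinfun.bilinear_simps)
  define c where "c = norm S"
  have c: "c > 0" using nz by (simp add: c_def)
  have "(norm (S x))\<^sup>2 \<le> (c\<^sup>2 - d\<^sup>2 / c\<^sup>2) * (norm x)\<^sup>2" for x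
  proof -
    have "d\<^sup>2 * (norm x)\<^sup>2 \<le> (norm (S (S x) - c\<^sup>2 *\<^sub>R x))\<^sup>2"
      using power_mono[OF d(2)[of x], of 2] d(1) by (simp add: power_mult_distrib c_def)
    also have "\<dots> = (norm (S (S x)))\<^sup>2 - 2 * c\<^sup>2 * (norm (S x))\<^sup>2 + c^4 * (norm x)\<^sup>2"
      unfolding power2_norm_eq_inner using selfadjoint_inner[OF S, of "S x" x]
      by (simp add: inner_simps inner_commute power2_eq_square power4_eq_xxxx)
    also have "(norm (S (S x)))\<^sup>2 \<le> (c * norm (S x))\<^sup>2"
      unfolding c_def by (intro power_mono norm_blinfun) simp
    finally have "d\<^sup>2 * (norm x)\<^sup>2 \<le> c^4 * (norm x)\<^sup>2 - c\<^sup>2 * (norm (S x))\<^sup>2"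
      by (simp add: power_mult_distrib)
    then have "c\<^sup>2 * (norm (S x))\<^sup>2 \<le> c\<^sup>2 * ((c\<^sup>2 - d\<^sup>2 / c\<^sup>2) * (norm x)\<^sup>2)"
      using c by (simp add: algebra_simps power2_eq_square power4_eq_xxxx)
    then show ?thesis using c by simp
  qed
  note * = this
  have e0: "0 \<le> c\<^sup>2 - d\<^sup>2 / c\<^sup>2"
  proof (rule ccontr)
    assume neg: "\<not> ?thesis"
    obtain x where "S x \<noteq> 0" using nz by (metis blinfun_eqI zero_blinfun.rep_eq)
    then have "x \<noteq> 0" by auto
    then have "(c\<^sup>2 - d\<^sup>2 / c\<^sup>2) * (norm x)\<^sup>2 < 0" using neg by (intro mult_neg_pos) auto
    with *[of x] show False by (meson not_less order_trans zero_le_power2)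
  qed
  have "norm S \<le> sqrt (c\<^sup>2 - d\<^sup>2 / c\<^sup>2)"
  proof (rule norm_blinfun_bound)
    show "norm (S x) \<le> sqrt (c\<^sup>2 - d\<^sup>2 / c\<^sup>2) * norm x" for x
      by (rule power2_le_imp_le) (use * e0 in \<open>auto simp: power_mult_distrib\<close>)
  qed (use e0 in simp)
  then have "c\<^sup>2 \<le> c\<^sup>2 - d\<^sup>2 / c\<^sup>2" using e0 c by (metis c_def norm_ge_zero power_mono real_sqrt_pow2)
  moreover have "d\<^sup>2 / c\<^sup>2 > 0" using c d by simp
  ultimately show False by simp
qed

text \<open>Nonemptiness of the approximate point spectrum; \<open>S \<noteq> 0\<close> expresses
  that the space is not trivial. If it were empty, the polynomial \<open>x^2 - (norm T)^2\<close>
  would be bounded below at \<open>T\<close>, against the preceding fact.\<close>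

lemma exists_not_bounded_below:
  fixes S T :: "'h::complex_hilbert op"
  assumes T: "selfadjoint T" and "S \<noteq> 0"
  shows "\<exists>r. \<not> bounded_below (T - r *\<^sub>R id_blinfun)"
proof (cases "T = 0")
  case True
  have "\<not> bounded_below (T - 0 *\<^sub>R id_blinfun)"
  proof
    assume "bounded_below (T - 0 *\<^sub>R id_blinfun)"
    then obtain d where "d > 0" "\<And>x::'h. d * norm x \<le> 0" using True by (auto simp: bounded_below_def)
    then have "x = 0" for x :: 'h by (meson mult_pos_pos not_le zero_less_norm_iff)
    then have "S = 0" by (intro blinfun_eqI) metis
    with \<open>S \<noteq> 0\<close> show False by simp
  qed
  then show ?thesis by blast
next
  case False
  show ?thesis
  proof (rule ccontr)
    assume "\<not> ?thesis"
    then have "bounded_below (poly_op [:- (norm T)\<^sup>2, 0, 1:] T)"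
      by (intro bounded_below_poly_op[OF T]) auto
    moreover have "poly_op [:- (norm T)\<^sup>2, 0, 1:] T = (T o\<^sub>L T) - (norm T)\<^sup>2 *\<^sub>R id_blinfun"
      by (intro blinfun_eqI) (simp add: blinfun.bilinear_simps)
    ultimately show False using not_bounded_below_norm[OF T False] by simp
  qed
qed

text \<open>For \<open>c = norm (p(T))\<close> the operator \<open>p(T)\<^sup>2 - c\<^sup>2\<close> is not bounded below, hence neither is
  \<open>T - r\<close> for some real root \<open>r\<close> of \<open>p\<^sup>2 - c\<^sup>2\<close>.\<close>

lemma norm_poly_op_le_spectrum:
  fixes T :: "'h::complex_hilbert op"
  assumes T: "selfadjoint T" and K: "0 \<le> K"
    and bnd: "\<And>r. complex_of_real r \<in> spectrum T \<Longrightarrow> \<bar>poly p r\<bar> \<le> K"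
  shows "norm (poly_op p T) \<le> K"
proof (rule ccontr)
  let ?S = "poly_op p T"
  define c where "c = norm ?S"
  assume "\<not> norm ?S \<le> K"
  then have cK: "c > K" by (simp add: c_def)
  then have "?S \<noteq> 0" using K by (auto simp: c_def)
  define q where "q = p * p - [:c\<^sup>2:]"
  have qS: "poly_op q T = (?S o\<^sub>L ?S) - c\<^sup>2 *\<^sub>R id_blinfun"
    by (simp add: q_def poly_op_diff poly_op_mult)
  have nb: "\<not> bounded_below (poly_op q T)"
    unfolding qS c_def by (rule not_bounded_below_norm[OF selfadjoint_poly_op[OF T] \<open>?S \<noteq> 0\<close>])
  \<comment> \<open>Off the spectrum a left inverse \<open>R\<close> yields the lower bound
    \<open>1 / (norm R + 1)\<close>, where the summand 1 avoids division by zero.\<close>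
  have bb: "bounded_below (T - r *\<^sub>R id_blinfun)" if "complex_of_real r \<notin> spectrum T" for r
  proof -
    from that obtain R where R: "R o\<^sub>L (T - r *\<^sub>R id_blinfun) = id_blinfun"
      by (auto simp: spectrum_def scalar_op_of_real)
    have "1 / (norm R + 1) * norm x \<le> norm ((T - r *\<^sub>R id_blinfun) x)" for x
    proof -
      let ?y = "(T - r *\<^sub>R id_blinfun) x"
      have "x = R ?y" using R by (metis blinfun_apply_blinfun_compose blinfun_apply_id_blinfun)
      then have "norm x \<le> norm R * norm ?y" by (metis norm_blinfun)
      also have "\<dots> \<le> (norm R + 1) * norm ?y" by (intro mult_right_mono) auto
      finally show ?thesis by (simp add: add_nonneg_pos pos_divide_le_eq mult.commute)
    qed
    moreover have "1 / (norm R + 1) > 0" by (simp add: add_nonneg_pos)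
    ultimately show ?thesis unfolding bounded_below_def by blast
  qed
  \<comment> \<open>A spectral point exists and \<open>q\<close> does not vanish there; this
    excludes \<open>q = 0\<close>, the case of a constant \<open>p\<close> with square
    \<open>c^2\<close>.\<close>
  obtain r where r: "complex_of_real r \<in> spectrum T"
    using bb exists_not_bounded_below[OF T \<open>?S \<noteq> 0\<close>] by blast
  have pos: "poly q r \<noteq> 0" if "complex_of_real r \<in> spectrum T" for r
  proof
    assume "poly q r = 0"
    then have "(poly p r)\<^sup>2 = c\<^sup>2" by (simp add: q_def power2_eq_square)
    then have "\<bar>poly p r\<bar> = \<bar>c\<bar>" by (simp add: power2_eq_iff abs_eq_iff)
    with bnd[OF that] cK K show False by simp
  qed
  have "q \<noteq> 0" using pos[OF r] by auto
  then have "bounded_below (poly_op q T)"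
    using bb pos by (intro bounded_below_poly_op[OF T]) blast+
  with nb show False by blast
qed


lemma norm_poly_op_le:
  assumes T: "op_between a b T" and "0 \<le> K" and "\<And>r. r \<in> {a..b} \<Longrightarrow> \<bar>poly p r\<bar> \<le> K"
  shows "norm (poly_op p T) \<le> K"
  using real_spectrum_subset[OF T] assms by (intro norm_poly_op_le_spectrum) (auto simp: op_between_def)

section \<open>Continuous functions of an operator\<close>

lemma poly_uniform_approximation:
  fixes g :: "real \<Rightarrow> real"
  assumes g: "continuous_on {a..b} g"
  shows "\<exists>p. uniform_limit {a..b} (\<lambda>n. poly (p n)) g sequentially"
proof -
  have "\<exists>p. \<forall>x\<in>{a..b}. \<bar>poly p x - g x\<bar> < e" if "e > 0" for e :: real
  proof -
    obtain h where h: "polynomial_function h" "\<forall>x\<in>{a..b}. norm (g x - h x) < e"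
      using Stone_Weierstrass_polynomial_function[OF compact_Icc g \<open>e > 0\<close>] by blast
    then obtain c n where c: "h = (\<lambda>x. \<Sum>i\<le>n. c i * x ^ i)"
      using real_polynomial_function_iff_sum real_polynomial_function_eq by metis
    have "poly (\<Sum>i\<le>n. monom (c i) i) = h" by (auto simp: c poly_sum poly_monom)
    with h show ?thesis by (intro exI[of _ "\<Sum>i\<le>n. monom (c i) i"]) (auto simp: abs_minus_commute)
  qed
  then have "\<exists>p. \<forall>x\<in>{a..b}. \<bar>poly p x - g x\<bar> < inverse (real (Suc n))" for n by simp
  then obtain p where p: "\<And>n x. x \<in> {a..b} \<Longrightarrow> \<bar>poly (p n) x - g x\<bar> < inverse (real (Suc n))" by metis
  have "uniform_limit {a..b} (\<lambda>n. poly (p n)) g sequentially"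
  proof (rule uniform_limitI)
    fix e :: real assume "0 < e"
    with LIMSEQ_inverse_real_of_nat have "\<forall>\<^sub>F n in sequentially. inverse (real (Suc n)) < e"
      by (rule order_tendstoD)
    then show "\<forall>\<^sub>F n in sequentially. \<forall>x\<in>{a..b}. dist (poly (p n) x) (g x) < e"
      by eventually_elim (use p in \<open>force simp: dist_real_def intro: less_trans\<close>)
  qed
  then show ?thesis by blast
qed

text \<open>The description in \<open>fun_calc\<close> is unambiguous: two approximating sequences
  differ by little on the real spectrum, and the norm of a polynomial of \<open>T\<close> is bounded
  by its size there. A bound over an enclosing interval would not do, since the approximation is
  only assumed on the spectrum.\<close>

lemma fun_calc_eqI:
  assumes T: "selfadjoint T"
    and p: "uniform_limit {r. complex_of_real r \<in> spectrum T} (\<lambda>n. poly (p n)) f sequentially"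
    and S: "(\<lambda>n. poly_op (p n) T) \<longlonglongrightarrow> S"
  shows "fun_calc f T = S"
  unfolding fun_calc_def
proof (rule the_equality)
  let ?\<sigma> = "{r. complex_of_real r \<in> spectrum T}"
  show "\<exists>p. uniform_limit ?\<sigma> (\<lambda>n. poly (p n)) f sequentially \<and> (\<lambda>n. poly_op (p n) T) \<longlonglongrightarrow> S"
    using p S by blast
  fix S' assume "\<exists>p. uniform_limit ?\<sigma> (\<lambda>n. poly (p n)) f sequentially \<and> (\<lambda>n. poly_op (p n) T) \<longlonglongrightarrow> S'"
  then obtain q where q: "uniform_limit ?\<sigma> (\<lambda>n. poly (q n)) f sequentially" "(\<lambda>n. poly_op (q n) T) \<longlonglongrightarrow> S'" by blast
  have "(\<lambda>n. poly_op (p n - q n) T) \<longlonglongrightarrow> 0"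
  proof (rule tendstoI)
    fix e :: real assume e: "0 < e"
    then have "e / 4 > 0" by simp
    from uniform_limitD[OF p this] uniform_limitD[OF q(1) this]
    have "\<forall>\<^sub>F n in sequentially. norm (poly_op (p n - q n) T) \<le> e / 2"
    proof eventually_elim
      case (elim n)
      show ?case
      proof (rule norm_poly_op_le_spectrum[OF T])
        fix r assume r: "complex_of_real r \<in> spectrum T"
        then have "\<bar>poly (p n) r - f r\<bar> < e / 4" "\<bar>poly (q n) r - f r\<bar> < e / 4"
          using elim by (auto simp: dist_real_def)
        then show "\<bar>poly (p n - q n) r\<bar> \<le> e / 2" by (simp add: abs_if split: if_splits)
      qed (use e in simp)
    qed
    then show "\<forall>\<^sub>F n in sequentially. dist (poly_op (p n - q n) T) 0 < e"
      by eventually_elim (use e in simp)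
  qed
  moreover have "(\<lambda>n. poly_op (p n - q n) T) \<longlonglongrightarrow> S - S'"
    unfolding poly_op_diff by (intro tendsto_diff S q)
  ultimately have "S - S' = 0" using LIMSEQ_unique by blast
  then show "S' = S" by simp
qed

text \<open>Existence of the limit. From here on an interval with \<open>op_between a b T\<close>
  takes the place of the spectrum.\<close>

lemma poly_op_tendsto_fun_calc:
  assumes T: "op_between a b T"
    and p: "uniform_limit {a..b} (\<lambda>n. poly (p n)) f sequentially"
  shows "(\<lambda>n. poly_op (p n) T) \<longlonglongrightarrow> fun_calc f T"
proof -
  have "Cauchy (\<lambda>n. poly_op (p n) T)"
  proof (rule CauchyI)
    fix e :: real assume e: "0 < e"
    then have "e / 4 > 0" by simp
    from uniform_limitD[OF p this] obtain N
      where N: "\<And>n x. n \<ge> N \<Longrightarrow> x \<in> {a..b} \<Longrightarrow> \<bar>poly (p n) x - f x\<bar> < e / 4"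
      unfolding eventually_sequentially dist_real_def by blast
    have "norm (poly_op (p m) T - poly_op (p n) T) < e" if "m \<ge> N" "n \<ge> N" for m n
    proof -
      have "norm (poly_op (p m - p n) T) \<le> e / 2"
      proof (rule norm_poly_op_le[OF T])
        fix r assume r: "r \<in> {a..b}"
        show "\<bar>poly (p m - p n) r\<bar> \<le> e / 2"
          using N[OF that(1) r] N[OF that(2) r] by (simp add: abs_if split: if_splits)
      qed (use e in simp)
      then show ?thesis using e by (simp add: poly_op_diff)
    qed
    then show "\<exists>M. \<forall>m\<ge>M. \<forall>n\<ge>M. norm (poly_op (p m) T - poly_op (p n) T) < e" by blast
  qed
  then obtain S where S: "(\<lambda>n. poly_op (p n) T) \<longlonglongrightarrow> S" using Cauchy_convergent convergent_def by blast
  have "fun_calc f T = S"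
    using T by (intro fun_calc_eqI[OF _ uniform_limit_on_subset[OF p real_spectrum_subset[OF T]] S])
      (simp add: op_between_def)
  with S show ?thesis by simp
qed

lemma fun_calc_cong:
  assumes "op_between a b T" "\<And>r. r \<in> {a..b} \<Longrightarrow> f r = g r"
  shows "fun_calc f T = fun_calc g T"
proof -
  have "uniform_limit {r. complex_of_real r \<in> spectrum T} p f sequentially =
        uniform_limit {r. complex_of_real r \<in> spectrum T} p g sequentially" for p :: "nat \<Rightarrow> real \<Rightarrow> real"
    by (rule uniform_limit_cong') (use real_spectrum_subset[OF assms(1)] assms(2) in auto)
  then show ?thesis by (simp add: fun_calc_def)
qed

lemma fun_calc_poly: "op_between a b T \<Longrightarrow> fun_calc (poly p) T = poly_op p T"
  using poly_op_tendsto_fun_calc[of a b T "\<lambda>_. p" "poly p"] LIMSEQ_unique tendsto_const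
  by (metis uniform_limit_const)

lemma poly_fun_pCons: "poly (pCons a p) = (\<lambda>x. a + x * poly p x)"
  and poly_fun_add: "poly (p + q) = (\<lambda>x. poly p x + poly q x)"
  and poly_fun_mult: "poly (p * q) = (\<lambda>x. poly p x * poly q x)"
  by (simp_all add: fun_eq_iff)

lemma fun_calc_const: "op_between a b T \<Longrightarrow> fun_calc (\<lambda>_. c) T = c *\<^sub>R id_blinfun"
  using fun_calc_poly[of a b T "[:c:]"] by (simp add: poly_fun_pCons)

lemma fun_calc_ident: "op_between a b T \<Longrightarrow> fun_calc (\<lambda>r. r) T = T"
  using fun_calc_poly[of a b T "[:0, 1:]"] by (simp add: poly_fun_pCons) (simp add: blinfun_eqI)

lemma fun_calc_affine: "op_between a b T \<Longrightarrow> fun_calc (\<lambda>r. c * r + d) T = c *\<^sub>R T + d *\<^sub>R id_blinfun"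
  using fun_calc_poly[of a b T "[:d, c:]"]
  by (simp add: poly_fun_pCons add.commute mult.commute) (auto intro!: blinfun_eqI simp: blinfun.bilinear_simps)

section \<open>Algebra and order of the calculus\<close>

context
  fixes a b :: real and T :: "'h::complex_hilbert op"
  assumes T: "op_between a b T"
begin

lemma selfadjoint_fun_calc:
  assumes f: "continuous_on {a..b} f" shows "selfadjoint (fun_calc f T)"
proof -
  obtain p where p: "uniform_limit {a..b} (\<lambda>n. poly (p n)) f sequentially"
    using poly_uniform_approximation[OF f] by blast
  show ?thesis
    by (rule selfadjoint_limit[OF _ poly_op_tendsto_fun_calc[OF T p]])
       (use T in \<open>simp add: selfadjoint_poly_op op_between_def\<close>)
qed

lemma fun_calc_add:
  assumes f: "continuous_on {a..b} f" and g: "continuous_on {a..b} g"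
  shows "fun_calc (\<lambda>r. f r + g r) T = fun_calc f T + fun_calc g T"
proof -
  obtain p q where p: "uniform_limit {a..b} (\<lambda>n. poly (p n)) f sequentially"
    and q: "uniform_limit {a..b} (\<lambda>n. poly (q n)) g sequentially"
    using poly_uniform_approximation f g by meson
  have "uniform_limit {a..b} (\<lambda>n. poly (p n + q n)) (\<lambda>r. f r + g r) sequentially"
    using uniform_limit_add[OF p q] by (simp add: poly_fun_add)
  from poly_op_tendsto_fun_calc[OF T this]
    tendsto_add[OF poly_op_tendsto_fun_calc[OF T p] poly_op_tendsto_fun_calc[OF T q]]
  show ?thesis by (simp add: poly_op_add LIMSEQ_unique)
qed

lemma fun_calc_mult:
  assumes f: "continuous_on {a..b} f" and g: "continuous_on {a..b} g"
  shows "fun_calc (\<lambda>r. f r * g r) T = fun_calc f T o\<^sub>L fun_calc g T"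
proof -
  obtain p q where p: "uniform_limit {a..b} (\<lambda>n. poly (p n)) f sequentially"
    and q: "uniform_limit {a..b} (\<lambda>n. poly (q n)) g sequentially"
    using poly_uniform_approximation f g by meson
  have "bounded (f ` {a..b})" "bounded (g ` {a..b})"
    using f g by (auto intro!: compact_imp_bounded compact_continuous_image)
  with p q have "uniform_limit {a..b} (\<lambda>n r. poly (p n) r * poly (q n) r) (\<lambda>r. f r * g r) sequentially"
    by (intro uniform_lim_mult)
  then have "uniform_limit {a..b} (\<lambda>n. poly (p n * q n)) (\<lambda>r. f r * g r) sequentially" by (simp add: poly_fun_mult)
  from poly_op_tendsto_fun_calc[OF T this]
    blinfun_compose.tendsto[OF poly_op_tendsto_fun_calc[OF T p] poly_op_tendsto_fun_calc[OF T q]]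
  show ?thesis by (simp add: poly_op_mult LIMSEQ_unique)
qed

lemma fun_calc_scale:
  assumes f: "continuous_on {a..b} f"
  shows "fun_calc (\<lambda>r. c * f r) T = c *\<^sub>R fun_calc f T"
  using fun_calc_mult[OF continuous_on_const f, of c] fun_calc_const[OF T]
  by (auto intro!: blinfun_eqI simp: blinfun.bilinear_simps)

lemma fun_calc_diff:
  assumes f: "continuous_on {a..b} f" and g: "continuous_on {a..b} g"
  shows "fun_calc (\<lambda>r. f r - g r) T = fun_calc f T - fun_calc g T"
  using fun_calc_add[OF f, of "\<lambda>r. (-1) * g r"] fun_calc_scale[OF g, of "-1"] g
  by (simp add: continuous_on_minus)

text \<open>A nonnegative function is a square, so its operator is a selfadjoint operator times
  itself.\<close>

lemma positive_fun_calc: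
  assumes f: "continuous_on {a..b} f" and pos: "\<And>r. r \<in> {a..b} \<Longrightarrow> 0 \<le> f r"
  shows "positive_op (fun_calc f T)"
proof -
  let ?g = "\<lambda>r. sqrt (f r)"
  have g: "continuous_on {a..b} ?g" using f by (intro continuous_intros)
  have "fun_calc f T = fun_calc (\<lambda>r. ?g r * ?g r) T"
    by (rule fun_calc_cong[OF T]) (use pos in simp)
  also have "\<dots> = fun_calc ?g T o\<^sub>L fun_calc ?g T" by (rule fun_calc_mult[OF g g])
  finally show ?thesis
    using positive_op_adj_self[of "fun_calc ?g T"] selfadjoint_fun_calc[OF g]
    by (simp add: selfadjoint_def)
qed

lemma op_between_fun_calc:
  assumes f: "continuous_on {a..b} f" and pos: "\<And>r. r \<in> {a..b} \<Longrightarrow> f r \<in> {c..d}"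
  shows "op_between c d (fun_calc f T)"
proof -
  have 1: "positive_op (fun_calc (\<lambda>r. f r - c) T)"
    using pos by (intro positive_fun_calc continuous_intros f) auto
  have 2: "positive_op (fun_calc (\<lambda>r. d - f r) T)"
    using pos by (intro positive_fun_calc continuous_intros f) auto
  have "fun_calc (\<lambda>r. f r - c) T = fun_calc f T - c *\<^sub>R id_blinfun"
    "fun_calc (\<lambda>r. d - f r) T = d *\<^sub>R id_blinfun - fun_calc f T"
    using f by (simp_all add: fun_calc_diff fun_calc_const[OF T] continuous_on_const)
  with 1 2 have "0 \<le> inner x ((fun_calc f T - c *\<^sub>R id_blinfun) x)" "0 \<le> inner x ((d *\<^sub>R id_blinfun - fun_calc f T) x)" for x
    by (simp_all only: positive_opD)
  then show ?thesis
    using selfadjoint_fun_calc[OF f]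
    by (auto simp: op_between_def blinfun.bilinear_simps inner_simps power2_norm_eq_inner)
qed

lemma norm_fun_calc_le:
  assumes f: "continuous_on {a..b} f" and K: "0 \<le> K" "\<And>r. r \<in> {a..b} \<Longrightarrow> \<bar>f r\<bar> \<le> K"
  shows "norm (fun_calc f T) \<le> K"
proof (rule field_le_epsilon)
  obtain p where p: "uniform_limit {a..b} (\<lambda>n. poly (p n)) f sequentially"
    using poly_uniform_approximation[OF f] by blast
  fix e :: real assume e: "0 < e"
  have "\<forall>\<^sub>F n in sequentially. norm (poly_op (p n) T) \<le> K + e"
    using uniform_limitD[OF p e]
  proof eventually_elim
    case (elim n)
    show ?case
    proof (rule norm_poly_op_le[OF T])
      fix r assume r: "r \<in> {a..b}"
      show "\<bar>poly (p n) r\<bar> \<le> K + e"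
        using elim[rule_format, OF r] K(2)[OF r] by (simp add: dist_real_def abs_if split: if_splits)
    qed (use K e in simp)
  qed
  moreover have "(\<lambda>n. norm (poly_op (p n) T)) \<longlonglongrightarrow> norm (fun_calc f T)"
    by (intro tendsto_norm poly_op_tendsto_fun_calc[OF T p])
  ultimately show "norm (fun_calc f T) \<le> K + e"
    using tendsto_upperbound trivial_limit_sequentially by blast
qed

lemma norm_fun_calc_diff_le:
  assumes f: "continuous_on {a..b} f" and g: "continuous_on {a..b} g"
    and K: "0 \<le> K" "\<And>r. r \<in> {a..b} \<Longrightarrow> \<bar>f r - g r\<bar> \<le> K"
  shows "norm (fun_calc f T - fun_calc g T) \<le> K"
  unfolding fun_calc_diff[OF f g, symmetric]
  by (rule norm_fun_calc_le) (use K in \<open>auto intro!: continuous_intros f g\<close>)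

lemma fun_calc_uniform_limit:
  assumes f: "\<And>n. continuous_on {a..b} (f n)" and l: "uniform_limit {a..b} f g sequentially"
  shows "(\<lambda>n. fun_calc (f n) T) \<longlonglongrightarrow> fun_calc g T"
proof (rule LIMSEQ_I)
  have g: "continuous_on {a..b} g"
    using uniform_limit_theorem[OF _ l] f by simp
  fix e :: real assume e: "0 < e"
  then have "e / 2 > 0" by simp
  from uniform_limitD[OF l this] obtain N
    where N: "\<And>n x. n \<ge> N \<Longrightarrow> x \<in> {a..b} \<Longrightarrow> \<bar>f n x - g x\<bar> < e / 2"
    unfolding eventually_sequentially dist_real_def by blast
  have "norm (fun_calc (f n) T - fun_calc g T) \<le> e / 2" if "n \<ge> N" for n
    using e N[OF that] by (intro norm_fun_calc_diff_le f g) (auto intro: less_imp_le)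
  then show "\<exists>N. \<forall>n\<ge>N. norm (fun_calc (f n) T - fun_calc g T) < e"
    using e by (metis half_gt_zero_iff field_sum_of_halves less_add_same_cancel1 order_le_less_trans)
qed

text \<open>For polynomial \<open>g\<close> this is multiplicativity of the calculus, and both sides
  are continuous under uniform convergence of \<open>g\<close> on \<open>{c..d}\<close>.\<close>

lemma fun_calc_compose:
  assumes u: "continuous_on {a..b} u" "\<And>r. r \<in> {a..b} \<Longrightarrow> u r \<in> {c..d}" and g: "continuous_on {c..d} g"
  shows "fun_calc g (fun_calc u T) = fun_calc (\<lambda>r. g (u r)) T"
proof -
  have uT: "op_between c d (fun_calc u T)" by (rule op_between_fun_calc[OF u])
  have *: "poly_op p (fun_calc u T) = fun_calc (\<lambda>r. poly p (u r)) T" for p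
  proof (induction p)
    case 0 then show ?case by (simp add: fun_calc_const[OF T])
  next
    case (pCons a p)
    show ?case using u
      by (simp add: pCons.IH fun_calc_add fun_calc_mult fun_calc_const[OF T] continuous_intros)
  qed
  obtain p where p: "uniform_limit {c..d} (\<lambda>n. poly (p n)) g sequentially"
    using poly_uniform_approximation[OF g] by blast
  have "uniform_limit {a..b} (\<lambda>n r. poly (p n) (u r)) (\<lambda>r. g (u r)) sequentially"
    using uniform_limit_compose'[OF p, where h = u and B = "{a..b}"] u(2) by auto
  then have "(\<lambda>n. fun_calc (\<lambda>r. poly (p n) (u r)) T) \<longlonglongrightarrow> fun_calc (\<lambda>r. g (u r)) T"
    by (intro fun_calc_uniform_limit continuous_intros u)
  moreover have "(\<lambda>n. fun_calc (\<lambda>r. poly (p n) (u r)) T) \<longlonglongrightarrow> fun_calc g (fun_calc u T)"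
    using poly_op_tendsto_fun_calc[OF uT p] by (simp add: *)
  ultimately show ?thesis using LIMSEQ_unique by blast
qed

end

lemma fun_calc_shift:
  assumes T: "op_between a b T" and g: "continuous_on {a + c..b + c} g"
  shows "fun_calc g (T + c *\<^sub>R id_blinfun) = fun_calc (\<lambda>r. g (r + c)) T"
proof -
  have "T + c *\<^sub>R id_blinfun = fun_calc (\<lambda>r. r + c) T"
    using fun_calc_affine[OF T, of 1 c] by simp
  then show ?thesis
    using fun_calc_compose[OF T, of "\<lambda>r. r + c" "a + c" "b + c" g] g
    by (simp add: continuous_intros)
qed

section \<open>Dependence on the operator\<close>

lemma continuous_on_poly_op:
  "continuous_on S X \<Longrightarrow> continuous_on S (\<lambda>s. poly_op p (X s))"
  by (induction p) (auto intro!: continuous_intros blinfun_compose.continuous_on)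

text \<open>The polynomial approximations converge uniformly in \<open>s\<close> because a single
  interval serves all \<open>X s\<close>.\<close>

lemma continuous_on_fun_calc:
  assumes X: "continuous_on S X" "\<And>s. s \<in> S \<Longrightarrow> op_between a b (X s)" and f: "continuous_on {a..b} f"
  shows "continuous_on S (\<lambda>s. fun_calc f (X s))"
proof -
  obtain p where p: "uniform_limit {a..b} (\<lambda>n. poly (p n)) f sequentially"
    using poly_uniform_approximation[OF f] by blast
  have "uniform_limit S (\<lambda>n s. poly_op (p n) (X s)) (\<lambda>s. fun_calc f (X s)) sequentially"
  proof (rule uniform_limitI)
    fix e :: real assume e: "0 < e"
    then have "e / 2 > 0" by simp
    from uniform_limitD[OF p this]
    show "\<forall>\<^sub>F n in sequentially. \<forall>s\<in>S. dist (poly_op (p n) (X s)) (fun_calc f (X s)) < e"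
    proof eventually_elim
      case (elim n)
      have "norm (fun_calc (poly (p n)) (X s) - fun_calc f (X s)) \<le> e / 2" if "s \<in> S" for s
        using elim e by (intro norm_fun_calc_diff_le[OF X(2)[OF that]] f continuous_intros)
          (auto simp: dist_real_def intro: less_imp_le)
      then show ?case using e fun_calc_poly[OF X(2)] by (force simp: dist_norm)
    qed
  qed
  then show ?thesis
    by (rule uniform_limit_theorem[rotated]) (auto intro!: always_eventually continuous_on_poly_op X)
qed

section \<open>Bounded tracial functionals\<close>

lemma blinfun_compose_assoc: "(a o\<^sub>L b) o\<^sub>L c = a o\<^sub>L (b o\<^sub>L c)"
  and blinfun_compose_id: "id_blinfun o\<^sub>L a = a" "a o\<^sub>L id_blinfun = a"
  by (auto intro: blinfun_eqI)

text \<open>The free constant later makes antiderivatives of approximating polynomials agree with a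
  given function at one point.\<close>

lemma poly_antiderivative: "\<exists>P. pderiv P = p \<and> poly P a = (c :: real)"
proof -
  have "\<exists>P. pderiv P = p"
  proof
    let ?P = "\<Sum>i\<le>degree p. monom (coeff p i / real (Suc i)) (Suc i)"
    have "pderiv ?P = (\<Sum>i\<le>degree p. monom (coeff p i) i)"
      by (simp add: higher_pderiv_sum[of 1, simplified] pderiv_monom)
    also have "\<dots> = p" by (rule poly_as_sum_of_monoms)
    finally show "pderiv ?P = p" .
  qed
  then obtain P where "pderiv P = p" by blast
  then show ?thesis
    by (intro exI[of _ "P + [:c - poly P a:]"]) (simp add: pderiv_add pderiv_pCons)
qed

text \<open>Only real scalars and norm limits occur, so that the real part of a finite trace is an
  instance.\<close>

locale tracial_functional =
  fixes M :: "'h::complex_hilbert op set" and t :: "'h op \<Rightarrow> real" and K :: real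
  assumes M_bounded_ops: "M \<subseteq> bounded_ops"
    and M_id: "id_blinfun \<in> M"
    and M_add: "S \<in> M \<Longrightarrow> T \<in> M \<Longrightarrow> S + T \<in> M"
    and M_scaleR: "T \<in> M \<Longrightarrow> r *\<^sub>R T \<in> M"
    and M_compose: "S \<in> M \<Longrightarrow> T \<in> M \<Longrightarrow> S o\<^sub>L T \<in> M"
    and M_limit: "(\<And>n. X n \<in> M) \<Longrightarrow> X \<longlonglongrightarrow> T \<Longrightarrow> T \<in> M"
    and t_add: "S \<in> M \<Longrightarrow> T \<in> M \<Longrightarrow> t (S + T) = t S + t T"
    and t_scaleR: "T \<in> M \<Longrightarrow> t (r *\<^sub>R T) = r * t T"
    and t_cyclic: "S \<in> M \<Longrightarrow> T \<in> M \<Longrightarrow> t (S o\<^sub>L T) = t (T o\<^sub>L S)"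
    and t_nonneg: "T \<in> M \<Longrightarrow> positive_op T \<Longrightarrow> 0 \<le> t T"
    and t_bound: "T \<in> M \<Longrightarrow> \<bar>t T\<bar> \<le> K * norm T"
begin

lemma M_0: "0 \<in> M"
  using M_scaleR[OF M_id, of 0] by simp

lemma M_uminus: "T \<in> M \<Longrightarrow> - T \<in> M"
  using M_scaleR[of T "-1"] by simp

lemma M_diff: "S \<in> M \<Longrightarrow> T \<in> M \<Longrightarrow> S - T \<in> M"
  using M_add[of S "- T"] M_uminus by simp

lemmas M_closed = M_0 M_id M_add M_scaleR M_compose M_diff M_uminus

lemma t_0: "t 0 = 0"
  using t_scaleR[OF M_0, of 0] by simp

lemma t_diff: "S \<in> M \<Longrightarrow> T \<in> M \<Longrightarrow> t (S - T) = t S - t T"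
  using t_add[of S "(-1) *\<^sub>R T"] t_scaleR[of T "-1"] M_scaleR[of T "-1"] by simp

lemma t_mono: "S \<in> M \<Longrightarrow> T \<in> M \<Longrightarrow> positive_op (T - S) \<Longrightarrow> t S \<le> t T"
  using t_nonneg[of "T - S"] by (simp add: t_diff M_diff)

lemma t_diff_le: "S \<in> M \<Longrightarrow> T \<in> M \<Longrightarrow> \<bar>t S - t T\<bar> \<le> K * norm (S - T)"
  using t_bound[of "S - T"] by (simp add: t_diff M_diff)

lemma continuous_on_t_M: "continuous_on M t"
proof (rule lipschitz_on_continuous_on)
  show "\<bar>K\<bar>-lipschitz_on M t"
  proof (rule lipschitz_onI)
    fix S T assume "S \<in> M" "T \<in> M"
    then have "\<bar>t S - t T\<bar> \<le> K * norm (S - T)" by (rule t_diff_le)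
    also have "\<dots> \<le> \<bar>K\<bar> * norm (S - T)" by (intro mult_right_mono) auto
    finally show "dist (t S) (t T) \<le> \<bar>K\<bar> * dist S T" by (simp add: dist_norm)
  qed simp
qed

lemma continuous_on_t: "continuous_on S X \<Longrightarrow> (\<And>s. s \<in> S \<Longrightarrow> X s \<in> M) \<Longrightarrow> continuous_on S (\<lambda>s. t (X s))"
  by (rule continuous_on_compose2[OF continuous_on_t_M]) auto

lemma t_tendsto: "X \<longlonglongrightarrow> T \<Longrightarrow> (\<And>n. X n \<in> M) \<Longrightarrow> (\<lambda>n. t (X n)) \<longlonglongrightarrow> t T"
  using continuous_on_t_M M_limit[of X T] unfolding continuous_on_sequentially comp_def by blast

lemma M_poly_op: "T \<in> M \<Longrightarrow> poly_op p T \<in> M"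
  by (induction p) (auto intro: M_closed)

lemma M_fun_calc: "T \<in> M \<Longrightarrow> op_between a b T \<Longrightarrow> continuous_on {a..b} f \<Longrightarrow> fun_calc f T \<in> M"
  using poly_uniform_approximation poly_op_tendsto_fun_calc M_poly_op M_limit by metis

lemma positive_op_sqrt:
  assumes T: "T \<in> M" "positive_op T"
  obtains Q where "Q \<in> M" "selfadjoint Q" "Q o\<^sub>L Q = T"
proof
  have b: "op_between 0 (norm T) T" by (rule positive_op_between[OF T(2)]) simp
  have c: "continuous_on {0..norm T} sqrt" by (intro continuous_intros)
  show "fun_calc sqrt T \<in> M" by (rule M_fun_calc[OF T(1) b c])
  show "selfadjoint (fun_calc sqrt T)" by (rule selfadjoint_fun_calc[OF b c])
  have "fun_calc sqrt T o\<^sub>L fun_calc sqrt T = fun_calc (\<lambda>r. sqrt r * sqrt r) T"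
    by (rule fun_calc_mult[OF b c c, symmetric])
  also have "\<dots> = fun_calc (\<lambda>r. r) T" by (rule fun_calc_cong[OF b]) simp
  finally show "fun_calc sqrt T o\<^sub>L fun_calc sqrt T = T" by (simp add: fun_calc_ident[OF b])
qed

text \<open>The product of two positive operators need not be positive, but with \<open>Q\<close>
  the square root of \<open>T\<close> cyclicity replaces it by the positive operator
  \<open>Q o\<^sub>L S o\<^sub>L Q\<close>.\<close>

lemma t_compose_nonneg:
  assumes "S \<in> M" "T \<in> M" "positive_op S" "positive_op T"
  shows "0 \<le> t (S o\<^sub>L T)"
proof -
  obtain Q where Q: "Q \<in> M" "selfadjoint Q" "Q o\<^sub>L Q = T" using positive_op_sqrt assms by blast
  have "t (S o\<^sub>L T) = t ((S o\<^sub>L Q) o\<^sub>L Q)" by (simp add: Q(3)[symmetric] blinfun_compose_assoc)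
  also have "\<dots> = t (Q o\<^sub>L (S o\<^sub>L Q))" using assms(1) Q(1) by (intro t_cyclic M_compose)
  also have "Q o\<^sub>L (S o\<^sub>L Q) = Q o\<^sub>L S o\<^sub>L Q" by (simp add: blinfun_compose_assoc)
  finally show ?thesis using assms Q by (simp add: t_nonneg positive_op_conj M_compose)
qed

text \<open>The derivative of a power is a sum of words with \<open>X\<close> in every position;
  only under the trace can \<open>X\<close> be rotated to the end. The factor \<open>Z\<close>,
  commuting with the base point, strengthens the induction: the step for \<open>pCons\<close>
  multiplies \<open>Z\<close> by the base point, and the product still commutes with it.\<close>

lemma t_poly_op_derivative_aux:
  assumes Y: "Y \<in> M" and X: "X \<in> M"
  shows "\<exists>D\<in>M. ((\<lambda>u. poly_op p (Y + u *\<^sub>R X)) has_vector_derivative D) (at u within S) \<and>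
    (\<forall>Z\<in>M. Z o\<^sub>L (Y + u *\<^sub>R X) = (Y + u *\<^sub>R X) o\<^sub>L Z \<longrightarrow>
       t (Z o\<^sub>L D) = t (Z o\<^sub>L (poly_op (pderiv p) (Y + u *\<^sub>R X) o\<^sub>L X)))"
proof (induction p)
  case 0 then show ?case by (intro bexI[of _ 0] M_0) auto
next
  case (pCons a p)
  let ?W = "Y + u *\<^sub>R X"
  from pCons obtain D where D: "D \<in> M"
    "((\<lambda>u. poly_op p (Y + u *\<^sub>R X)) has_vector_derivative D) (at u within S)"
    "\<And>Z. Z \<in> M \<Longrightarrow> Z o\<^sub>L ?W = ?W o\<^sub>L Z \<Longrightarrow> t (Z o\<^sub>L D) = t (Z o\<^sub>L (poly_op (pderiv p) ?W o\<^sub>L X))" by blast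
  have W: "?W \<in> M" using assms by (auto intro: M_closed)
  let ?D = "(?W o\<^sub>L D) + (X o\<^sub>L poly_op p ?W)"
  have "((\<lambda>u. Y + u *\<^sub>R X) has_vector_derivative X) (at u within S)"
    by (auto intro!: derivative_eq_intros)
  from blinfun_compose.has_vector_derivative[OF this D(2)]
  have "((\<lambda>u. poly_op (pCons a p) (Y + u *\<^sub>R X)) has_vector_derivative ?D) (at u within S)"
    by (auto intro!: derivative_eq_intros)
  moreover have "t (Z o\<^sub>L ?D) = t (Z o\<^sub>L (poly_op (pderiv (pCons a p)) ?W o\<^sub>L X))"
    if Z: "Z \<in> M" "Z o\<^sub>L ?W = ?W o\<^sub>L Z" for Z
  proof -
    let ?P = "poly_op p ?W" and ?P' = "poly_op (pderiv p) ?W"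
    have P: "?P \<in> M" "?P' \<in> M" using W by (simp_all add: M_poly_op)
    have "Z o\<^sub>L ?D = ((Z o\<^sub>L ?W) o\<^sub>L D) + (Z o\<^sub>L X o\<^sub>L ?P)"
      by (intro blinfun_eqI) (simp add: blinfun.bilinear_simps)
    then have "t (Z o\<^sub>L ?D) = t ((Z o\<^sub>L ?W) o\<^sub>L D) + t (Z o\<^sub>L X o\<^sub>L ?P)"
      using Z W D P X by (simp add: t_add M_compose)
    also have "t ((Z o\<^sub>L ?W) o\<^sub>L D) = t ((Z o\<^sub>L ?W) o\<^sub>L (?P' o\<^sub>L X))"
    proof (rule D(3))
      show "Z o\<^sub>L ?W o\<^sub>L ?W = ?W o\<^sub>L (Z o\<^sub>L ?W)" using Z(2) by (simp add: blinfun_compose_assoc)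
    qed (use Z W in \<open>simp add: M_compose\<close>)
    also have "t (Z o\<^sub>L X o\<^sub>L ?P) = t (?P o\<^sub>L Z o\<^sub>L X)"
      using Z X P t_cyclic[of "Z o\<^sub>L X" ?P] by (simp add: M_compose blinfun_compose_assoc)
    also have "?P o\<^sub>L Z = Z o\<^sub>L ?P" using poly_op_commute[OF Z(2)] by simp
    also have "t ((Z o\<^sub>L ?W) o\<^sub>L (?P' o\<^sub>L X)) + t (Z o\<^sub>L ?P o\<^sub>L X)
        = t (((Z o\<^sub>L ?W) o\<^sub>L (?P' o\<^sub>L X)) + (Z o\<^sub>L ?P o\<^sub>L X))"
      using Z X P W by (simp add: t_add M_compose)
    also have "((Z o\<^sub>L ?W) o\<^sub>L (?P' o\<^sub>L X)) + (Z o\<^sub>L ?P o\<^sub>L X) = Z o\<^sub>L (poly_op (pderiv (pCons a p)) ?W o\<^sub>L X)"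
      by (intro blinfun_eqI) (simp add: pderiv_pCons poly_op_add blinfun.bilinear_simps)
    finally show ?thesis .
  qed
  moreover have "?D \<in> M" by (intro M_add M_compose M_poly_op W D X)
  ultimately show ?case by blast
qed

text \<open>Linearity and boundedness of \<open>t\<close> are known on \<open>M\<close> only, so the
  remainder of the difference quotient, which lies in \<open>M\<close>, is estimated directly by
  \<open>t_bound\<close>.\<close>

lemma t_has_real_derivative:
  assumes f: "(f has_vector_derivative D) (at u within S)" and M: "\<And>v. f v \<in> M" "D \<in> M"
  shows "((\<lambda>u. t (f u)) has_real_derivative t D) (at u within S)"
  unfolding has_field_derivative_def has_derivative_within
proof (intro conjI)
  show "bounded_linear ((*) (t D))" by (rule bounded_linear_mult_right)
  have "((\<lambda>y. (1 / norm (y - u)) *\<^sub>R (f y - (f u + (y - u) *\<^sub>R D))) \<longlongrightarrow> 0) (at u within S)"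
    using f unfolding has_vector_derivative_def has_derivative_within by blast
  from tendsto_mult_left[OF tendsto_norm_zero[OF this], of K]
  have *: "((\<lambda>y. K * norm ((1 / norm (y - u)) *\<^sub>R (f y - (f u + (y - u) *\<^sub>R D)))) \<longlongrightarrow> 0) (at u within S)"
    by simp
  show "((\<lambda>y. (1 / norm (y - u)) *\<^sub>R (t (f y) - (t (f u) + t D * (y - u)))) \<longlongrightarrow> 0) (at u within S)"
  proof (rule Lim_null_comparison[OF _ *], rule always_eventually, rule allI)
    fix y
    have "(1 / norm (y - u)) *\<^sub>R (t (f y) - (t (f u) + t D * (y - u)))
        = t ((1 / norm (y - u)) *\<^sub>R (f y - (f u + (y - u) *\<^sub>R D)))"
      using M by (simp add: t_scaleR t_diff t_add M_closed mult.commute)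
    then show "norm ((1 / norm (y - u)) *\<^sub>R (t (f y) - (t (f u) + t D * (y - u))))
        \<le> K * norm ((1 / norm (y - u)) *\<^sub>R (f y - (f u + (y - u) *\<^sub>R D)))"
      using t_bound[of "(1 / norm (y - u)) *\<^sub>R (f y - (f u + (y - u) *\<^sub>R D))"] M
      by (simp only: real_norm_def) (simp add: M_closed)
  qed
qed

lemma t_poly_op_derivative:
  assumes Y: "Y \<in> M" and X: "X \<in> M"
  shows "((\<lambda>u. t (poly_op p (Y + u *\<^sub>R X))) has_real_derivative
           t (poly_op (pderiv p) (Y + u *\<^sub>R X) o\<^sub>L X)) (at u within S)"
proof -
  obtain D where D: "D \<in> M"
    "((\<lambda>u. poly_op p (Y + u *\<^sub>R X)) has_vector_derivative D) (at u within S)"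
    "\<And>Z. Z \<in> M \<Longrightarrow> Z o\<^sub>L (Y + u *\<^sub>R X) = (Y + u *\<^sub>R X) o\<^sub>L Z \<Longrightarrow>
       t (Z o\<^sub>L D) = t (Z o\<^sub>L (poly_op (pderiv p) (Y + u *\<^sub>R X) o\<^sub>L X))"
    using t_poly_op_derivative_aux[OF assms] by metis
  have "t D = t (poly_op (pderiv p) (Y + u *\<^sub>R X) o\<^sub>L X)" using D(3)[OF M_id] by (simp add: blinfun_compose_id)
  with t_has_real_derivative[OF D(2) _ D(1)] show ?thesis
    using assms by (simp add: M_poly_op M_closed)
qed

text \<open>For polynomials this is the fundamental theorem of calculus along the segment. The
  integral form, unlike the derivative itself, survives the uniform approximation of
  \<open>g\<close> by polynomials, and so reaches every continuously differentiable
  \<open>G\<close>.\<close>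

lemma trace_increment:
  assumes Y: "Y \<in> M" "op_between a b Y" and X: "X \<in> M" "op_between a b (Y + X)" and ab: "a \<le> b"
    and g: "continuous_on {a..b} g"
    and G: "\<And>r. r \<in> {a..b} \<Longrightarrow> (G has_real_derivative g r) (at r within {a..b})"
  shows "((\<lambda>u. t (fun_calc g (Y + u *\<^sub>R X) o\<^sub>L X)) has_integral t (fun_calc G (Y + X)) - t (fun_calc G Y)) {0..1}"
proof -
  let ?W = "\<lambda>u. Y + u *\<^sub>R X"
  have W: "op_between a b (?W u)" if "u \<in> {0..1}" for u
    using op_between_segment[OF Y(2) X(2)] that by auto
  have WM: "?W u \<in> M" for u using X Y by (intro M_closed)
  obtain p where p: "uniform_limit {a..b} (\<lambda>n. poly (p n)) g sequentially"
    using poly_uniform_approximation[OF g] by blast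
  \<comment> \<open>Agreement with \<open>G\<close> at \<open>a\<close> turns uniform convergence of
    the derivatives into uniform convergence of the antiderivatives.\<close>
  obtain P where P: "\<And>n. pderiv (P n) = p n" "\<And>n. poly (P n) a = G a"
    using choice[of "\<lambda>n Q. pderiv Q = p n \<and> poly Q a = G a"] poly_antiderivative by blast
  have PG: "uniform_limit {a..b} (\<lambda>n. poly (P n)) G sequentially"
  proof (rule uniform_limitI)
    fix e :: real assume e: "0 < e"
    \<comment> \<open>The summand 1 keeps the divisor positive when \<open>a = b\<close> and the
      final inequality strict.\<close>
    define d where "d = e / (b - a + 1)"
    have d: "d > 0" using e ab by (simp add: d_def)
    show "\<forall>\<^sub>F n in sequentially. \<forall>x\<in>{a..b}. dist (poly (P n) x) (G x) < e"
      using uniform_limitD[OF p d]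
    proof eventually_elim
      case (elim n)
      show ?case
      proof
        fix x assume x: "x \<in> {a..b}"
        have "norm ((\<lambda>r. poly (P n) r - G r) x - (\<lambda>r. poly (P n) r - G r) a) \<le> d * norm (x - a)"
        proof (rule field_differentiable_bound[of "{a..b}" _ "\<lambda>r. poly (p n) r - g r"])
          fix r assume r: "r \<in> {a..b}"
          show "((\<lambda>r. poly (P n) r - G r) has_field_derivative poly (p n) r - g r) (at r within {a..b})"
            using DERIV_subset[OF poly_DERIV[of "P n" r], of "{a..b}"] G[OF r] P(1)[of n]
            by (intro DERIV_diff) auto
          show "norm (poly (p n) r - g r) \<le> d" using elim r by (auto simp: dist_real_def intro: less_imp_le)
        qed (use x ab in auto)
        then have "\<bar>poly (P n) x - G x\<bar> \<le> d * (x - a)" using x P(2) by simp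
        also have "\<dots> \<le> d * (b - a)" using d x by (intro mult_left_mono) auto
        also have "\<dots> < e" using e ab by (simp add: d_def field_simps)
        finally show "dist (poly (P n) x) (G x) < e" by (simp add: dist_real_def)
      qed
    qed
  qed
  have contW: "continuous_on {0..1} ?W" by (intro continuous_intros)
  have int: "((\<lambda>u. t (poly_op (p n) (?W u) o\<^sub>L X)) has_integral t (poly_op (P n) (Y + X)) - t (poly_op (P n) Y)) {0..1}" for n
  proof -
    have "((\<lambda>u. t (poly_op (p n) (?W u) o\<^sub>L X)) has_integral
        t (poly_op (P n) (?W 1)) - t (poly_op (P n) (?W 0))) {0..1}"
      using t_poly_op_derivative[OF Y(1) X(1), of "P n"]
      by (intro fundamental_theorem_of_calculus) (auto simp: P(1) has_real_derivative_iff_has_vector_derivative)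
    then show ?thesis by simp
  qed
  have ul: "uniform_limit (cbox 0 1) (\<lambda>n u. t (poly_op (p n) (?W u) o\<^sub>L X)) (\<lambda>u. t (fun_calc g (?W u) o\<^sub>L X)) sequentially"
  proof (rule uniform_limitI)
    fix e :: real assume e: "0 < e"
    define d where "d = e / (\<bar>K\<bar> * norm X + 1)"
    have pos: "\<bar>K\<bar> * norm X + 1 > 0" by (intro add_nonneg_pos) auto
    then have d: "d > 0" using e by (simp add: d_def)
    show "\<forall>\<^sub>F n in sequentially. \<forall>u\<in>cbox 0 1. dist (t (poly_op (p n) (?W u) o\<^sub>L X)) (t (fun_calc g (?W u) o\<^sub>L X)) < e"
      using uniform_limitD[OF p d]
    proof eventually_elim
      case (elim n)
      show ?case
      proof
        fix u :: real assume "u \<in> cbox 0 1"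
        then have u: "u \<in> {0..1}" by simp
        let ?D = "fun_calc (poly (p n)) (?W u) - fun_calc g (?W u)"
        have D: "norm ?D \<le> d"
          using elim d by (intro norm_fun_calc_diff_le[OF W[OF u]] g continuous_intros)
            (auto simp: dist_real_def intro: less_imp_le)
        have "t (poly_op (p n) (?W u) o\<^sub>L X) - t (fun_calc g (?W u) o\<^sub>L X) = t (?D o\<^sub>L X)"
        proof -
          have "?D o\<^sub>L X = (poly_op (p n) (?W u) o\<^sub>L X) - (fun_calc g (?W u) o\<^sub>L X)"
            by (intro blinfun_eqI) (simp add: fun_calc_poly[OF W[OF u]] blinfun.bilinear_simps)
          then show ?thesis
            using X(1) WM[of u] by (simp add: t_diff M_compose M_poly_op M_fun_calc[OF _ W[OF u] g])
        qed
        moreover have "?D o\<^sub>L X \<in> M"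
          by (intro M_compose M_diff M_fun_calc[OF WM W[OF u]] X(1) g continuous_intros)
        ultimately have "\<bar>t (poly_op (p n) (?W u) o\<^sub>L X) - t (fun_calc g (?W u) o\<^sub>L X)\<bar> \<le> K * norm (?D o\<^sub>L X)"
          using t_bound by simp
        also have "\<dots> \<le> \<bar>K\<bar> * (d * norm X)"
          using D by (intro mult_mono order_trans[OF norm_blinfun_compose] mult_right_mono) auto
        also have "\<dots> = d * (\<bar>K\<bar> * norm X)" by simp
        also have "\<dots> < d * (\<bar>K\<bar> * norm X + 1)" using d by simp
        also have "\<dots> = e" using pos by (simp add: d_def)
        finally show "dist (t (poly_op (p n) (?W u) o\<^sub>L X)) (t (fun_calc g (?W u) o\<^sub>L X)) < e"
          by (simp add: dist_real_def)
      qed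
    qed
  qed
  have cont: "continuous_on (cbox 0 1) (\<lambda>u. t (poly_op (p n) (?W u) o\<^sub>L X))" for n
    using contW WM X(1)
    by (intro continuous_on_t blinfun_compose.continuous_on
        continuous_on_poly_op continuous_on_const) (auto intro!: M_compose M_poly_op)
  obtain I J where IJ: "\<And>n. ((\<lambda>u. t (poly_op (p n) (?W u) o\<^sub>L X)) has_integral I n) (cbox 0 1)"
    "((\<lambda>u. t (fun_calc g (?W u) o\<^sub>L X)) has_integral J) (cbox 0 1)" "I \<longlonglongrightarrow> J"
    using uniform_limit_integral_cbox[OF ul cont] by (metis trivial_limit_sequentially)
  have I: "I = (\<lambda>n. t (poly_op (P n) (Y + X)) - t (poly_op (P n) Y))"
  proof
    fix n show "I n = t (poly_op (P n) (Y + X)) - t (poly_op (P n) Y)"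
      using IJ(1)[of n] int[of n] by (intro has_integral_unique[of _ "I n" "{0..1}"]) auto
  qed
  have "I \<longlonglongrightarrow> t (fun_calc G (Y + X)) - t (fun_calc G Y)"
    unfolding I using X Y
    by (intro tendsto_diff t_tendsto poly_op_tendsto_fun_calc[OF _ PG]) (auto intro: M_poly_op M_add)
  then have "J = t (fun_calc G (Y + X)) - t (fun_calc G Y)" using IJ(3) LIMSEQ_unique by blast
  with IJ(2) show ?thesis by simp
qed

text \<open>The function \<open>G\<close> need not be operator monotone. Under the trace it behaves
  as if it were, since the integrand of \<open>trace_increment\<close> is the trace of a product of
  two positive operators.\<close>

lemma trace_mono_C1:
  assumes Y: "Y \<in> M" "op_between a b Y" and X: "X \<in> M" "op_between a b (Y + X)" and ab: "a \<le> b"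
    and g: "continuous_on {a..b} g"
    and G: "\<And>r. r \<in> {a..b} \<Longrightarrow> (G has_real_derivative g r) (at r within {a..b})"
    and pos: "\<And>r. r \<in> {a..b} \<Longrightarrow> 0 \<le> g r" and Xp: "positive_op X"
  shows "t (fun_calc G Y) \<le> t (fun_calc G (Y + X))"
proof -
  have "0 \<le> t (fun_calc G (Y + X)) - t (fun_calc G Y)"
  proof (rule has_integral_nonneg[OF trace_increment[OF Y X ab g G]])
    fix u :: real assume "u \<in> {0..1}"
    then have W: "op_between a b (Y + u *\<^sub>R X)" using op_between_segment[OF Y(2) X(2)] by auto
    have WM: "Y + u *\<^sub>R X \<in> M" using X Y by (intro M_closed)
    show "0 \<le> t (fun_calc g (Y + u *\<^sub>R X) o\<^sub>L X)"
      using X Xp pos by (intro t_compose_nonneg M_fun_calc[OF WM W g] positive_fun_calc[OF W g])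
  qed
  then show ?thesis by simp
qed

text \<open>Steklov averages reduce monotone Lipschitz functions to continuously differentiable ones.\<close>

lemma trace_mono:
  assumes Y: "Y \<in> M" "op_between a b Y" and X: "X \<in> M" "op_between a b X" and ab: "a \<le> b"
    and G: "mono G" "L-lipschitz_on UNIV G" and le: "positive_op (X - Y)"
  shows "t (fun_calc G Y) \<le> t (fun_calc G X)"
proof -
  have cG: "continuous_on S G" for S
    using lipschitz_on_continuous_on[OF G(2)] continuous_on_subset by blast
  have L: "0 \<le> L" using G(2) lipschitz_on_nonneg by blast
  define A where "A w = integral {a..w} G" for w
  define g where "g n w = real (Suc n) * (G (w + 1 / real (Suc n)) - G w)" for n w
  \<comment> \<open>The mean of \<open>G\<close> over a window of length \<open>1 / Suc n\<close> to
    the right of \<open>w\<close>. Its derivative \<open>g n\<close> is a difference quotient of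
    \<open>G\<close>, nonnegative by monotonicity.\<close>
  define F where "F n w = real (Suc n) * (A (w + 1 / real (Suc n)) - A w)" for n w
  \<comment> \<open>The window reaches at most one unit past \<open>b\<close>, hence the endpoint
    \<open>b + 1\<close>.\<close>
  have dA: "(A has_real_derivative G w) (at w within {a..b + 1})" if "w \<in> {a..b + 1}" for w
    unfolding A_def using integral_has_real_derivative[OF cG that] .
  have dF: "(F n has_real_derivative g n w) (at w within {a..b})" if w: "w \<in> {a..b}" for n w
  proof -
    have n1: "1 / real (Suc n) \<le> 1" "0 \<le> 1 / real (Suc n)" by auto
    have "w + 1 / real (Suc n) \<in> {a..b + 1}" using w n1 by (auto intro: order_trans add_mono)
    from dA[OF this] have "(A has_real_derivative G (w + 1 / real (Suc n)))
        (at (w + 1 / real (Suc n)) within (\<lambda>w. w + 1 / real (Suc n)) ` {a..b})"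
      by (rule DERIV_subset) (use n1 in \<open>auto intro: order_trans add_mono\<close>)
    moreover have "((\<lambda>w. w + 1 / real (Suc n)) has_real_derivative 1) (at w within {a..b})"
      by (auto intro!: derivative_eq_intros)
    ultimately have "((\<lambda>w. A (w + 1 / real (Suc n))) has_real_derivative G (w + 1 / real (Suc n))) (at w within {a..b})"
      using DERIV_image_chain[of A _ "\<lambda>w. w + 1 / real (Suc n)"] by (fastforce simp: o_def)
    moreover have "(A has_real_derivative G w) (at w within {a..b})"
      by (rule DERIV_subset[OF dA]) (use w in auto)
    ultimately show ?thesis unfolding F_def g_def
      by (auto intro!: derivative_eq_intros)
  qed
  have approx: "\<bar>F n w - G w\<bar> \<le> L * (1 / real (Suc n))" if w: "w \<in> {a..b}" for n w
  proof -
    let ?h = "1 / real (Suc n)"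
    have h: "?h > 0" "?h \<le> 1" by auto
    have ig: "G integrable_on {c..d}" for c d by (rule integrable_continuous_interval[OF cG])
    have "integral {a..w} G + integral {w..w + ?h} G = integral {a..w + ?h} G"
      using w h by (intro Henstock_Kurzweil_Integration.integral_combine ig) auto
    then have F: "F n w = real (Suc n) * integral {w..w + ?h} G" unfolding F_def A_def by simp
    have "norm (integral {w..w + ?h} (\<lambda>v. G v - G w)) \<le> L * ?h * (w + ?h - w)"
    proof (rule integral_bound)
      fix v assume v: "v \<in> {w..w + ?h}"
      have "\<bar>G v - G w\<bar> \<le> L * \<bar>v - w\<bar>" using lipschitz_onD[OF G(2), of v w] by (simp add: dist_real_def)
      also have "\<dots> \<le> L * ?h" using v L by (intro mult_left_mono) auto
      finally show "norm (G v - G w) \<le> L * ?h" by simp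
    qed (use h in \<open>auto intro!: continuous_intros cG\<close>)
    moreover have "integral {w..w + ?h} (\<lambda>v. G v - G w) = integral {w..w + ?h} G - ?h * G w"
      using ig h by (subst Henstock_Kurzweil_Integration.integral_diff) auto
    ultimately have "\<bar>integral {w..w + ?h} G - ?h * G w\<bar> \<le> L * ?h * ?h" using h by simp
    then have "real (Suc n) * \<bar>integral {w..w + ?h} G - ?h * G w\<bar> \<le> real (Suc n) * (L * ?h * ?h)"
      by (intro mult_left_mono) auto
    moreover have "real (Suc n) * \<bar>integral {w..w + ?h} G - ?h * G w\<bar> = \<bar>F n w - G w\<bar>"
    proof -
      have "F n w - G w = real (Suc n) * (integral {w..w + ?h} G - ?h * G w)"
        unfolding F right_diff_distrib by simp
      then show ?thesis by (simp add: abs_mult)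
    qed
    ultimately show ?thesis by simp
  qed
  have cF: "continuous_on {a..b} (F n)" for n
    using dF by (intro DERIV_continuous_on)
  have ul: "uniform_limit {a..b} F G sequentially"
  proof (rule uniform_limitI)
    fix e :: real assume e: "0 < e"
    have "(\<lambda>n. L * (1 / real (Suc n))) \<longlonglongrightarrow> L * 0"
      by (intro tendsto_mult tendsto_const lim_1_over_n[THEN LIMSEQ_Suc])
    then have "\<forall>\<^sub>F n in sequentially. L * (1 / real (Suc n)) < e" using e by (intro order_tendstoD) auto
    then show "\<forall>\<^sub>F n in sequentially. \<forall>w\<in>{a..b}. dist (F n w) (G w) < e"
    proof eventually_elim
      case (elim n)
      show ?case
      proof
        fix w assume "w \<in> {a..b}"
        from approx[OF this, of n] elim show "dist (F n w) (G w) < e" unfolding dist_real_def by linarith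
      qed
    qed
  qed
  have "t (fun_calc (F n) Y) \<le> t (fun_calc (F n) X)" for n
  proof -
    have "t (fun_calc (F n) Y) \<le> t (fun_calc (F n) (Y + (X - Y)))"
    proof (rule trace_mono_C1[OF Y _ _ ab _ dF _ le])
      show "X - Y \<in> M" using X Y by (intro M_closed)
      show "continuous_on {a..b} (g n)" unfolding g_def
        by (intro continuous_intros continuous_on_compose2[OF cG[of UNIV]]) auto
      show "0 \<le> g n r" for r unfolding g_def using monoD[OF G(1), of r "r + 1 / real (Suc n)"] by simp
    qed (use X in simp_all)
    then show ?thesis by simp
  qed
  moreover have "(\<lambda>n. t (fun_calc (F n) Y)) \<longlonglongrightarrow> t (fun_calc G Y)"
    "(\<lambda>n. t (fun_calc (F n) X)) \<longlonglongrightarrow> t (fun_calc G X)"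
    using X Y by (auto intro!: t_tendsto fun_calc_uniform_limit[OF _ cF ul] M_fun_calc[OF _ _ cF])
  ultimately show ?thesis using LIMSEQ_le by blast
qed

text \<open>For polynomials, \<open>p(S T) S = S p(T S)\<close> moves one factor across, and
  cyclicity closes the loop on everything but the constant term, which is the same on both sides.
  Approximation does the rest.\<close>

lemma trace_fun_calc_swap:
  assumes S: "S \<in> M" and T: "T \<in> M" and ST: "op_between a b (S o\<^sub>L T)" and TS: "op_between a b (T o\<^sub>L S)"
    and g: "continuous_on {a..b} g"
  shows "t (fun_calc g (S o\<^sub>L T)) = t (fun_calc g (T o\<^sub>L S))"
proof -
  have inter: "poly_op p (S o\<^sub>L T) o\<^sub>L S = S o\<^sub>L poly_op p (T o\<^sub>L S)" for p
  proof (induction p)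
    case (pCons c p)
    show ?case
    proof (rule blinfun_eqI)
      fix x
      have "poly_op p (S o\<^sub>L T) (S y) = S (poly_op p (T o\<^sub>L S) y)" for y
        using pCons.IH by (metis blinfun_apply_blinfun_compose)
      then show "(poly_op (pCons c p) (S o\<^sub>L T) o\<^sub>L S) x = (S o\<^sub>L poly_op (pCons c p) (T o\<^sub>L S)) x"
        by (simp add: blinfun.bilinear_simps)
    qed
  qed simp
  have poly: "t (poly_op p (S o\<^sub>L T)) = t (poly_op p (T o\<^sub>L S))" for p
  proof (cases p)
    case (pCons c q)
    have M: "poly_op q (S o\<^sub>L T) \<in> M" "poly_op q (T o\<^sub>L S) \<in> M" using S T by (auto intro!: M_poly_op M_compose)
    have "t (S o\<^sub>L T o\<^sub>L poly_op q (S o\<^sub>L T)) = t (T o\<^sub>L (poly_op q (S o\<^sub>L T) o\<^sub>L S))"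
      using t_cyclic[of S "T o\<^sub>L poly_op q (S o\<^sub>L T)"] S T M by (simp add: M_compose blinfun_compose_assoc)
    also have "\<dots> = t (T o\<^sub>L S o\<^sub>L poly_op q (T o\<^sub>L S))" by (simp add: inter blinfun_compose_assoc)
    finally show ?thesis using S T M by (simp add: pCons t_add M_closed)
  qed
  obtain p where p: "uniform_limit {a..b} (\<lambda>n. poly (p n)) g sequentially"
    using poly_uniform_approximation[OF g] by blast
  have "(\<lambda>n. t (poly_op (p n) (S o\<^sub>L T))) \<longlonglongrightarrow> t (fun_calc g (S o\<^sub>L T))"
    "(\<lambda>n. t (poly_op (p n) (T o\<^sub>L S))) \<longlonglongrightarrow> t (fun_calc g (T o\<^sub>L S))"
    using S T by (auto intro!: t_tendsto poly_op_tendsto_fun_calc[OF _ p] ST TS M_poly_op M_compose)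
  then show ?thesis by (simp add: poly LIMSEQ_unique)
qed

end

section \<open>The trace of a spectral projection and the layer-cake formula\<close>

text \<open>Completeness is what allows function-valued integrals in the layer-cake
  argument.\<close>

instance bcontfun :: (metric_space, banach) banach ..

text \<open>As \<open>n\<close> grows these increase to the indicator of the positive half-line,
  which is not continuous and so has no place in the calculus.\<close>

definition cutoff :: "real \<Rightarrow> real \<Rightarrow> real" where
  "cutoff n w = min 1 (max 0 (n * w))"

lemma cutoff_nonneg: "0 \<le> cutoff n w"
  and cutoff_le_1: "cutoff n w \<le> 1"
  and cutoff_eq_1: "1 \<le> n * w \<Longrightarrow> cutoff n w = 1"
  by (auto simp: cutoff_def max_def min_def)

lemma cutoff_nonpos: "0 \<le> n \<Longrightarrow> w \<le> 0 \<Longrightarrow> cutoff n w = 0"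
  using mult_nonneg_nonpos[of n w] by (simp add: cutoff_def max_def)

lemma mono_cutoff: "0 \<le> n \<Longrightarrow> mono (cutoff n)"
  unfolding cutoff_def by (intro monoI min.mono max.mono mult_left_mono order_refl)

lemma cutoff_mono_left: "n \<le> m \<Longrightarrow> 0 \<le> n \<Longrightarrow> cutoff n w \<le> cutoff m w"
proof (cases "w \<ge> 0")
  case True
  assume "n \<le> m" then show ?thesis
    unfolding cutoff_def using True by (intro min.mono max.mono mult_right_mono order_refl)
next
  case False
  assume "n \<le> m" "0 \<le> n" then show ?thesis using False by (simp add: cutoff_nonpos)
qed

lemma lipschitz_cutoff: "0 \<le> n \<Longrightarrow> n-lipschitz_on UNIV (cutoff n)"
proof (rule lipschitz_onI)
  fix x y :: real assume "0 \<le> n"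
  have "\<bar>cutoff n x - cutoff n y\<bar> \<le> \<bar>n * x - n * y\<bar>" by (simp add: cutoff_def min_def max_def)
  also have "\<dots> = n * \<bar>x - y\<bar>" using \<open>0 \<le> n\<close> by (metis abs_mult abs_of_nonneg right_diff_distrib)
  finally show "dist (cutoff n x) (cutoff n y) \<le> n * dist x y" by (simp add: dist_real_def)
qed

lemma continuous_on_cutoff [continuous_intros]:
  "continuous_on S f \<Longrightarrow> continuous_on S (\<lambda>s. cutoff n (f s))"
  unfolding cutoff_def by (intro continuous_intros)

text \<open>A convergent sequence of operators is bounded, so along each sequence a common interval
  is available.\<close>

lemma continuous_on_fun_calc_UNIV:
  fixes X :: "'a::metric_space \<Rightarrow> 'h::complex_hilbert op"
  assumes X: "continuous_on S X" "\<And>s. s \<in> S \<Longrightarrow> selfadjoint (X s)" and f: "continuous_on UNIV f"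
  shows "continuous_on S (\<lambda>s. fun_calc f (X s))"
  unfolding continuous_on_sequentially
proof (intro allI ballI impI, elim conjE)
  fix x s assume s: "s \<in> S" and x: "\<forall>n. x n \<in> S" "x \<longlonglongrightarrow> s"
  have lim: "(\<lambda>n. X (x n)) \<longlonglongrightarrow> X s"
    using X(1) s x unfolding continuous_on_sequentially comp_def by blast
  then have "Bseq (\<lambda>n. X (x n))" by (rule convergent_imp_Bseq[OF convergentI])
  then obtain R where R: "\<And>n. norm (X (x n)) \<le> R" unfolding Bseq_def by blast
  have "norm (X s) \<le> R" using tendsto_norm[OF lim] R by (intro LIMSEQ_le_const2[of "\<lambda>n. norm (X (x n))"]) auto
  let ?D = "{T :: 'h op. op_between (-R) R T}"
  have "continuous_on ?D (\<lambda>T. fun_calc f T)"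
    by (rule continuous_on_fun_calc[OF continuous_on_id _ continuous_on_subset[OF f]]) auto
  moreover have "X s \<in> ?D" "\<forall>n. X (x n) \<in> ?D"
    using R \<open>norm (X s) \<le> R\<close> X(2) s x(1) by (auto intro!: op_between_norm)
  ultimately show "((\<lambda>s. fun_calc f (X s)) \<circ> x) \<longlonglongrightarrow> fun_calc f (X s)"
    using lim unfolding continuous_on_sequentially comp_def by (elim allE[of _ "\<lambda>n. X (x n)"]) blast
qed

context tracial_functional
begin

lemma t_fun_calc_mono:
  assumes T: "T \<in> M" "op_between a b T" and f: "continuous_on {a..b} f" and g: "continuous_on {a..b} g"
    and le: "\<And>r. r \<in> {a..b} \<Longrightarrow> f r \<le> g r"
  shows "t (fun_calc f T) \<le> t (fun_calc g T)"
proof (rule t_mono)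
  have "positive_op (fun_calc (\<lambda>r. g r - f r) T)"
    using le by (intro positive_fun_calc[OF T(2)] continuous_intros f g) auto
  then show "positive_op (fun_calc g T - fun_calc f T)" by (simp add: fun_calc_diff[OF T(2) g f])
qed (intro M_fun_calc[OF T] f g)+

text \<open>With \<open>Q\<close> the square root of the positive part of \<open>Y\<close>, one has \<open>Z Y Z \<le> (Z Q) (Q Z)\<close> and
  \<open>(Q Z) (Z Q) \<le> (norm Z)\<^sup>2 Q\<^sup>2\<close>, and the trace does not distinguish \<open>(Z Q) (Q Z)\<close> from
  \<open>(Q Z) (Z Q)\<close>.\<close>

lemma t_cutoff_conj_le:
  assumes Y: "Y \<in> M" "selfadjoint Y" and Z: "Z \<in> M" "selfadjoint Z" and n: "0 \<le> n"
  shows "t (fun_calc (cutoff n) (Z o\<^sub>L Y o\<^sub>L Z)) \<le> t (fun_calc (cutoff (n * (norm Z)\<^sup>2)) Y)"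
proof -
  let ?L = "norm Y" and ?z = "(norm Z)\<^sup>2"
  have bY: "op_between (- ?L) ?L Y" using Y(2) by (rule op_between_norm) simp
  define P where "P = fun_calc (\<lambda>r. max r 0) Y"
  define Q where "Q = fun_calc (\<lambda>r. sqrt (max r 0)) Y"
  have P: "P \<in> M" "selfadjoint P" and Q: "Q \<in> M" "selfadjoint Q"
    unfolding P_def Q_def by (intro M_fun_calc[OF Y(1) bY] selfadjoint_fun_calc[OF bY] continuous_intros)+
  have QQ: "Q o\<^sub>L Q = P"
  proof -
    have "Q o\<^sub>L Q = fun_calc (\<lambda>r. sqrt (max r 0) * sqrt (max r 0)) Y"
      unfolding Q_def by (intro fun_calc_mult[OF bY, symmetric] continuous_intros)
    also have "\<dots> = P" unfolding P_def by (rule fun_calc_cong[OF bY]) simp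
    finally show ?thesis .
  qed
  have PY: "positive_op (P - Y)"
  proof -
    have "positive_op (fun_calc (\<lambda>r. max r 0 - r) Y)"
      by (intro positive_fun_calc[OF bY] continuous_intros) auto
    also have "fun_calc (\<lambda>r. max r 0 - r) Y = P - fun_calc (\<lambda>r. r) Y"
      unfolding P_def by (intro fun_calc_diff[OF bY] continuous_intros)
    also have "fun_calc (\<lambda>r. r) Y = Y" by (rule fun_calc_ident[OF bY])
    finally show ?thesis .
  qed
  have M: "Z o\<^sub>L Y o\<^sub>L Z \<in> M" "Z o\<^sub>L P o\<^sub>L Z \<in> M" "Q o\<^sub>L (Z o\<^sub>L Z) o\<^sub>L Q \<in> M" "?z *\<^sub>R P \<in> M"
    by (intro M_compose M_scaleR Y Z P Q)+
  have ZZ: "selfadjoint (Z o\<^sub>L Z)" using selfadjoint_conj[OF selfadjoint_id Z(2)] by (simp add: blinfun_compose_id)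
  have sa: "selfadjoint (Z o\<^sub>L Y o\<^sub>L Z)" "selfadjoint (Z o\<^sub>L P o\<^sub>L Z)" "selfadjoint (Q o\<^sub>L (Z o\<^sub>L Z) o\<^sub>L Q)"
    "selfadjoint (?z *\<^sub>R P)"
    by (intro selfadjoint_conj selfadjoint_scaleR Y Z P Q ZZ)+
  \<comment> \<open>One radius for all four operators, so that every comparison takes place on the
    interval \<open>{- R..R}\<close>.\<close>
  define R where "R = norm (Z o\<^sub>L Y o\<^sub>L Z) + norm (Z o\<^sub>L P o\<^sub>L Z) + norm (Q o\<^sub>L (Z o\<^sub>L Z) o\<^sub>L Q) + norm (?z *\<^sub>R P)"
  have R: "norm (Z o\<^sub>L Y o\<^sub>L Z) \<le> R" "norm (Z o\<^sub>L P o\<^sub>L Z) \<le> R" "norm (Q o\<^sub>L (Z o\<^sub>L Z) o\<^sub>L Q) \<le> R" "norm (?z *\<^sub>R P) \<le> R" "- R \<le> R"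
    unfolding R_def by (auto intro!: add_nonneg_nonneg simp: add_increasing add_increasing2)
  note b = op_between_norm[OF sa(1) R(1)] op_between_norm[OF sa(2) R(2)]
    op_between_norm[OF sa(3) R(3)] op_between_norm[OF sa(4) R(4)]
  have c: "continuous_on {-R..R} (cutoff n)" by (intro continuous_intros)
  have "t (fun_calc (cutoff n) (Z o\<^sub>L Y o\<^sub>L Z)) \<le> t (fun_calc (cutoff n) (Z o\<^sub>L P o\<^sub>L Z))"
  proof (rule trace_mono[OF M(1) b(1) M(2) b(2) R(5) mono_cutoff[OF n] lipschitz_cutoff[OF n]])
    have "(Z o\<^sub>L P o\<^sub>L Z) - (Z o\<^sub>L Y o\<^sub>L Z) = Z o\<^sub>L (P - Y) o\<^sub>L Z"
      by (intro blinfun_eqI) (simp add: blinfun.bilinear_simps)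
    then show "positive_op ((Z o\<^sub>L P o\<^sub>L Z) - (Z o\<^sub>L Y o\<^sub>L Z))" using positive_op_conj[OF PY Z(2)] by simp
  qed
  also have "Z o\<^sub>L P o\<^sub>L Z = (Z o\<^sub>L Q) o\<^sub>L (Q o\<^sub>L Z)" by (simp add: QQ[symmetric] blinfun_compose_assoc)
  also have "t (fun_calc (cutoff n) ((Z o\<^sub>L Q) o\<^sub>L (Q o\<^sub>L Z))) = t (fun_calc (cutoff n) ((Q o\<^sub>L Z) o\<^sub>L (Z o\<^sub>L Q)))"
  proof (rule trace_fun_calc_swap[OF _ _ _ _ c])
    show "Z o\<^sub>L Q \<in> M" "Q o\<^sub>L Z \<in> M" by (intro M_compose Z Q)+
    show "op_between (-R) R ((Z o\<^sub>L Q) o\<^sub>L (Q o\<^sub>L Z))" "op_between (-R) R ((Q o\<^sub>L Z) o\<^sub>L (Z o\<^sub>L Q))"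
      using b(2,3) by (simp_all add: QQ[symmetric] blinfun_compose_assoc)
  qed
  also have "(Q o\<^sub>L Z) o\<^sub>L (Z o\<^sub>L Q) = Q o\<^sub>L (Z o\<^sub>L Z) o\<^sub>L Q" by (simp add: blinfun_compose_assoc)
  also have "t (fun_calc (cutoff n) (Q o\<^sub>L (Z o\<^sub>L Z) o\<^sub>L Q)) \<le> t (fun_calc (cutoff n) (?z *\<^sub>R P))"
  proof (rule trace_mono[OF M(3) b(3) M(4) b(4) R(5) mono_cutoff[OF n] lipschitz_cutoff[OF n]])
    have "0 \<le> inner x ((?z *\<^sub>R P - (Q o\<^sub>L (Z o\<^sub>L Z) o\<^sub>L Q)) x)" for x
    proof -
      have 1: "inner x (P x) = (norm (Q x))\<^sup>2"
        by (simp add: QQ[symmetric] selfadjoint_inner[OF Q(2), symmetric] dot_square_norm)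
      have 2: "inner x (Q (Z (Z (Q x)))) = (norm (Z (Q x)))\<^sup>2"
        by (simp add: selfadjoint_inner[OF Q(2), symmetric] selfadjoint_inner[OF Z(2), symmetric] dot_square_norm)
      have "(norm (Z (Q x)))\<^sup>2 \<le> (norm Z * norm (Q x))\<^sup>2" by (intro power_mono norm_blinfun) simp
      then show ?thesis by (simp add: blinfun.bilinear_simps inner_simps 1 2 power_mult_distrib)
    qed
    then show "positive_op (?z *\<^sub>R P - (Q o\<^sub>L (Z o\<^sub>L Z) o\<^sub>L Q))"
      using sa by (simp add: positive_op_iff selfadjoint_diff)
  qed
  also have "fun_calc (cutoff n) (?z *\<^sub>R P) = fun_calc (cutoff (n * ?z)) Y"
  proof -
    have cm: "continuous_on {- ?L..?L} (\<lambda>r. max r 0)" by (intro continuous_intros)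
    have "?z *\<^sub>R P = fun_calc (\<lambda>r. ?z * max r 0) Y"
      unfolding P_def by (rule fun_calc_scale[OF bY cm, symmetric])
    then have "fun_calc (cutoff n) (?z *\<^sub>R P) = fun_calc (\<lambda>r. cutoff n (?z * max r 0)) Y"
      by (simp only:, intro fun_calc_compose[OF bY, where c = 0 and d = "?z * ?L"] continuous_intros)
        (auto intro!: mult_left_mono)
    also have "\<dots> = fun_calc (cutoff (n * ?z)) Y"
    proof (rule fun_calc_cong[OF bY])
      fix r show "cutoff n (?z * max r 0) = cutoff (n * ?z) r"
      proof (cases "r \<ge> 0")
        case True then show ?thesis by (simp add: cutoff_def mult.assoc)
      next
        case False then show ?thesis using n by (simp add: cutoff_nonpos max_def)
      qed
    qed
    finally show ?thesis .
  qed
  finally show ?thesis .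
qed

text \<open>\<open>pos_rank Y\<close> is the trace of the spectral projection of \<open>Y\<close> for \<open>(0, \<infinity>)\<close>, obtained without
  constructing the projection.\<close>

definition pos_rank :: "'h op \<Rightarrow> ennreal" where
  "pos_rank Y = (SUP n. ennreal (t (fun_calc (cutoff (real n)) Y)))"

text \<open>Congruence costs only the factor \<open>(norm Z)^2\<close> in the slope of the cutoff,
  and the supremum over slopes absorbs it.\<close>

lemma pos_rank_conj_le:
  assumes Y: "Y \<in> M" "selfadjoint Y" and Z: "Z \<in> M" "selfadjoint Z"
  shows "pos_rank (Z o\<^sub>L Y o\<^sub>L Z) \<le> pos_rank Y"
  unfolding pos_rank_def
proof (rule SUP_least)
  fix n :: nat
  obtain m :: nat where m: "real n * (norm Z)\<^sup>2 \<le> real m" using real_arch_simple by blast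
  have bY: "op_between (- norm Y) (norm Y) Y" using Y(2) by (rule op_between_norm) simp
  have "t (fun_calc (cutoff (real n)) (Z o\<^sub>L Y o\<^sub>L Z)) \<le> t (fun_calc (cutoff (real n * (norm Z)\<^sup>2)) Y)"
    using assms by (intro t_cutoff_conj_le) auto
  also have "\<dots> \<le> t (fun_calc (cutoff (real m)) Y)"
    using m by (intro t_fun_calc_mono[OF Y(1) bY] cutoff_mono_left) (auto intro!: continuous_intros)
  finally show "ennreal (t (fun_calc (cutoff (real n)) (Z o\<^sub>L Y o\<^sub>L Z)))
      \<le> (SUP n. ennreal (t (fun_calc (cutoff (real n)) Y)))"
    by (intro SUP_upper2[of m] ennreal_leI) auto
qed

text \<open>Sylvester's law: the inequality is applied to \<open>Z\<close> and then to its
  inverse.\<close>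

lemma pos_rank_conj:
  assumes Y: "Y \<in> M" "selfadjoint Y" and Z: "Z \<in> M" "selfadjoint Z" and W: "W \<in> M" "selfadjoint W"
    and inv: "W o\<^sub>L Z = id_blinfun" "Z o\<^sub>L W = id_blinfun"
  shows "pos_rank (Z o\<^sub>L Y o\<^sub>L Z) = pos_rank Y"
proof (rule antisym[OF pos_rank_conj_le[OF Y Z]])
  have "W o\<^sub>L (Z o\<^sub>L Y o\<^sub>L Z) o\<^sub>L W = (W o\<^sub>L Z) o\<^sub>L Y o\<^sub>L (Z o\<^sub>L W)" by (simp add: blinfun_compose_assoc)
  also have "\<dots> = Y" by (simp add: inv blinfun_compose_id)
  finally show "pos_rank Y \<le> pos_rank (Z o\<^sub>L Y o\<^sub>L Z)"
    using pos_rank_conj_le[of "Z o\<^sub>L Y o\<^sub>L Z" W] Y Z W by (simp add: M_compose selfadjoint_conj)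
qed

lemma pos_rank_eq_0:
  assumes "op_between a b Y" "b \<le> 0"
  shows "pos_rank Y = 0"
proof -
  have "fun_calc (cutoff (real n)) Y = fun_calc (\<lambda>_. 0) Y" for n
    using assms(2) by (intro fun_calc_cong[OF assms(1)]) (auto simp: cutoff_nonpos)
  then show ?thesis by (simp add: pos_rank_def fun_calc_const[OF assms(1)] t_0)
qed

text \<open>With \<open>Y\<close> fixed and the function varying, bounded linearity is what
  exchanges the trace with an integral over a family of functions.\<close>

lemma t_fun_calc_bounded_linear:
  assumes Y: "Y \<in> M" "op_between a b Y"
  shows "bounded_linear (\<lambda>u. t (fun_calc (apply_bcontfun u) Y))"
proof (rule bounded_linear_intro[of _ "\<bar>K\<bar>"])
  have c: "continuous_on {a..b} (apply_bcontfun u)" for u :: "real \<Rightarrow>\<^sub>C real"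
    by simp
  fix u v :: "real \<Rightarrow>\<^sub>C real" and r :: real
  show "t (fun_calc (apply_bcontfun (u + v)) Y) = t (fun_calc (apply_bcontfun u) Y) + t (fun_calc (apply_bcontfun v) Y)"
    using Y by (simp add: plus_bcontfun.rep_eq[abs_def] fun_calc_add[OF Y(2) c c] t_add M_fun_calc[OF Y c])
  show "t (fun_calc (apply_bcontfun (r *\<^sub>R u)) Y) = r *\<^sub>R t (fun_calc (apply_bcontfun u) Y)"
    using Y by (simp add: scaleR_bcontfun.rep_eq[abs_def] fun_calc_scale[OF Y(2) c] t_scaleR M_fun_calc[OF Y c])
  have "norm (t (fun_calc (apply_bcontfun u) Y)) \<le> K * norm (fun_calc (apply_bcontfun u) Y)"
    using t_bound[OF M_fun_calc[OF Y c]] by simp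
  also have "\<dots> \<le> \<bar>K\<bar> * norm u"
    using norm_bounded[of u] by (intro mult_mono norm_fun_calc_le[OF Y(2) c]) auto
  finally show "norm (t (fun_calc (apply_bcontfun u) Y)) \<le> norm u * \<bar>K\<bar>" by (simp add: mult.commute)
qed

text \<open>The scalar identity behind this: integrating \<open>h\<close> over those
  \<open>r \<ge> 0\<close> with \<open>r < w\<close> gives \<open>integral {0..max w 0} h\<close>.
  It is used first with a cutoff of slope \<open>n\<close> in place of the indicator. Then
  \<open>n\<close> grows, by monotone convergence on the left and by uniform convergence inside the
  calculus on the right.\<close>

lemma pos_rank_layer_cake:
  assumes Y: "Y \<in> M" "selfadjoint Y"
    and h: "continuous_on {0..} h" and hpos: "\<And>r. 0 \<le> r \<Longrightarrow> 0 \<le> h r"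
  shows "(\<integral>\<^sup>+ r. ennreal (h r) * pos_rank (Y - r *\<^sub>R id_blinfun) * indicator {0..} r \<partial>lborel)
    = ennreal (t (fun_calc (\<lambda>w. integral {0..max w 0} h) Y))"
proof -
  define L where "L = norm Y"
  have L0: "0 \<le> L" by (simp add: L_def)
  have bY: "op_between (- L) L Y" using Y(2) by (rule op_between_norm) (simp add: L_def)
  have hL: "continuous_on {0..c} h" for c by (rule continuous_on_subset[OF h]) auto
  have "bounded (h ` {0..L})" by (intro compact_imp_bounded compact_continuous_image hL compact_Icc)
  then obtain C where "\<forall>y\<in>h ` {0..L}. norm y \<le> C" unfolding bounded_iff by blast
  then have C: "\<And>r. r \<in> {0..L} \<Longrightarrow> \<bar>h r\<bar> \<le> C" by auto
  have C0: "0 \<le> C" using C[of 0] L0 by auto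
  define H where "H w = integral {0..max w 0} h" for w
  define T where "T n r = t (fun_calc (cutoff (real n)) (Y - r *\<^sub>R id_blinfun))" for n r
  define k where "k n r = Bcontfun (\<lambda>w. cutoff (real n) (w - r))" for n r
  have k: "apply_bcontfun (k n r) = (\<lambda>w. cutoff (real n) (w - r))" for n r
    unfolding k_def
    by (intro Bcontfun_inverse bcontfun_normI[of _ 1] continuous_intros)
      (simp add: cutoff_nonneg cutoff_le_1)
  \<comment> \<open>The layers are integrated in the Banach space of bounded continuous functions of
    \<open>w\<close>, where the trace of the calculus at \<open>Y\<close> is a bounded linear
    functional and so passes inside.\<close>
  define g where "g n r = h r *\<^sub>R k n r" for n r
  have kc: "continuous_on S (k n)" for S n
  proof (rule lipschitz_on_continuous_on)
    show "(real n)-lipschitz_on S (k n)"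
    proof (rule lipschitz_onI)
      fix x y
      show "dist (k n x) (k n y) \<le> real n * dist x y"
      proof (rule dist_bound)
        fix w show "dist (apply_bcontfun (k n x) w) (apply_bcontfun (k n y) w) \<le> real n * dist x y"
          unfolding k using lipschitz_onD[OF lipschitz_cutoff[of "real n"], of "w - x" "w - y"]
          by (simp add: dist_real_def abs_minus_commute)
      qed
    qed simp
  qed
  have gc: "continuous_on {0..L} (g n)" for n
    unfolding g_def by (intro continuous_intros hL kc)
  define I where "I n = integral {0..L} (g n)" for n
  have gI: "(g n has_integral I n) {0..L}" for n
    unfolding I_def by (intro integrable_integral integrable_continuous_interval gc)
  have sh: "fun_calc (cutoff (real n)) (Y - r *\<^sub>R id_blinfun) = fun_calc (\<lambda>w. cutoff (real n) (w - r)) Y" for n r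
    using fun_calc_shift[OF bY, of "- r" "cutoff (real n)"] by (simp add: continuous_on_cutoff)
  have cw: "continuous_on S (\<lambda>w. cutoff (real n) (w - r))" for S n r by (intro continuous_intros)
  have tI: "((\<lambda>r. h r * T n r) has_integral t (fun_calc (apply_bcontfun (I n)) Y)) {0..L}" for n
  proof -
    have "((\<lambda>u. t (fun_calc (apply_bcontfun u) Y)) \<circ> g n has_integral t (fun_calc (apply_bcontfun (I n)) Y)) {0..L}"
      by (rule has_integral_linear[OF gI t_fun_calc_bounded_linear[OF Y(1) bY]])
    moreover have "((\<lambda>u. t (fun_calc (apply_bcontfun u) Y)) \<circ> g n) r = h r * T n r" for r
      unfolding comp_def g_def T_def sh
      by (simp add: k fun_calc_scale[OF bY cw] t_scaleR M_fun_calc[OF Y(1) bY cw])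
    ultimately show ?thesis by (simp add: fun_eq_iff[symmetric] comp_def)
  qed
  have apI: "apply_bcontfun (I n) w = integral {0..L} (\<lambda>r. h r * cutoff (real n) (w - r))" for n w
  proof -
    have "bounded_linear (\<lambda>u. apply_bcontfun u w :: real)"
    proof (rule bounded_linear_intro[of _ 1])
      show "norm (apply_bcontfun u w) \<le> norm u * 1" for u :: "real \<Rightarrow>\<^sub>C real" using norm_bounded[of u w] by simp
    qed simp_all
    from has_integral_linear[OF gI[of n] this]
    have "((\<lambda>r. h r * cutoff (real n) (w - r)) has_integral apply_bcontfun (I n) w) {0..L}"
      by (simp add: comp_def g_def k)
    then show ?thesis by (rule integral_unique[symmetric])
  qed
  have ig: "(\<lambda>r. h r * cutoff (real n) (w - r)) integrable_on {c..d}" if "0 \<le> c" for n w c d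
    using that by (intro integrable_continuous_interval continuous_intros continuous_on_subset[OF h]) auto
  \<comment> \<open>The integrands differ only for \<open>r\<close> within \<open>1 / n\<close>
    below \<open>w\<close>, where the cutoff has not yet reached 1, and there by at most
    \<open>C\<close>.\<close>
  have close: "\<bar>apply_bcontfun (I n) w - H w\<bar> \<le> C * (1 / real n)" if w: "w \<in> {- L..L}" and n: "n > 0" for n w
  proof (cases "w \<le> 0")
    case True
    have "apply_bcontfun (I n) w = integral {0..L} (\<lambda>r. 0)"
      unfolding apI by (rule Henstock_Kurzweil_Integration.integral_cong) (use True in \<open>simp add: cutoff_nonpos\<close>)
    then show ?thesis using True C0 by (simp add: H_def max_def)
  next
    case False
    define c where "c = max 0 (w - 1 / real n)"
    let ?f = "\<lambda>r. h r * cutoff (real n) (w - r)"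
    have c: "0 \<le> c" "c \<le> w" "w \<le> L" "w - c \<le> 1 / real n" using False w n by (auto simp: c_def)
    have "integral {0..w} ?f + integral {w..L} ?f = integral {0..L} ?f"
      using False w by (intro Henstock_Kurzweil_Integration.integral_combine ig) auto
    moreover have "integral {w..L} ?f = integral {w..L} (\<lambda>r. 0)"
      by (rule Henstock_Kurzweil_Integration.integral_cong) (simp add: cutoff_nonpos)
    ultimately have 1: "apply_bcontfun (I n) w = integral {0..w} ?f" by (simp add: apI)
    have 2: "integral {0..c} ?f + integral {c..w} ?f = integral {0..w} ?f"
      using c by (intro Henstock_Kurzweil_Integration.integral_combine ig) auto
    have ih: "h integrable_on {d..e}" if "0 \<le> d" for d e
      using that by (intro integrable_continuous_interval continuous_on_subset[OF h]) auto
    have 3: "integral {0..c} h + integral {c..w} h = H w"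
      using c False unfolding H_def by (simp add: Henstock_Kurzweil_Integration.integral_combine ih)
    have 4: "integral {0..c} ?f = integral {0..c} h"
    \<comment> \<open>Dropping the endpoint covers the degenerate case \<open>c = 0\<close>, in
      which the cutoff there may be below 1.\<close>
    proof (rule integral_spike[of "{c}"])
      fix r assume r: "r \<in> {0..c} - {c}"
      then have "r < w - 1 / real n" by (auto simp: c_def max_def split: if_splits)
      then have "1 \<le> real n * (w - r)" using n by (simp add: field_simps)
      then show "h r = ?f r" by (simp add: cutoff_eq_1)
    qed simp
    have "norm (integral {c..w} (\<lambda>r. ?f r - h r)) \<le> C * (w - c)"
    proof (rule integral_bound)
      fix r assume r: "r \<in> {c..w}"
      have "?f r - h r = - (h r * (1 - cutoff (real n) (w - r)))" by (simp add: algebra_simps)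
      then have "norm (?f r - h r) = \<bar>h r\<bar> * (1 - cutoff (real n) (w - r))"
        by (simp add: abs_mult cutoff_le_1)
      also have "\<dots> \<le> C * 1" using r c C[of r] by (intro mult_mono) (auto simp: cutoff_nonneg cutoff_le_1)
      finally show "norm (?f r - h r) \<le> C" by simp
    qed (use c in \<open>auto intro!: continuous_intros continuous_on_subset[OF h]\<close>)
    also have "\<dots> \<le> C * (1 / real n)" using c C0 by (intro mult_left_mono)
    finally have "\<bar>integral {c..w} ?f - integral {c..w} h\<bar> \<le> C * (1 / real n)"
      using c by (simp add: Henstock_Kurzweil_Integration.integral_diff ig ih)
    then show ?thesis using 1 2 3 4 by simp
  qed
  have ul: "uniform_limit {- L..L} (\<lambda>n. apply_bcontfun (I n)) H sequentially"
  proof (rule uniform_limitI)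
    fix e :: real assume e: "0 < e"
    have "(\<lambda>n. C * (1 / real n)) \<longlonglongrightarrow> C * 0" by (intro tendsto_mult tendsto_const lim_1_over_n)
    then have "\<forall>\<^sub>F n in sequentially. C * (1 / real n) < e" using e by (intro order_tendstoD) auto
    then show "\<forall>\<^sub>F n in sequentially. \<forall>w\<in>{- L..L}. dist (apply_bcontfun (I n) w) (H w) < e"
      using eventually_gt_at_top[of 0]
    proof eventually_elim
      case (elim n)
      show ?case
      proof
        fix w assume "w \<in> {- L..L}"
        from close[OF this elim(2)] elim show "dist (apply_bcontfun (I n) w) (H w) < e"
          unfolding dist_real_def by linarith
      qed
    qed
  qed
  have lim: "(\<lambda>n. t (fun_calc (apply_bcontfun (I n)) Y)) \<longlonglongrightarrow> t (fun_calc H Y)"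
    by (intro t_tendsto fun_calc_uniform_limit[OF bY _ ul] M_fun_calc[OF Y(1) bY]) simp_all
  have bYr: "op_between (- L - r) (L - r) (Y - r *\<^sub>R id_blinfun)" for r
    using op_between_add[OF bY op_between_id[of "- r"]] by simp
  have YrM: "Y - r *\<^sub>R id_blinfun \<in> M" for r using Y by (intro M_closed)
  have T0: "0 \<le> T n r" for n r
    unfolding T_def
    by (intro t_nonneg positive_fun_calc[OF bYr] M_fun_calc[OF YrM bYr] continuous_intros) (simp add: cutoff_nonneg)
  have Tmono: "T n r \<le> T m r" if "n \<le> m" for n m r
    unfolding T_def using that
    by (intro t_fun_calc_mono[OF YrM bYr] continuous_intros cutoff_mono_left) auto
  \<comment> \<open>Restricting to \<open>{0..L}\<close> loses nothing: for \<open>r > L\<close> the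
    operator \<open>Y - r\<close> is negative and its \<open>pos_rank\<close> is zero.\<close>
  define F where "F n r = ennreal (h r * T n r) * indicator {0..L} r" for n r
  have Tc: "continuous_on S (T n)" for S n
    unfolding T_def
    by (intro continuous_on_t continuous_on_fun_calc_UNIV M_fun_calc[OF YrM bYr] continuous_intros
        selfadjoint_diff selfadjoint_scaleR selfadjoint_id Y)
  have Fm: "F n \<in> borel_measurable lborel" for n
  proof -
    have "(\<lambda>r. ennreal (indicator {0..L} r *\<^sub>R (h r * T n r))) \<in> borel_measurable borel"
      by (intro measurable_compose[OF _ measurable_ennreal] borel_measurable_continuous_on_indicator continuous_intros hL Tc) simp
    also have "(\<lambda>r. ennreal (indicator {0..L} r *\<^sub>R (h r * T n r))) = F n"
      by (auto simp: F_def fun_eq_iff indicator_def)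
    finally show ?thesis by simp
  qed
  have Fint: "(\<integral>\<^sup>+ r. F n r \<partial>lborel) = ennreal (t (fun_calc (apply_bcontfun (I n)) Y))" for n
    unfolding F_def using hpos T0 by (intro nn_integral_has_integral_lebesgue'[OF _ tI]) auto
  have Finc: "incseq F"
  proof (intro incseq_SucI le_funI)
    fix n r show "F n r \<le> F (Suc n) r"
      unfolding F_def using hpos[of r] Tmono[of n "Suc n" r]
      by (cases "r \<in> {0..L}") (auto intro!: ennreal_leI mult_left_mono)
  qed
  have FSUP: "ennreal (h r) * pos_rank (Y - r *\<^sub>R id_blinfun) * indicator {0..} r = (SUP n. F n r)" for r
  proof (cases "r \<in> {0..L}")
    case True
    then have "F n r = ennreal (h r) * ennreal (T n r)" for n
      using hpos[of r] T0 by (simp add: F_def ennreal_mult)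
    then show ?thesis using True by (simp add: pos_rank_def SUP_mult_left_ennreal T_def)
  next
    case False
    show ?thesis
    proof (cases "r < 0")
      case True then show ?thesis by (simp add: F_def)
    next
      case nn: False
      then have "pos_rank (Y - r *\<^sub>R id_blinfun) = 0" using False by (intro pos_rank_eq_0[OF bYr]) auto
      then show ?thesis using False by (simp add: F_def)
    qed
  qed
  have "(\<integral>\<^sup>+ r. ennreal (h r) * pos_rank (Y - r *\<^sub>R id_blinfun) * indicator {0..} r \<partial>lborel)
      = (SUP n. \<integral>\<^sup>+ r. F n r \<partial>lborel)"
    unfolding FSUP by (rule nn_integral_monotone_convergence_SUP[OF Finc Fm])
  also have "\<dots> = (SUP n. ennreal (t (fun_calc (apply_bcontfun (I n)) Y)))" by (simp add: Fint)
  also have "\<dots> = ennreal (t (fun_calc H Y))"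
  proof (rule LIMSEQ_unique[OF LIMSEQ_SUP])
    show "incseq (\<lambda>n. ennreal (t (fun_calc (apply_bcontfun (I n)) Y)))"
      unfolding Fint[symmetric] using Finc by (auto intro!: incseq_SucI nn_integral_mono simp: incseq_Suc_iff le_fun_def)
    show "(\<lambda>n. ennreal (t (fun_calc (apply_bcontfun (I n)) Y))) \<longlonglongrightarrow> ennreal (t (fun_calc H Y))"
      by (intro tendsto_ennrealI lim)
  qed
  finally show ?thesis by (simp add: H_def[abs_def])
qed

lemma pos_rank_measurable:
  fixes X :: "'b::{metric_space} \<Rightarrow> 'h op"
  assumes "continuous_on UNIV X" "\<And>s. X s \<in> M" "\<And>s. selfadjoint (X s)"
  shows "(\<lambda>s. pos_rank (X s)) \<in> borel_measurable borel"
proof -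
  have "continuous_on UNIV (\<lambda>s. t (fun_calc (cutoff (real n)) (X s)))" for n
    using assms(2)
    by (intro continuous_on_t continuous_on_fun_calc_UNIV assms continuous_intros
        M_fun_calc[OF _ op_between_norm[OF assms(3) order_refl]])
  then show ?thesis unfolding pos_rank_def
    by (intro borel_measurable_SUP measurable_compose[OF _ measurable_ennreal] borel_measurable_continuous_onI) auto
qed

end

section \<open>The integral formula for a bounded tracial functional\<close>

context tracial_functional
begin

context
  fixes A :: "'h op" and c a :: real
  assumes A: "A \<in> M" "op_between c a A" and c: "0 < c" "c \<le> a"
begin

definition inv_sqrt :: "real \<Rightarrow> 'h op" where
  "inv_sqrt s = fun_calc (\<lambda>r. 1 / sqrt r) (A + s *\<^sub>R id_blinfun)"

lemma op_between_A_shift: "op_between (c + s) (a + s) (A + s *\<^sub>R id_blinfun)"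
  using op_between_add[OF A(2) op_between_id[of s]] .

lemma A_shift_in_M: "A + s *\<^sub>R id_blinfun \<in> M"
  by (intro M_closed A)

context
  fixes s :: real
  assumes s: "0 \<le> s"
begin

lemma continuous_on_inv_sqrt_A_shift: "continuous_on {c + s..a + s} (\<lambda>r. 1 / sqrt r)"
  using c s by (intro continuous_intros) auto

lemma inv_sqrt_in_M: "inv_sqrt s \<in> M"
  unfolding inv_sqrt_def
  by (rule M_fun_calc[OF A_shift_in_M op_between_A_shift continuous_on_inv_sqrt_A_shift])

lemma selfadjoint_inv_sqrt: "selfadjoint (inv_sqrt s)"
  unfolding inv_sqrt_def
  by (rule selfadjoint_fun_calc[OF op_between_A_shift continuous_on_inv_sqrt_A_shift])

lemma norm_inv_sqrt_le: "norm (inv_sqrt s) \<le> 1 / sqrt (c + s)"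
  unfolding inv_sqrt_def
proof (rule norm_fun_calc_le[OF op_between_A_shift continuous_on_inv_sqrt_A_shift])
  fix r assume "r \<in> {c + s..a + s}"
  then show "\<bar>1 / sqrt r\<bar> \<le> 1 / sqrt (c + s)" using c s by (auto intro!: frac_le)
qed (use c s in simp)

lemma norm_conj_inv_sqrt_le: "norm (inv_sqrt s o\<^sub>L T o\<^sub>L inv_sqrt s) \<le> norm T / (c + s)"
proof -
  have "norm (inv_sqrt s o\<^sub>L T o\<^sub>L inv_sqrt s) \<le> norm (inv_sqrt s) * norm T * norm (inv_sqrt s)"
    by (meson norm_blinfun_compose mult_right_mono norm_ge_zero order_trans)
  also have "\<dots> = (norm (inv_sqrt s))\<^sup>2 * norm T" by (simp add: power2_eq_square)
  also have "\<dots> \<le> (1 / sqrt (c + s))\<^sup>2 * norm T" by (intro mult_right_mono power_mono norm_inv_sqrt_le) auto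
  also have "\<dots> = norm T / (c + s)" using c s by (simp add: power_divide)
  finally show ?thesis .
qed

lemma inv_sqrt_invertible:
  obtains W where "W \<in> M" "selfadjoint W" "W o\<^sub>L inv_sqrt s = id_blinfun" "inv_sqrt s o\<^sub>L W = id_blinfun"
proof
  let ?W = "fun_calc sqrt (A + s *\<^sub>R id_blinfun)"
  note b = op_between_A_shift[of s]
  have cs: "continuous_on {c + s..a + s} sqrt" by (intro continuous_intros)
  show "?W \<in> M" "selfadjoint ?W"
    by (intro M_fun_calc[OF A_shift_in_M b cs] selfadjoint_fun_calc[OF b cs])+
  have "fun_calc (\<lambda>r. sqrt r * (1 / sqrt r)) (A + s *\<^sub>R id_blinfun) = fun_calc (\<lambda>_. 1) (A + s *\<^sub>R id_blinfun)"
    "fun_calc (\<lambda>r. (1 / sqrt r) * sqrt r) (A + s *\<^sub>R id_blinfun) = fun_calc (\<lambda>_. 1) (A + s *\<^sub>R id_blinfun)"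
    by (rule fun_calc_cong[OF b]; use c s in auto)+
  then show "?W o\<^sub>L inv_sqrt s = id_blinfun" "inv_sqrt s o\<^sub>L ?W = id_blinfun"
    unfolding inv_sqrt_def
    by (simp_all add: fun_calc_mult[OF b cs continuous_on_inv_sqrt_A_shift, symmetric]
        fun_calc_mult[OF b continuous_on_inv_sqrt_A_shift cs, symmetric] fun_calc_const[OF b])
qed

lemma inv_sqrt_conj_A_shift: "inv_sqrt s o\<^sub>L (A + s *\<^sub>R id_blinfun) o\<^sub>L inv_sqrt s = id_blinfun"
proof -
  let ?T = "A + s *\<^sub>R id_blinfun"
  note b = op_between_A_shift[of s]
  note cs = continuous_on_inv_sqrt_A_shift
  have c2: "continuous_on {c + s..a + s} (\<lambda>r. (1 / sqrt r) * r)" by (intro continuous_intros cs)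
  have "fun_calc (\<lambda>r. (1 / sqrt r) * r * (1 / sqrt r)) ?T = inv_sqrt s o\<^sub>L ?T o\<^sub>L inv_sqrt s"
    unfolding inv_sqrt_def fun_calc_mult[OF b c2 cs] fun_calc_mult[OF b cs continuous_on_id]
    by (simp add: fun_calc_ident[OF b])
  moreover have "fun_calc (\<lambda>r. (1 / sqrt r) * r * (1 / sqrt r)) ?T = fun_calc (\<lambda>_. 1) ?T"
    by (rule fun_calc_cong[OF b]) (use c s in \<open>auto simp: field_simps\<close>)
  ultimately show ?thesis by (simp add: fun_calc_const[OF b])
qed

text \<open>Writing the identity as \<open>inv_sqrt s\<close> times \<open>A + s\<close> times
  \<open>inv_sqrt s\<close> exhibits the left operator as a congruence of the right one by an
  invertible operator.\<close>

lemma pos_rank_conj_inv_sqrt: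
  assumes B: "B \<in> M" "selfadjoint B"
  shows "pos_rank ((inv_sqrt s o\<^sub>L B o\<^sub>L inv_sqrt s) - r *\<^sub>R id_blinfun) = pos_rank (B - r *\<^sub>R A - (r * s) *\<^sub>R id_blinfun)"
proof -
  let ?Y = "B - r *\<^sub>R A - (r * s) *\<^sub>R id_blinfun"
  have "(inv_sqrt s o\<^sub>L B o\<^sub>L inv_sqrt s) - r *\<^sub>R (inv_sqrt s o\<^sub>L (A + s *\<^sub>R id_blinfun) o\<^sub>L inv_sqrt s)
      = inv_sqrt s o\<^sub>L ?Y o\<^sub>L inv_sqrt s"
    by (intro blinfun_eqI) (simp add: blinfun.bilinear_simps scaleR_add_right)
  then have eq: "(inv_sqrt s o\<^sub>L B o\<^sub>L inv_sqrt s) - r *\<^sub>R id_blinfun = inv_sqrt s o\<^sub>L ?Y o\<^sub>L inv_sqrt s"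
    by (simp add: inv_sqrt_conj_A_shift)
  obtain W where W: "W \<in> M" "selfadjoint W" "W o\<^sub>L inv_sqrt s = id_blinfun" "inv_sqrt s o\<^sub>L W = id_blinfun"
    by (rule inv_sqrt_invertible)
  show ?thesis unfolding eq
  proof (rule pos_rank_conj[OF _ _ inv_sqrt_in_M selfadjoint_inv_sqrt W])
    show "?Y \<in> M" by (intro M_closed A B)
    show "selfadjoint ?Y"
      using A(2) by (intro selfadjoint_diff selfadjoint_scaleR selfadjoint_id B) (simp add: op_between_def)
  qed
qed

end

text \<open>Clipping the argument at \<open>c\<close> gives a function continuous on the whole line
  without changing its values on \<open>A + s\<close>, which is bounded below by
  \<open>c\<close>.\<close>

lemma continuous_on_inv_sqrt: "continuous_on {0..} inv_sqrt"
proof -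
  have sa: "selfadjoint A" using A(2) by (simp add: op_between_def)
  have "continuous_on {0..} (\<lambda>s. fun_calc (\<lambda>r. 1 / sqrt (max c r)) (A + s *\<^sub>R id_blinfun))"
    using c by (intro continuous_on_fun_calc_UNIV continuous_intros selfadjoint_add selfadjoint_scaleR selfadjoint_id sa) auto
  moreover have "fun_calc (\<lambda>r. 1 / sqrt (max c r)) (A + s *\<^sub>R id_blinfun) = inv_sqrt s" if "s \<in> {0..}" for s
    unfolding inv_sqrt_def using that
    by (intro fun_calc_cong[OF op_between_A_shift]) (auto simp: max_def)
  ultimately show ?thesis by (rule continuous_on_eq)
qed

text \<open>Both sides are integrals of \<open>pos_rank (B - t A - l)\<close> over the quadrant, the right-hand one in
  the coordinates \<open>(t, s)\<close> with \<open>l = t s\<close>.\<close>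

lemma integrated_trace_formula:
  assumes B: "B \<in> M" "selfadjoint B"
    and f: "continuous_on {0..} f" and fpos: "\<And>r. 0 \<le> r \<Longrightarrow> 0 \<le> f r"
  shows "(\<integral>\<^sup>+ r. ennreal (f r) * ennreal (t (fun_calc (\<lambda>w. integral {0..max w 0} (\<lambda>r. r)) (B - r *\<^sub>R A))) * indicator {0..} r \<partial>lborel)
    = (\<integral>\<^sup>+ s. ennreal s * ennreal (t (fun_calc (\<lambda>w. integral {0..max w 0} (\<lambda>r. r\<^sup>2 * f r)) (inv_sqrt s o\<^sub>L B o\<^sub>L inv_sqrt s)))
        * indicator {0..} s \<partial>lborel)" (is "?lhs = ?rhs")
proof -
  let ?\<rho> = "\<lambda>r l. pos_rank (B - r *\<^sub>R A - l *\<^sub>R id_blinfun)"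
  have sa: "selfadjoint A" using A(2) by (simp add: op_between_def)
  have BrM: "B - r *\<^sub>R A \<in> M" "B - r *\<^sub>R A - l *\<^sub>R id_blinfun \<in> M" for r l by (intro M_closed A B)+
  have Brs: "selfadjoint (B - r *\<^sub>R A)" "selfadjoint (B - r *\<^sub>R A - l *\<^sub>R id_blinfun)" for r l
    by (intro selfadjoint_diff selfadjoint_scaleR selfadjoint_id sa B)+
  \<comment> \<open>The weight \<open>r^2 * s\<close> is \<open>l\<close> times the Jacobian:
    \<open>l = r * s\<close> contributes one factor \<open>r\<close>, and the substitution the
    other.\<close>
  define F where "F r s = ennreal (f r) * indicator {0..} r * (ennreal (r\<^sup>2) * (ennreal s * indicator {0..} s * ?\<rho> r (r * s)))" for r s
  have mf: "(\<lambda>r. ennreal (f r) * indicator {0..} r) \<in> borel_measurable borel"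
  proof -
    have "(\<lambda>r. ennreal (indicator {0..} r *\<^sub>R f r)) \<in> borel_measurable borel"
      by (intro measurable_compose[OF _ measurable_ennreal] borel_measurable_continuous_on_indicator f) simp
    also have "(\<lambda>r. ennreal (indicator {0..} r *\<^sub>R f r)) = (\<lambda>r. ennreal (f r) * indicator {0..} r)"
      by (auto simp: fun_eq_iff indicator_def)
    finally show ?thesis .
  qed
  have mr: "(\<lambda>p. ?\<rho> (fst p) (fst p * snd p)) \<in> borel_measurable (borel :: (real \<times> real) measure)"
    by (intro pos_rank_measurable continuous_intros BrM Brs)
  have mF: "(\<lambda>(r, s). F r s) \<in> borel_measurable (lborel \<Otimes>\<^sub>M lborel)"
  proof -
    have [measurable]: "(\<lambda>p. ?\<rho> (fst p) (fst p * snd p)) \<in> borel_measurable (borel \<Otimes>\<^sub>M borel :: (real \<times> real) measure)"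
      using mr by (simp add: borel_prod)
    note [measurable] = mf
    have "(\<lambda>p. (ennreal (f (fst p)) * indicator {0..} (fst p)) * (ennreal ((fst p)\<^sup>2) * (ennreal (snd p) * indicator {0..} (snd p) * ?\<rho> (fst p) (fst p * snd p))))
       \<in> borel_measurable (borel \<Otimes>\<^sub>M borel :: (real \<times> real) measure)"
      using measurable_compose[OF measurable_fst mf] by measurable
    then show ?thesis by (simp add: F_def case_prod_beta)
  qed
  have "?lhs = (\<integral>\<^sup>+ r. (\<integral>\<^sup>+ s. F r s \<partial>lborel) \<partial>lborel)"
  proof (rule nn_integral_cong_AE)
    \<comment> \<open>At \<open>r = 0\<close> the substitution degenerates; a single point is
      negligible.\<close>
    show "AE r in lborel. ennreal (f r) * ennreal (t (fun_calc (\<lambda>w. integral {0..max w 0} (\<lambda>r. r)) (B - r *\<^sub>R A))) * indicator {0..} r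
        = (\<integral>\<^sup>+ s. F r s \<partial>lborel)"
      using AE_lborel_singleton[of 0]
    proof eventually_elim
      case (elim r)
      show ?case
      proof (cases "r > 0")
        case True
        have m: "(\<lambda>l. ?\<rho> r l) \<in> borel_measurable borel"
          by (intro pos_rank_measurable continuous_intros BrM Brs)
        have m': "(\<lambda>s. ?\<rho> r (r * s)) \<in> borel_measurable borel"
          by (intro pos_rank_measurable continuous_intros BrM Brs)
        have "ennreal (t (fun_calc (\<lambda>w. integral {0..max w 0} (\<lambda>r. r)) (B - r *\<^sub>R A)))
            = (\<integral>\<^sup>+ l. ennreal l * ?\<rho> r l * indicator {0..} l \<partial>lborel)"
          by (rule pos_rank_layer_cake[OF BrM(1) Brs(1), symmetric]) (auto intro: continuous_intros)
        also have "\<dots> = ennreal \<bar>r\<bar> * (\<integral>\<^sup>+ s. ennreal (0 + r * s) * ?\<rho> r (0 + r * s) * indicator {0..} (0 + r * s) \<partial>lborel)"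
          using m True by (intro nn_integral_real_affine borel_measurable_times_ennreal borel_measurable_indicator) auto
        also have "\<dots> = (\<integral>\<^sup>+ s. ennreal r * (ennreal (0 + r * s) * ?\<rho> r (0 + r * s) * indicator {0..} (0 + r * s)) \<partial>lborel)"
          using m' True by (subst nn_integral_cmult) auto
        also have "\<dots> = (\<integral>\<^sup>+ s. ennreal (r\<^sup>2) * (ennreal s * indicator {0..} s * ?\<rho> r (r * s)) \<partial>lborel)"
        proof (rule nn_integral_cong)
          fix s
          show "ennreal r * (ennreal (0 + r * s) * ?\<rho> r (0 + r * s) * indicator {0..} (0 + r * s))
            = ennreal (r\<^sup>2) * (ennreal s * indicator {0..} s * ?\<rho> r (r * s))"
          proof (cases "s \<ge> 0")
            case s: True
            then have "0 \<le> r * s" using True by simp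
            then show ?thesis using s True by (simp add: ennreal_mult power2_eq_square mult_ac)
          next
            case False
            then have "r * s < 0" using True by (simp add: mult_pos_neg)
            then show ?thesis using False by simp
          qed
        qed
        finally have "ennreal (t (fun_calc (\<lambda>w. integral {0..max w 0} (\<lambda>r. r)) (B - r *\<^sub>R A)))
          = (\<integral>\<^sup>+ s. ennreal (r\<^sup>2) * (ennreal s * indicator {0..} s * ?\<rho> r (r * s)) \<partial>lborel)" .
        moreover have "(\<integral>\<^sup>+ s. F r s \<partial>lborel) = ennreal (f r) * (\<integral>\<^sup>+ s. ennreal (r\<^sup>2) * (ennreal s * indicator {0..} s * ?\<rho> r (r * s)) \<partial>lborel)"
          unfolding F_def using m' True by (subst nn_integral_cmult) auto
        ultimately show ?thesis using True by simp
      next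
        case False
        then have "r < 0" using elim by simp
        then show ?thesis by (simp add: F_def)
      qed
    qed
  qed
  also have "\<dots> = (\<integral>\<^sup>+ s. (\<integral>\<^sup>+ r. F r s \<partial>lborel) \<partial>lborel)"
    by (rule lborel_pair.Fubini'[OF mF, symmetric])
  also have "\<dots> = ?rhs"
  proof (rule nn_integral_cong)
    fix s
    show "(\<integral>\<^sup>+ r. F r s \<partial>lborel) = ennreal s * ennreal (t (fun_calc (\<lambda>w. integral {0..max w 0} (\<lambda>r. r\<^sup>2 * f r)) (inv_sqrt s o\<^sub>L B o\<^sub>L inv_sqrt s)))
        * indicator {0..} s"
    proof (cases "s \<ge> 0")
      case True
      let ?C = "inv_sqrt s o\<^sub>L B o\<^sub>L inv_sqrt s"
      have C: "?C \<in> M" "selfadjoint ?C"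
        by (intro M_compose inv_sqrt_in_M[OF True] B selfadjoint_conj selfadjoint_inv_sqrt[OF True])+
      have m: "(\<lambda>r. ?\<rho> r (r * s)) \<in> borel_measurable borel"
        by (intro pos_rank_measurable continuous_intros BrM Brs)
      \<comment> \<open>For fixed \<open>s\<close> the inner integral is again a layer-cake
        integral, now for \<open>?C\<close>, once inertia identifies
        \<open>?\<rho> r (r * s)\<close> with the \<open>pos_rank\<close> of
        \<open>?C - r\<close>.\<close>
      have "ennreal (t (fun_calc (\<lambda>w. integral {0..max w 0} (\<lambda>r. r\<^sup>2 * f r)) ?C))
          = (\<integral>\<^sup>+ r. ennreal (r\<^sup>2 * f r) * pos_rank (?C - r *\<^sub>R id_blinfun) * indicator {0..} r \<partial>lborel)"
        using fpos by (intro pos_rank_layer_cake[OF C, symmetric] continuous_intros f) auto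
      also have "\<dots> = (\<integral>\<^sup>+ r. (ennreal (f r) * indicator {0..} r) * (ennreal (r\<^sup>2) * ?\<rho> r (r * s)) \<partial>lborel)"
      proof (rule nn_integral_cong)
        fix r
        show "ennreal (r\<^sup>2 * f r) * pos_rank (?C - r *\<^sub>R id_blinfun) * indicator {0..} r
          = (ennreal (f r) * indicator {0..} r) * (ennreal (r\<^sup>2) * ?\<rho> r (r * s))"
          using fpos[of r] by (cases "r \<ge> 0") (auto simp: pos_rank_conj_inv_sqrt[OF True B] ennreal_mult mult_ac)
      qed
      finally have eq: "ennreal (t (fun_calc (\<lambda>w. integral {0..max w 0} (\<lambda>r. r\<^sup>2 * f r)) ?C))
        = (\<integral>\<^sup>+ r. (ennreal (f r) * indicator {0..} r) * (ennreal (r\<^sup>2) * ?\<rho> r (r * s)) \<partial>lborel)" .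
      have "(\<integral>\<^sup>+ r. F r s \<partial>lborel) = (\<integral>\<^sup>+ r. ennreal s * ((ennreal (f r) * indicator {0..} r) * (ennreal (r\<^sup>2) * ?\<rho> r (r * s))) \<partial>lborel)"
        unfolding F_def using True by (intro nn_integral_cong) (simp add: mult_ac)
      also have "\<dots> = ennreal s * (\<integral>\<^sup>+ r. (ennreal (f r) * indicator {0..} r) * (ennreal (r\<^sup>2) * ?\<rho> r (r * s)) \<partial>lborel)"
      proof (rule nn_integral_cmult)
        show "(\<lambda>r. (ennreal (f r) * indicator {0..} r) * (ennreal (r\<^sup>2) * ?\<rho> r (r * s))) \<in> borel_measurable lborel"
          using borel_measurable_times_ennreal[OF mf borel_measurable_times_ennreal[OF _ m], of "\<lambda>r. ennreal (r\<^sup>2)"] by simp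
      qed
      finally show ?thesis using True by (simp add: eq)
    qed (simp add: F_def)
  qed
  finally show ?thesis .
qed

end

end

text \<open>The condition \<open>h 0 = 0\<close> makes the extension of \<open>h\<close> by zero to
  the negative axis continuous. The integral is therefore continuously differentiable across 0, as
  the trace derivative demands.\<close>

lemma integral_pos_part_derivative:
  assumes h: "continuous_on {0..} h" and h0: "h 0 = 0" and a: "a \<le> 0" and r: "r \<in> {a..b}"
  shows "((\<lambda>w. integral {0..max w 0} h) has_real_derivative h (max r 0)) (at r within {a..b})"
proof -
  define k where "k w = h (max w 0)" for w :: real
  have k: "continuous_on S k" for S
    unfolding k_def by (intro continuous_on_compose2[OF h] continuous_intros) auto
  have ik: "k integrable_on {d..e}" for d e by (rule integrable_continuous_interval[OF k])
  have eq: "integral {a..w} k = integral {0..max w 0} h" if "a \<le> w" for w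
  proof (cases "w \<le> 0")
    case True
    then have "integral {a..w} k = integral {a..w} (\<lambda>_. 0)"
      by (intro Henstock_Kurzweil_Integration.integral_cong) (auto simp: k_def max_def h0)
    then show ?thesis using True by (simp add: max_def)
  next
    case False
    have "integral {a..0} k + integral {0..w} k = integral {a..w} k"
      using a False by (intro Henstock_Kurzweil_Integration.integral_combine ik) auto
    moreover have "integral {a..0} k = integral {a..0} (\<lambda>_. 0)"
      by (intro Henstock_Kurzweil_Integration.integral_cong) (auto simp: k_def max_def h0)
    moreover have "integral {0..w} k = integral {0..w} h"
      by (intro Henstock_Kurzweil_Integration.integral_cong) (auto simp: k_def)
    ultimately show ?thesis using False by simp
  qed
  have "((\<lambda>w. integral {a..w} k) has_real_derivative k r) (at r within {a..b})"
    by (rule integral_has_real_derivative[OF k r])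
  then show ?thesis unfolding k_def[of r]
    by (rule has_field_derivative_transform_within[OF _ zero_less_one r]) (simp add: eq)
qed

lemma continuous_on_integral_pos_part:
  fixes h :: "real \<Rightarrow> real"
  assumes h: "continuous_on {0..} h"
  shows "continuous_on UNIV (\<lambda>w. integral {0..max w 0} h)"
  unfolding continuous_on_eq_continuous_at[OF open_UNIV]
proof
  fix w :: real
  define R where "R = \<bar>w\<bar> + 1"
  have "h integrable_on {0..R}" by (intro integrable_continuous_interval continuous_on_subset[OF h]) auto
  then have "continuous_on {0..R} (\<lambda>w. integral {0..w} h)" by (rule indefinite_integral_continuous_1)
  then have "continuous_on {..<R} (\<lambda>w. integral {0..max w 0} h)"
    by (rule continuous_on_compose2) (auto intro!: continuous_intros simp: R_def)
  then show "isCont (\<lambda>w. integral {0..max w 0} h) w"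
    by (rule continuous_on_interior) (auto simp: R_def interior_open)
qed

text \<open>Supplies the majorant for dominated convergence in the variable
  \<open>s\<close>.\<close>

lemma set_integrable_inverse_square:
  assumes "0 < c"
  shows "set_integrable lborel {0..} (\<lambda>s::real. 1 / (c + s)\<^sup>2)"
proof -
  have m: "(\<lambda>s::real. 1 / (c + s)\<^sup>2) \<in> borel_measurable borel" by measurable
  have "(\<integral>\<^sup>+ s. ennreal (1 / (c + s)\<^sup>2) * indicator {0..} s \<partial>lborel) = ennreal (0 - (- (1 / (c + 0))))"
  proof (rule nn_integral_FTC_atLeast[OF m])
    fix s :: real assume "0 \<le> s"
    then show "((\<lambda>s. - (1 / (c + s))) has_real_derivative 1 / (c + s)\<^sup>2) (at s)"
      using assms by (auto intro!: derivative_eq_intros simp: power2_eq_square)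
  next
    have "((\<lambda>s. 1 / (c + s)) \<longlongrightarrow> 0) at_top"
      by (intro tendsto_divide_0[OF tendsto_const] filterlim_at_top_imp_at_infinity
          filterlim_tendsto_add_at_top[OF tendsto_const filterlim_ident])
    from tendsto_minus[OF this] show "((\<lambda>s. - (1 / (c + s))) \<longlongrightarrow> 0) at_top" by simp
  qed simp
  moreover have "(\<integral>\<^sup>+ s. ennreal (indicator {0..} s *\<^sub>R (1 / (c + s)\<^sup>2)) \<partial>lborel)
      = (\<integral>\<^sup>+ s. ennreal (1 / (c + s)\<^sup>2) * indicator {0..} s \<partial>lborel)"
    by (intro nn_integral_cong) (simp add: indicator_def)
  ultimately show ?thesis unfolding set_integrable_def
    by (intro integrableI_nonneg) auto
qed

section \<open>Directional derivatives of traces\<close>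

context tracial_functional
begin

context
  fixes Y X :: "'h op" and a b :: real and G g :: "real \<Rightarrow> real"
  assumes Y: "Y \<in> M" "op_between a b Y" and X: "X \<in> M" "op_between a b (Y + X)" and ab: "a \<le> b"
    and g: "continuous_on {a..b} g"
    and G: "\<And>r. r \<in> {a..b} \<Longrightarrow> (G has_real_derivative g r) (at r within {a..b})"
begin

private lemma segment_between: "u \<in> {0..1} \<Longrightarrow> op_between a b (Y + u *\<^sub>R X)"
  using op_between_segment[OF Y(2) X(2)] by auto

private lemma segment_in_M: "Y + u *\<^sub>R X \<in> M"
  by (intro M_closed Y X)

text \<open>The difference quotient is the average of the directional derivative over the segment
  from \<open>Y\<close> to \<open>Y + e *\<^sub>R X\<close>.\<close>

private lemma scaled_increment:
  assumes e: "0 < e" "e \<le> 1"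
  shows "((\<lambda>u. t (fun_calc g (Y + (u * e) *\<^sub>R X) o\<^sub>L X)) has_integral
      (t (fun_calc G (Y + e *\<^sub>R X)) - t (fun_calc G Y)) / e) {0..1}"
proof -
  have eX: "e *\<^sub>R X \<in> M" by (intro M_closed X)
  have b: "op_between a b (Y + e *\<^sub>R X)" using e by (intro segment_between) auto
  have "((\<lambda>u. (1 / e) * t (fun_calc g (Y + u *\<^sub>R (e *\<^sub>R X)) o\<^sub>L (e *\<^sub>R X))) has_integral
      (1 / e) * (t (fun_calc G (Y + e *\<^sub>R X)) - t (fun_calc G Y))) {0..1}"
    by (intro has_integral_mult_right trace_increment[OF Y eX b ab g G])
  moreover have "(1 / e) * t (fun_calc g (Y + u *\<^sub>R (e *\<^sub>R X)) o\<^sub>L (e *\<^sub>R X))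
      = t (fun_calc g (Y + (u * e) *\<^sub>R X) o\<^sub>L X)" if u: "u \<in> {0..1}" for u
  proof -
    have "u * e \<in> {0..1}" using u e by (auto simp: mult_le_one)
    then have "fun_calc g (Y + (u * e) *\<^sub>R X) o\<^sub>L X \<in> M"
      by (intro M_compose M_fun_calc[OF segment_in_M segment_between g] X)
    moreover have "fun_calc g (Y + u *\<^sub>R (e *\<^sub>R X)) o\<^sub>L (e *\<^sub>R X) = e *\<^sub>R (fun_calc g (Y + (u * e) *\<^sub>R X) o\<^sub>L X)"
      by (intro blinfun_eqI) (simp add: blinfun.bilinear_simps)
    ultimately show ?thesis using e by (simp add: t_scaleR)
  qed
  ultimately show ?thesis by (subst has_integral_cong[symmetric]) auto
qed

lemma t_fun_calc_compose_le:
  assumes "u \<in> {0..1}" and C: "\<And>r. r \<in> {a..b} \<Longrightarrow> \<bar>g r\<bar> \<le> C"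
  shows "\<bar>t (fun_calc g (Y + u *\<^sub>R X) o\<^sub>L X)\<bar> \<le> \<bar>K\<bar> * (C * norm X)"
proof -
  note W = segment_between[OF assms(1)]
  have C0: "0 \<le> C" using C[of a] ab by (auto intro: order_trans[OF abs_ge_zero])
  have "\<bar>t (fun_calc g (Y + u *\<^sub>R X) o\<^sub>L X)\<bar> \<le> K * norm (fun_calc g (Y + u *\<^sub>R X) o\<^sub>L X)"
    by (intro t_bound M_compose M_fun_calc[OF segment_in_M W g] X)
  also have "\<dots> \<le> \<bar>K\<bar> * (C * norm X)"
    using C C0 by (intro mult_mono order_trans[OF norm_blinfun_compose] mult_right_mono norm_fun_calc_le[OF W g]) auto
  finally show ?thesis .
qed

text \<open>An average inherits the bound of its integrand, here uniformly in \<open>e\<close>; this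
  is the domination needed for passing to the limit under the integral.\<close>

lemma difference_quotient_le:
  assumes e: "0 < e" "e \<le> 1" and C: "\<And>r. r \<in> {a..b} \<Longrightarrow> \<bar>g r\<bar> \<le> C"
  shows "\<bar>(t (fun_calc G (Y + e *\<^sub>R X)) - t (fun_calc G Y)) / e\<bar> \<le> \<bar>K\<bar> * (C * norm X)"
proof -
  have C0: "0 \<le> C" using C[of a] ab by (auto intro: order_trans[OF abs_ge_zero])
  have "norm ((t (fun_calc G (Y + e *\<^sub>R X)) - t (fun_calc G Y)) / e) \<le> \<bar>K\<bar> * (C * norm X) * measure lborel {0..1::real}"
  proof (rule has_integral_bound_real[OF _ finite.emptyI scaled_increment[OF e]])
    fix u :: real assume "u \<in> {0..1} - {}"
    then have "u * e \<in> {0..1}" using e by (auto simp: mult_le_one)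
    from t_fun_calc_compose_le[OF this C]
    show "norm (t (fun_calc g (Y + (u * e) *\<^sub>R X) o\<^sub>L X)) \<le> \<bar>K\<bar> * (C * norm X)" by simp
  qed (use C0 in auto)
  then show ?thesis by simp
qed

text \<open>The averages shrink to the value at the endpoint \<open>Y\<close>, because the integrand
  is continuous in the segment parameter.\<close>

lemma difference_quotient_tendsto:
  "(\<lambda>n. (t (fun_calc G (Y + (1 / real (Suc n)) *\<^sub>R X)) - t (fun_calc G Y)) / (1 / real (Suc n)))
     \<longlonglongrightarrow> t (fun_calc g Y o\<^sub>L X)"
proof (rule LIMSEQ_I)
  let ?\<psi> = "\<lambda>u. t (fun_calc g (Y + u *\<^sub>R X) o\<^sub>L X)"
  have "continuous_on {0..1} ?\<psi>"
    by (intro continuous_on_t blinfun_compose.continuous_on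
        continuous_on_fun_calc[OF _ segment_between g] continuous_intros
        M_compose M_fun_calc[OF segment_in_M segment_between g] X)
  then have cont: "\<And>e. e > 0 \<Longrightarrow> \<exists>d>0. \<forall>u\<in>{0..1}. dist u 0 < d \<longrightarrow> dist (?\<psi> u) (?\<psi> 0) < e"
    unfolding continuous_on_iff by (metis atLeastAtMost_iff order_refl zero_le_one)
  fix r :: real assume r: "0 < r"
  then have "r / 2 > 0" by simp
  from cont[OF this] obtain d where d: "d > 0" "\<And>u. u \<in> {0..1} \<Longrightarrow> u < d \<Longrightarrow> \<bar>?\<psi> u - ?\<psi> 0\<bar> < r / 2"
    by (auto simp: dist_real_def)
  obtain N where N: "1 / real (Suc N) < d" using d(1) by (metis nat_approx_posE)
  show "\<exists>N. \<forall>n\<ge>N. norm ((t (fun_calc G (Y + (1 / real (Suc n)) *\<^sub>R X)) - t (fun_calc G Y)) / (1 / real (Suc n))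
      - t (fun_calc g Y o\<^sub>L X)) < r"
  proof (intro exI allI impI)
    fix n assume n: "N \<le> n"
    define e where "e = 1 / real (Suc n)"
    have e: "0 < e" "e \<le> 1" "e < d"
      using n N by (auto simp: e_def intro!: le_less_trans[OF _ N] divide_left_mono)
    have "((\<lambda>u. ?\<psi> (u * e) - ?\<psi> 0) has_integral (t (fun_calc G (Y + e *\<^sub>R X)) - t (fun_calc G Y)) / e - ?\<psi> 0) {0..1}"
      using has_integral_diff[OF scaled_increment[OF e(1,2)] has_integral_const_real[of "?\<psi> 0" 0 1]] by simp
    then have "norm ((t (fun_calc G (Y + e *\<^sub>R X)) - t (fun_calc G Y)) / e - ?\<psi> 0) \<le> r / 2 * measure lborel {0..1::real}"
    proof (rule has_integral_bound_real[OF _ finite.emptyI, rotated])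
      fix u :: real assume "u \<in> {0..1} - {}"
      then have u: "u \<in> {0..1}" by simp
      have ue: "u * e \<in> {0..1}" using u e by (auto simp: mult_le_one)
      have "u * e \<le> 1 * e" using u e by (intro mult_right_mono) auto
      then have "u * e < d" using e(3) by linarith
      from d(2)[OF ue this] have "\<bar>?\<psi> (u * e) - ?\<psi> 0\<bar> < r / 2" .
      then show "norm (?\<psi> (u * e) - ?\<psi> 0) \<le> r / 2" by simp
    qed (use r in simp)
    then show "norm ((t (fun_calc G (Y + (1 / real (Suc n)) *\<^sub>R X)) - t (fun_calc G Y)) / (1 / real (Suc n))
      - t (fun_calc g Y o\<^sub>L X)) < r"
      using r by (simp add: e_def)
  qed
qed

end


section \<open>Differentiating the integrated formula\<close>

context
  fixes A :: "'h op" and c a :: real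
  assumes A: "A \<in> M" "op_between c a A" and c: "0 < c" "c \<le> a"
begin

text \<open>The integrated formula holds for every \<open>B + e *\<^sub>R X\<close> with
  \<open>e \<in> {0..1}\<close>. Its difference quotients along \<open>e = 1 / Suc n\<close> have
  equal integrals for each \<open>n\<close>, and dominated convergence applies on both sides
  separately.\<close>

lemma trace_formula_nonneg:
  assumes B: "B \<in> M" "positive_op B" and X: "X \<in> M" "positive_op X"
    and f: "continuous_on {0..} f" and fpos: "\<And>r. 0 \<le> r \<Longrightarrow> 0 \<le> f r"
  defines "l \<equiv> \<lambda>r. f r * t (pos_part (B - r *\<^sub>R A) o\<^sub>L X)"
    and "k \<equiv> \<lambda>s. s * t (fun_calc (\<lambda>r. r\<^sup>2 * f r) (inv_sqrt A s o\<^sub>L B o\<^sub>L inv_sqrt A s)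
                      o\<^sub>L (inv_sqrt A s o\<^sub>L X o\<^sub>L inv_sqrt A s))"
  shows "set_integrable lborel {0..} l" "set_integrable lborel {0..} k"
    "(LINT r:{0..}|lborel. l r) = (LINT s:{0..}|lborel. k s)"
proof -
  let ?S = "inv_sqrt A"
  \<comment> \<open>A norm bound for \<open>B + e *\<^sub>R X\<close>, uniform in
    \<open>e \<in> {0..1}\<close>.\<close>
  define b where "b = norm B + norm X"
  \<comment> \<open>For \<open>r > T\<close> the operator
    \<open>B + e *\<^sub>R X - r *\<^sub>R A\<close> is at most \<open>b - r * c < 0\<close>, so its
    positive part vanishes.\<close>
  define T where "T = b / c"
  have b0: "0 \<le> b" by (simp add: b_def)
  have T0: "0 \<le> T" using b0 c by (simp add: T_def)
  define h where "h r = r\<^sup>2 * f r" for r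
  \<comment> \<open>Half the square of the positive part; its derivative is the positive part that
    appears in \<open>l\<close>.\<close>
  define q where "q w = integral {0..max w 0} (\<lambda>r. r)" for w :: real
  define H where "H w = integral {0..max w 0} h" for w
  have hc: "continuous_on {0..} h" unfolding h_def by (intro continuous_intros f)
  have ic: "continuous_on {0..} (\<lambda>r::real. r)" by (intro continuous_intros)
  have qc: "continuous_on UNIV q" unfolding q_def by (rule continuous_on_integral_pos_part[OF ic])
  have Hc: "continuous_on UNIV H" unfolding H_def by (rule continuous_on_integral_pos_part[OF hc])
  have q0: "0 \<le> q w" for w unfolding q_def
    by (rule integral_nonneg) (auto intro!: integrable_continuous_interval continuous_intros)
  have H0: "0 \<le> H w" for w unfolding H_def
    using fpos by (intro integral_nonneg integrable_continuous_interval continuous_on_subset[OF hc]) (auto simp: h_def)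
  have "bounded (f ` {0..T})"
    by (intro compact_imp_bounded compact_continuous_image continuous_on_subset[OF f] compact_Icc) auto
  then obtain m where "\<forall>y\<in>f ` {0..T}. norm y \<le> m" unfolding bounded_iff by blast
  then have m: "\<And>r. r \<in> {0..T} \<Longrightarrow> \<bar>f r\<bar> \<le> m" by auto
  have m0: "0 \<le> m" using m[of 0] T0 by auto
  have saA: "selfadjoint A" using A(2) by (simp add: op_between_def)
  have BX: "B + X \<in> M" "positive_op (B + X)" by (intro M_closed B X positive_op_add)+
  have nBX: "norm B \<le> b" "norm (B + X) \<le> b" by (auto simp: b_def norm_triangle_ineq)
  have minus_A: "op_between (- (r * a)) (- (r * c)) (- (r *\<^sub>R A))" if "0 \<le> r" for r
    using op_betweenD[OF A(2)] that selfadjoint_scaleR[OF saA, of "- r"]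
    by (auto simp: op_between_def blinfun.bilinear_simps mult.assoc intro!: mult_left_mono)
  have Yb: "op_between (- (r * a)) (b - r * c) (D - r *\<^sub>R A)" if "0 \<le> r" "positive_op D" "norm D \<le> b" for r D
    using op_between_add[OF positive_op_between[OF that(2,3)] minus_A[OF that(1)]] by simp
  define Y where "Y e r = (B + e *\<^sub>R X) - r *\<^sub>R A" for e r
  have Y_eq: "Y e r = (B - r *\<^sub>R A) + e *\<^sub>R X" for e r by (simp add: Y_def)
  have YM: "Y e r \<in> M" for e r unfolding Y_def by (intro M_closed A B X)
  have Ysa: "selfadjoint (Y e r)" for e r unfolding Y_def
    by (intro selfadjoint_diff selfadjoint_add selfadjoint_scaleR saA positive_op_selfadjoint B X)
  have Ye: "op_between (- (r * a)) (b - r * c) (Y e r)" if "0 \<le> r" "e \<in> {0..1}" for r e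
    unfolding Y_eq
  proof (rule op_between_segment[OF Yb[OF that(1) B(2) nBX(1)]])
    show "op_between (- (r * a)) (b - r * c) ((B - r *\<^sub>R A) + X)"
      using Yb[OF that(1) BX(2) nBX(2)] by (simp add: algebra_simps)
  qed (use that in auto)
  define C where "C e s = ?S s o\<^sub>L (B + e *\<^sub>R X) o\<^sub>L ?S s" for e s
  define X' where "X' s = ?S s o\<^sub>L X o\<^sub>L ?S s" for s
  \<comment> \<open>Moving \<open>B\<close> along \<open>X\<close> moves \<open>C\<close> along
    \<open>X' s\<close>; this is the origin of the last factor in \<open>k\<close>.\<close>
  have C_eq: "C e s = C 0 s + e *\<^sub>R X' s" for e s
    unfolding C_def X'_def by (intro blinfun_eqI) (simp add: blinfun.bilinear_simps)
  have Be: "B + e *\<^sub>R X \<in> M" for e by (intro M_closed B X)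
  have SM: "?S s \<in> M" and Ssa: "selfadjoint (?S s)" if "0 \<le> s" for s
    using inv_sqrt_in_M[OF A c that] selfadjoint_inv_sqrt[OF A c that] .
  have CM: "C e s \<in> M" "X' s \<in> M" if "0 \<le> s" for e s
    unfolding C_def X'_def by (intro M_compose SM[OF that] Be X)+
  have Cpos: "positive_op (?S s o\<^sub>L D o\<^sub>L ?S s)" if "0 \<le> s" "positive_op D" for s D
    by (intro positive_op_conj that Ssa)
  have Cb: "op_between 0 (b / (c + s)) (?S s o\<^sub>L D o\<^sub>L ?S s)" if "0 \<le> s" "positive_op D" "norm D \<le> b" for s D
  proof (rule positive_op_between[OF Cpos[OF that(1,2)]])
    have "norm (?S s o\<^sub>L D o\<^sub>L ?S s) \<le> norm D / (c + s)" by (rule norm_conj_inv_sqrt_le[OF A c that(1)])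
    also have "\<dots> \<le> b / (c + s)" using that c by (intro divide_right_mono) auto
    finally show "norm (?S s o\<^sub>L D o\<^sub>L ?S s) \<le> b / (c + s)" .
  qed
  have C0b: "op_between 0 (b / (c + s)) (C 0 s)" and C1b: "op_between 0 (b / (c + s)) (C 0 s + X' s)" if "0 \<le> s" for s
  proof -
    show "op_between 0 (b / (c + s)) (C 0 s)" using Cb[OF that B(2) nBX(1)] by (simp add: C_def)
    have "C 0 s + X' s = ?S s o\<^sub>L (B + X) o\<^sub>L ?S s"
      unfolding C_def X'_def by (intro blinfun_eqI) (simp add: blinfun.bilinear_simps)
    then show "op_between 0 (b / (c + s)) (C 0 s + X' s)" using Cb[OF that BX(2) nBX(2)] by simp
  qed
  have Ceb: "op_between 0 (b / (c + s)) (C e s)" if "0 \<le> s" "e \<in> {0..1}" for s e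
    unfolding C_eq[of e] using op_between_segment[OF C0b[OF that(1)] C1b[OF that(1)], of e] that by auto
  define \<phi> where "\<phi> e r = indicator {0..} r *\<^sub>R (f r * t (fun_calc q (Y e r)))" for e r :: real
  define \<psi> where "\<psi> e s = indicator {0..} s *\<^sub>R (s * t (fun_calc H (C e s)))" for e s :: real
  have qYM: "fun_calc q (Y e r) \<in> M" for e r
    by (rule M_fun_calc[OF YM op_between_norm[OF Ysa order_refl] continuous_on_subset[OF qc]]) simp
  have HCM: "fun_calc H (C e s) \<in> M" if "0 \<le> s" "e \<in> {0..1}" for e s
    by (rule M_fun_calc[OF CM(1) Ceb continuous_on_subset[OF Hc]]) (use that in auto)
  have \<phi>c: "continuous_on {0..} (\<lambda>r. f r * t (fun_calc q (Y e r)))" for e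
    by (intro continuous_on_mult f continuous_on_t continuous_on_fun_calc_UNIV qc Ysa qYM)
      (simp add: Y_def[abs_def] continuous_intros)
  have Scont: "continuous_on {0..} ?S" by (rule continuous_on_inv_sqrt[OF A c])
  have \<psi>c: "continuous_on {0..} (\<lambda>s. s * t (fun_calc H (C e s)))" if "e \<in> {0..1}" for e
  proof (intro continuous_on_mult continuous_on_id continuous_on_t continuous_on_fun_calc_UNIV Hc)
    show "continuous_on {0..} (C e)" unfolding C_def[abs_def]
      by (intro blinfun_compose.continuous_on Scont continuous_on_const)
    show "selfadjoint (C e s)" if "s \<in> {0..}" for s
      using op_betweenD(1)[OF Ceb[of s e]] that \<open>e \<in> {0..1}\<close> by simp
    show "fun_calc H (C e s) \<in> M" if "s \<in> {0..}" for s
      using HCM[of s e] that \<open>e \<in> {0..1}\<close> by simp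
  qed
  have \<phi>m: "\<phi> e \<in> borel_measurable borel" for e
    unfolding \<phi>_def[abs_def] by (rule borel_measurable_continuous_on_indicator[OF _ \<phi>c]) simp
  have \<psi>m: "\<psi> e \<in> borel_measurable borel" if "e \<in> {0..1}" for e
    unfolding \<psi>_def[abs_def] by (rule borel_measurable_continuous_on_indicator[OF _ \<psi>c[OF that]]) simp
  have tq0: "0 \<le> t (fun_calc q (Y e r))" for e r
    by (intro t_nonneg qYM positive_fun_calc[OF op_between_norm[OF Ysa order_refl] continuous_on_subset[OF qc]] q0) simp
  have tH0: "0 \<le> t (fun_calc H (C e s))" if "0 \<le> s" "e \<in> {0..1}" for e s
    by (intro t_nonneg HCM that positive_fun_calc[OF Ceb continuous_on_subset[OF Hc]] H0) simp
  have \<phi>0: "0 \<le> \<phi> e r" for e r using fpos tq0 by (cases "0 \<le> r") (simp_all add: \<phi>_def)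
  have \<psi>0: "0 \<le> \<psi> e s" if "e \<in> {0..1}" for e s using tH0[of s e] that by (cases "0 \<le> s") (simp_all add: \<psi>_def)
  have \<phi>_zero: "\<phi> e r = 0" if "T < r" "e \<in> {0..1}" for e r
  proof -
    have "0 \<le> r" using that(1) T0 by simp
    moreover have "b - r * c < 0" using that(1) c by (simp add: T_def pos_divide_less_eq)
    ultimately have r: "0 \<le> r" "b - r * c < 0" .
    have "fun_calc q (Y e r) = fun_calc (\<lambda>_. 0) (Y e r)"
      by (rule fun_calc_cong[OF Ye[OF r(1) that(2)]]) (use r in \<open>auto simp: q_def max_def\<close>)
    then show ?thesis by (simp add: \<phi>_def fun_calc_const[OF Ye[OF r(1) that(2)]] t_0)
  qed
  have \<phi>i: "integrable lborel (\<phi> e)" if "e \<in> {0..1}" for e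
  proof -
    have "set_integrable lborel {0..T} (\<lambda>r. f r * t (fun_calc q (Y e r)))"
      by (rule borel_integrable_atLeastAtMost'[OF continuous_on_subset[OF \<phi>c]]) auto
    moreover have "\<phi> e = (\<lambda>r. indicator {0..T} r *\<^sub>R (f r * t (fun_calc q (Y e r))))"
    proof
      fix r show "\<phi> e r = indicator {0..T} r *\<^sub>R (f r * t (fun_calc q (Y e r)))"
        using \<phi>_zero[of r e] that by (cases "T < r") (auto simp: \<phi>_def indicator_def)
    qed
    ultimately show ?thesis by (simp add: set_integrable_def)
  qed
  have nn: "(\<integral>\<^sup>+ r. ennreal (\<phi> e r) \<partial>lborel) = (\<integral>\<^sup>+ s. ennreal (\<psi> e s) \<partial>lborel)" if "e \<in> {0..1}" for e
  proof -
    have "positive_op (B + e *\<^sub>R X)" using that by (intro positive_op_add positive_op_scaleR B X) auto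
    then have "selfadjoint (B + e *\<^sub>R X)" by (rule positive_op_selfadjoint)
    from integrated_trace_formula[OF A c Be this f fpos]
    have "(\<integral>\<^sup>+ r. ennreal (f r) * ennreal (t (fun_calc q (Y e r))) * indicator {0..} r \<partial>lborel)
      = (\<integral>\<^sup>+ s. ennreal s * ennreal (t (fun_calc H (C e s))) * indicator {0..} s \<partial>lborel)"
      unfolding q_def[abs_def] H_def[abs_def] h_def[abs_def] Y_def C_def by simp
    moreover have "ennreal (f r) * ennreal (t (fun_calc q (Y e r))) * indicator {0..} r = ennreal (\<phi> e r)" for r
      using fpos[of r] tq0 by (cases "0 \<le> r") (auto simp: \<phi>_def ennreal_mult)
    moreover have "ennreal s * ennreal (t (fun_calc H (C e s))) * indicator {0..} s = ennreal (\<psi> e s)" for s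
      using tH0[of s e] that by (cases "0 \<le> s") (auto simp: \<psi>_def ennreal_mult)
    ultimately show ?thesis by simp
  qed
  \<comment> \<open>Integrability on the right is inherited: the integrals of the two nonnegative
    functions agree, and the left function is integrable because of its bounded support.\<close>
  have \<psi>i: "integrable lborel (\<psi> e)" if "e \<in> {0..1}" for e
  proof (rule integrableI_nonneg)
    have "(\<integral>\<^sup>+ r. ennreal (\<phi> e r) \<partial>lborel) = ennreal (LINT r|lborel. \<phi> e r)"
      by (rule nn_integral_eq_integral[OF \<phi>i[OF that]]) (use \<phi>0 in simp)
    then show "(\<integral>\<^sup>+ s. ennreal (\<psi> e s) \<partial>lborel) < \<infinity>" by (simp add: nn[OF that, symmetric])
  qed (use \<psi>m[OF that] \<psi>0[OF that] in auto)
  have eq: "(LINT r|lborel. \<phi> e r) = (LINT s|lborel. \<psi> e s)" if "e \<in> {0..1}" for e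
    using \<phi>m \<phi>0 \<psi>m[OF that] \<psi>0[OF that] nn[OF that] by (simp add: integral_eq_nn_integral)
  define d where "d n = 1 / real (Suc n)" for n
  have d: "0 < d n" "d n \<le> 1" "d n \<in> {0..1}" for n by (auto simp: d_def)
  have z: "(0::real) \<in> {0..1}" by simp
  define \<Phi> where "\<Phi> n r = (\<phi> (d n) r - \<phi> 0 r) / d n" for n r
  define \<Psi> where "\<Psi> n s = (\<psi> (d n) s - \<psi> 0 s) / d n" for n s
  have eq': "(LINT r|lborel. \<Phi> n r) = (LINT s|lborel. \<Psi> n s)" for n
    unfolding \<Phi>_def \<Psi>_def using \<phi>i[OF d(3)] \<phi>i[OF z] \<psi>i[OF d(3)] \<psi>i[OF z] eq[OF d(3)] eq[OF z] by simp
  have \<Phi>m: "\<Phi> n \<in> borel_measurable lborel" and \<Psi>m: "\<Psi> n \<in> borel_measurable lborel" for n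
    unfolding \<Phi>_def[abs_def] \<Psi>_def[abs_def] using \<phi>m \<psi>m[OF d(3)] \<psi>m[OF z] by simp_all
  have dq: "((\<lambda>w. q w) has_real_derivative max r 0) (at r within {u..v})" if "u \<le> 0" "r \<in> {u..v}" for r u v
    unfolding q_def by (rule integral_pos_part_derivative[OF ic _ that]) simp
  have dH: "((\<lambda>w. H w) has_real_derivative h (max r 0)) (at r within {u..v})" if "u \<le> 0" "r \<in> {u..v}" for r u v
    unfolding H_def by (rule integral_pos_part_derivative[OF hc _ that]) (simp add: h_def)
  \<comment> \<open>Relaxing the upper bound from \<open>b - r * c\<close> to \<open>b\<close>
    bounds the positive part independently of \<open>r\<close>.\<close>
  have Y1: "op_between (- (r * a)) b (Y 0 r)" "op_between (- (r * a)) b (Y 0 r + X)" "- (r * a) \<le> b" "- (r * a) \<le> 0" if "0 \<le> r" for r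
  proof -
    have "0 \<le> r * c" "0 \<le> r * a" using that c by auto
    then show "op_between (- (r * a)) b (Y 0 r)" "op_between (- (r * a)) b (Y 0 r + X)" "- (r * a) \<le> b" "- (r * a) \<le> 0"
      using op_between_mono[OF Ye[OF that, of 0]] op_between_mono[OF Ye[OF that, of 1]] b0 Y_eq[of 1 r] Y_eq[of 0 r]
      by (simp_all add: add.commute)
  qed
  have cmax: "continuous_on S (\<lambda>r. max r 0 :: real)" for S by (intro continuous_intros)
  have Ystep: "Y (d n) r = Y 0 r + d n *\<^sub>R X" for n r by (simp add: Y_def)
  have \<Phi>eq: "\<Phi> n r = f r * ((t (fun_calc q (Y 0 r + d n *\<^sub>R X)) - t (fun_calc q (Y 0 r))) / d n)" if "0 \<le> r" for n r
    using that by (simp add: \<Phi>_def \<phi>_def right_diff_distrib Ystep)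
  have \<Phi>lim: "(\<lambda>n. \<Phi> n r) \<longlonglongrightarrow> indicator {0..} r *\<^sub>R l r" for r
  proof (cases "0 \<le> r")
    case True
    have "(\<lambda>n. f r * ((t (fun_calc q (Y 0 r + d n *\<^sub>R X)) - t (fun_calc q (Y 0 r))) / d n))
        \<longlonglongrightarrow> f r * t (fun_calc (\<lambda>r. max r 0) (Y 0 r) o\<^sub>L X)"
      unfolding d_def
      by (intro tendsto_mult_left difference_quotient_tendsto[OF YM Y1(1)[OF True] X(1) Y1(2)[OF True] Y1(3)[OF True] cmax dq] Y1(4)[OF True])
    then show ?thesis using True by (simp add: \<Phi>eq l_def pos_part_def) (simp add: Y_def)
  qed (simp add: \<Phi>_def \<phi>_def)
  have \<Phi>bound: "norm (\<Phi> n r) \<le> indicator {0..T} r *\<^sub>R (m * (\<bar>K\<bar> * (b * norm X)))" for n r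
  proof (cases "r \<in> {0..T}")
    case True
    then have r: "0 \<le> r" by simp
    have "\<bar>(t (fun_calc q (Y 0 r + d n *\<^sub>R X)) - t (fun_calc q (Y 0 r))) / d n\<bar> \<le> \<bar>K\<bar> * (b * norm X)"
      by (rule difference_quotient_le[OF YM Y1(1)[OF r] X(1) Y1(2)[OF r] Y1(3)[OF r] cmax dq d(1,2)])
        (use Y1(4)[OF r] b0 in auto)
    with m[OF True] m0 have "\<bar>f r\<bar> * \<bar>(t (fun_calc q (Y 0 r + d n *\<^sub>R X)) - t (fun_calc q (Y 0 r))) / d n\<bar> \<le> m * (\<bar>K\<bar> * (b * norm X))"
      by (intro mult_mono) auto
    then show ?thesis using True by (simp add: \<Phi>eq[OF r] abs_mult)
  next
    case False
    show ?thesis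
    proof (cases "r < 0")
      case True then show ?thesis by (simp add: \<Phi>_def \<phi>_def)
    next
      case False2: False
      then have "T < r" using False by auto
      then show ?thesis using False \<phi>_zero[OF _ d(3)] \<phi>_zero[OF _ z] by (simp add: \<Phi>_def)
    qed
  qed
  have C1: "0 \<le> b / (c + s)" "b / (c + s) \<le> T" if "0 \<le> s" for s
    using that b0 c by (auto simp: T_def intro!: divide_left_mono)
  have hC: "continuous_on {0..b / (c + s)} (\<lambda>r. h (max r 0))" for s
    by (intro continuous_on_compose2[OF hc cmax]) auto
  have \<Psi>eq: "\<Psi> n s = s * ((t (fun_calc H (C 0 s + d n *\<^sub>R X' s)) - t (fun_calc H (C 0 s))) / d n)" if "0 \<le> s" for n s
    using that by (simp add: \<Psi>_def \<psi>_def right_diff_distrib C_eq[of "d n"])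
  have \<Psi>lim: "(\<lambda>n. \<Psi> n s) \<longlonglongrightarrow> indicator {0..} s *\<^sub>R k s" for s
  proof (cases "0 \<le> s")
    case True
    have "(\<lambda>n. s * ((t (fun_calc H (C 0 s + d n *\<^sub>R X' s)) - t (fun_calc H (C 0 s))) / d n))
        \<longlonglongrightarrow> s * t (fun_calc (\<lambda>r. h (max r 0)) (C 0 s) o\<^sub>L X' s)"
      unfolding d_def
      by (intro tendsto_mult_left difference_quotient_tendsto[OF CM(1)[OF True] C0b[OF True] CM(2)[OF True] C1b[OF True] C1(1)[OF True] hC dH]) auto
    moreover have "fun_calc (\<lambda>r. h (max r 0)) (C 0 s) = fun_calc (\<lambda>r. r\<^sup>2 * f r) (C 0 s)"
      by (rule fun_calc_cong[OF C0b[OF True]]) (auto simp: h_def)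
    ultimately show ?thesis using True
      by (simp add: \<Psi>eq k_def X'_def) (simp add: C_def)
  qed (simp add: \<Psi>_def \<psi>_def)
  \<comment> \<open>The constant left after bounding the factor \<open>s\<close> by
    \<open>c + s\<close>: the square of \<open>b / (c + s)\<close> comes from \<open>h\<close>, one
    more \<open>1 / (c + s)\<close> from \<open>X' s\<close>, and one power cancels.\<close>
  define w where "w = m * b\<^sup>2 * \<bar>K\<bar> * norm X"
  have w0: "0 \<le> w" using m0 by (simp add: w_def)
  have \<Psi>bound: "norm (\<Psi> n s) \<le> indicator {0..} s *\<^sub>R (w * (1 / (c + s)\<^sup>2))" for n s
  proof (cases "0 \<le> s")
    case True
    let ?D = "(t (fun_calc H (C 0 s + d n *\<^sub>R X' s)) - t (fun_calc H (C 0 s))) / d n"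
    have cs: "0 < c + s" using c True by simp
    have "\<bar>?D\<bar> \<le> \<bar>K\<bar> * ((b / (c + s))\<^sup>2 * m * norm (X' s))"
    proof (rule difference_quotient_le[OF CM(1)[OF True] C0b[OF True] CM(2)[OF True] C1b[OF True] C1(1)[OF True] hC dH d(1,2)])
      fix r assume r: "r \<in> {0..b / (c + s)}"
      then have "\<bar>f r\<bar> \<le> m" using C1[OF True] by (intro m) auto
      then show "\<bar>h (max r 0)\<bar> \<le> (b / (c + s))\<^sup>2 * m"
        unfolding h_def abs_mult using r by (intro mult_mono) (auto intro!: power_mono)
    qed auto
    also have "\<dots> \<le> \<bar>K\<bar> * ((b / (c + s))\<^sup>2 * m * (norm X / (c + s)))"
      using m0 norm_conj_inv_sqrt_le[OF A c True, of X] unfolding X'_def by (intro mult_left_mono) auto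
    finally have "s * \<bar>?D\<bar> \<le> (c + s) * (\<bar>K\<bar> * ((b / (c + s))\<^sup>2 * m * (norm X / (c + s))))"
      using True c by (intro mult_mono) auto
    also have "\<dots> = w * (1 / (c + s)\<^sup>2)" using cs by (simp add: w_def power_divide)
    finally show ?thesis using True by (simp add: \<Psi>eq abs_mult)
  qed (simp add: \<Psi>_def \<psi>_def)
  have wi: "integrable lborel (\<lambda>r. indicator {0..T} r *\<^sub>R (m * (\<bar>K\<bar> * (b * norm X))))"
    unfolding set_integrable_def[symmetric] by (rule borel_integrable_atLeastAtMost'[OF continuous_on_const])
  have wi': "integrable lborel (\<lambda>s. indicator {0..} s *\<^sub>R (w * (1 / (c + s)\<^sup>2)))"
    using set_integrable_mult_right[of w, OF set_integrable_inverse_square[OF c(1)]] unfolding set_integrable_def by simp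
  have lm: "(\<lambda>r. indicator {0..} r *\<^sub>R l r) \<in> borel_measurable lborel"
    by (rule borel_measurable_LIMSEQ_real[OF \<Phi>lim \<Phi>m])
  have km: "(\<lambda>s. indicator {0..} s *\<^sub>R k s) \<in> borel_measurable lborel"
    by (rule borel_measurable_LIMSEQ_real[OF \<Psi>lim \<Psi>m])
  show "set_integrable lborel {0..} l" unfolding set_integrable_def
    by (rule integrable_dominated_convergence[where s = \<Phi>, OF lm \<Phi>m wi]) (use \<Phi>lim \<Phi>bound in auto)
  show "set_integrable lborel {0..} k" unfolding set_integrable_def
    by (rule integrable_dominated_convergence[where s = \<Psi>, OF km \<Psi>m wi']) (use \<Psi>lim \<Psi>bound in auto)
  have "(\<lambda>n. LINT r|lborel. \<Phi> n r) \<longlonglongrightarrow> (LINT r|lborel. indicator {0..} r *\<^sub>R l r)"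
    by (rule integral_dominated_convergence[where s = \<Phi>, OF lm \<Phi>m wi]) (use \<Phi>lim \<Phi>bound in auto)
  moreover have "(\<lambda>n. LINT s|lborel. \<Psi> n s) \<longlonglongrightarrow> (LINT s|lborel. indicator {0..} s *\<^sub>R k s)"
    by (rule integral_dominated_convergence[where s = \<Psi>, OF km \<Psi>m wi']) (use \<Psi>lim \<Psi>bound in auto)
  ultimately show "(LINT r:{0..}|lborel. l r) = (LINT s:{0..}|lborel. k s)"
    unfolding set_lebesgue_integral_def eq' by (rule LIMSEQ_unique)
qed

text \<open>Both sides are linear in \<open>f\<close>, so the formula follows from those for the
  positive and the negative part of \<open>f\<close>, which are again continuous.\<close>

lemma trace_formula:
  assumes B: "B \<in> M" "positive_op B" and X: "X \<in> M" "positive_op X"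
    and f: "continuous_on {0..} f"
  defines "l \<equiv> \<lambda>f r. f r * t (pos_part (B - r *\<^sub>R A) o\<^sub>L X)"
    and "k \<equiv> \<lambda>f s. s * t (fun_calc (\<lambda>r. r\<^sup>2 * f r) (inv_sqrt A s o\<^sub>L B o\<^sub>L inv_sqrt A s)
                      o\<^sub>L (inv_sqrt A s o\<^sub>L X o\<^sub>L inv_sqrt A s))"
  shows "set_integrable lborel {0..} (l f)" "set_integrable lborel {0..} (k f)"
    "(LINT r:{0..}|lborel. l f r) = (LINT s:{0..}|lborel. k f s)"
proof -
  define p n where "p r = max (f r) 0" and "n r = max (- f r) 0" for r
  have p: "continuous_on {0..} p" "\<And>r. 0 \<le> r \<Longrightarrow> 0 \<le> p r"
    and n: "continuous_on {0..} n" "\<And>r. 0 \<le> r \<Longrightarrow> 0 \<le> n r"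
    unfolding p_def n_def by (auto intro!: continuous_intros f)
  have fpn: "f r = p r - n r" for r by (auto simp: p_def n_def)
  have l: "l f r = l p r - l n r" for r by (simp add: l_def fpn left_diff_distrib)
  have k: "k f s = k p s - k n s" if "s \<in> {0..}" for s
  proof -
    have s: "0 \<le> s" using that by simp
    let ?C = "inv_sqrt A s o\<^sub>L B o\<^sub>L inv_sqrt A s" and ?X = "inv_sqrt A s o\<^sub>L X o\<^sub>L inv_sqrt A s"
    note S = inv_sqrt_in_M[OF A c s] selfadjoint_inv_sqrt[OF A c s]
    have b: "op_between 0 (norm ?C) ?C" by (intro positive_op_between positive_op_conj B S order_refl)
    have M: "?C \<in> M" "?X \<in> M" by (intro M_compose S B X)+
    have pc: "continuous_on {0..norm ?C} (\<lambda>r. r\<^sup>2 * p r)" and nc: "continuous_on {0..norm ?C} (\<lambda>r. r\<^sup>2 * n r)"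
      by (intro continuous_intros continuous_on_subset[OF p(1)] continuous_on_subset[OF n(1)]; auto)+
    have "(\<lambda>r. r\<^sup>2 * f r) = (\<lambda>r. r\<^sup>2 * p r - r\<^sup>2 * n r)" by (simp add: fpn right_diff_distrib)
    then have "fun_calc (\<lambda>r. r\<^sup>2 * f r) ?C o\<^sub>L ?X
        = (fun_calc (\<lambda>r. r\<^sup>2 * p r) ?C o\<^sub>L ?X) - (fun_calc (\<lambda>r. r\<^sup>2 * n r) ?C o\<^sub>L ?X)"
      by (simp add: fun_calc_diff[OF b pc nc] blinfun_compose.diff_left)
    then show ?thesis
      by (simp add: k_def t_diff M_compose M M_fun_calc[OF M(1) b pc] M_fun_calc[OF M(1) b nc] right_diff_distrib)
  qed
  have P: "set_integrable lborel {0..} (l p)" "set_integrable lborel {0..} (k p)"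
      "(LINT r:{0..}|lborel. l p r) = (LINT s:{0..}|lborel. k p s)"
    and N: "set_integrable lborel {0..} (l n)" "set_integrable lborel {0..} (k n)"
      "(LINT r:{0..}|lborel. l n r) = (LINT s:{0..}|lborel. k n s)"
    using trace_formula_nonneg[OF B X p] trace_formula_nonneg[OF B X n] unfolding l_def k_def by simp_all
  have kcong: "set_integrable lborel {0..} (k f) \<longleftrightarrow> set_integrable lborel {0..} (\<lambda>s. k p s - k n s)"
    by (rule set_integrable_cong) (use k in auto)
  show "set_integrable lborel {0..} (l f)" "set_integrable lborel {0..} (k f)"
    unfolding kcong using set_integral_diff(1)[OF P(1) N(1)] set_integral_diff(1)[OF P(2) N(2)]
    by (simp_all add: l[abs_def])
  have "(LINT r:{0..}|lborel. l f r) = (LINT r:{0..}|lborel. l p r - l n r)" by (simp add: l)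
  also have "\<dots> = (LINT s:{0..}|lborel. k p s - k n s)"
    using P N by (simp add: set_integral_diff(2))
  also have "\<dots> = (LINT s:{0..}|lborel. k f s)"
    by (rule set_lebesgue_integral_cong) (use k in auto)
  finally show "(LINT r:{0..}|lborel. l f r) = (LINT s:{0..}|lborel. k f s)" .
qed

end

end

section \<open>Finite traces on von Neumann algebras\<close>

context semifinite_von_neumann_algebra
begin

text \<open>The bicommutant property as a membership test: algebraic and norm closure of
  \<open>M\<close> reduce to commutation with each \<open>U\<close>.\<close>

lemma M_iff: "T \<in> M \<longleftrightarrow> T \<in> bounded_ops \<and> (\<forall>U\<in>commutant M. T o\<^sub>L U = U o\<^sub>L T)"
  using vna unfolding von_neumann_algebra_def commutant_def by blast

lemma M_bounded: "T \<in> M \<Longrightarrow> T \<in> bounded_ops"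
  by (simp add: M_iff)

lemma M_adj: "T \<in> M \<Longrightarrow> adj T \<in> M"
  using vna by (simp add: von_neumann_algebra_def)

lemma M_add: "S \<in> M \<Longrightarrow> T \<in> M \<Longrightarrow> S + T \<in> M"
  by (simp add: M_iff bounded_ops_add blinfun_compose.add_left
      blinfun_compose.add_right)

lemma M_scaleR: "T \<in> M \<Longrightarrow> r *\<^sub>R T \<in> M"
  by (simp add: M_iff bounded_ops_scaleR blinfun_compose.scaleR_left
      blinfun_compose.scaleR_right)

lemma M_compose: "S \<in> M \<Longrightarrow> T \<in> M \<Longrightarrow> S o\<^sub>L T \<in> M"
  by (simp add: M_iff bounded_ops_compose) (metis blinfun_compose_assoc)

lemma M_scalar: "scalar_op c \<in> M"
  unfolding M_iff by (intro conjI ballI bounded_ops_scalar blinfun_eqI) (simp add: commutant_def bounded_opsD)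

lemma M_id: "id_blinfun \<in> M"
  using M_scalar[of 1] scalar_op_of_real[of 1, where 'h = 'h] by simp

lemma M_diff: "S \<in> M \<Longrightarrow> T \<in> M \<Longrightarrow> S - T \<in> M"
  using M_add[of S "(-1) *\<^sub>R T"] M_scaleR[of T "-1"] by simp

lemma M_limit:
  assumes X: "\<And>n. X n \<in> M" and lim: "X \<longlonglongrightarrow> T"
  shows "T \<in> M"
  unfolding M_iff
proof (intro conjI ballI)
  show "T \<in> bounded_ops" by (rule bounded_ops_limit[OF M_bounded[OF X] lim])
  fix U assume U: "U \<in> commutant M"
  have "(\<lambda>n. X n o\<^sub>L U) \<longlonglongrightarrow> (T o\<^sub>L U)" "(\<lambda>n. U o\<^sub>L X n) \<longlonglongrightarrow> (U o\<^sub>L T)"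
    by (intro blinfun_compose.tendsto lim tendsto_const)+
  moreover have "X n o\<^sub>L U = U o\<^sub>L X n" for n using X[of n] U by (simp add: M_iff)
  ultimately show "T o\<^sub>L U = U o\<^sub>L T" by (simp add: LIMSEQ_unique)
qed

lemma pos_cone_add: "a \<in> pos_cone M \<Longrightarrow> b \<in> pos_cone M \<Longrightarrow> a + b \<in> pos_cone M"
  and pos_cone_scaleR: "a \<in> pos_cone M \<Longrightarrow> 0 \<le> r \<Longrightarrow> r *\<^sub>R a \<in> pos_cone M"
  and pos_cone_id: "id_blinfun \<in> pos_cone M"
  and pos_cone_adj_self: "y \<in> M \<Longrightarrow> adj y o\<^sub>L y \<in> pos_cone M"
  and pos_cone_self_adj: "y \<in> M \<Longrightarrow> y o\<^sub>L adj y \<in> pos_cone M"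
  by (auto simp: pos_cone_def M_add M_scaleR M_id M_compose M_adj positive_op_add positive_op_scaleR positive_op_id
      positive_op_adj_self positive_op_self_adj M_bounded)

lemma pos_cone_0: "0 \<in> pos_cone M"
  using pos_cone_scaleR[OF pos_cone_id, of 0] by simp

lemma tau_0: "tau 0 = 0"
  using tau_scale[OF order_refl pos_cone_id] by simp

lemma tau_mono:
  assumes "a \<in> pos_cone M" "b \<in> pos_cone M" "positive_op (b - a)"
  shows "tau a \<le> tau b"
proof -
  have "b - a \<in> pos_cone M" using assms by (simp add: pos_cone_def M_diff)
  from tau_add[OF assms(1) this] show ?thesis by simp
qed

lemma positive_norm_minus:
  assumes "selfadjoint T" "norm T \<le> r"
  shows "positive_op (r *\<^sub>R id_blinfun - T)" "positive_op (T + r *\<^sub>R id_blinfun)"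
  using op_between_norm[OF assms] assms(1)
  by (auto simp: positive_op_iff op_between_def blinfun.bilinear_simps inner_simps dot_square_norm
      intro!: selfadjoint_diff selfadjoint_add selfadjoint_scaleR selfadjoint_id) (smt (verit))+

section \<open>The real part of a finite trace\<close>

context
  assumes fin: "tau id_blinfun < \<infinity>"
begin

lemma tau_finite: assumes a: "a \<in> pos_cone M" shows "tau a < \<infinity>"
proof -
  have "tau a \<le> tau (norm a *\<^sub>R id_blinfun)"
    using a by (intro tau_mono pos_cone_scaleR pos_cone_id positive_norm_minus)
      (auto simp: pos_cone_def positive_op_selfadjoint)
  also have "\<dots> = ennreal (norm a) * tau id_blinfun" by (intro tau_scale pos_cone_id) simp
  also have "\<dots> < \<infinity>" using fin by (simp add: ennreal_mult_less_top)
  finally show ?thesis .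
qed

definition tau_real :: "'h op \<Rightarrow> real" where
  "tau_real a = enn2real (tau a)"

lemma tau_real_nonneg: "0 \<le> tau_real a"
  by (simp add: tau_real_def)

lemma tau_real_add: "a \<in> pos_cone M \<Longrightarrow> b \<in> pos_cone M \<Longrightarrow> tau_real (a + b) = tau_real a + tau_real b"
  using tau_finite by (simp add: tau_real_def tau_add enn2real_plus)

lemma tau_real_scaleR: "a \<in> pos_cone M \<Longrightarrow> 0 \<le> r \<Longrightarrow> tau_real (r *\<^sub>R a) = r * tau_real a"
  by (simp add: tau_real_def tau_scale enn2real_mult)

lemma tau_real_mono:
  "a \<in> pos_cone M \<Longrightarrow> b \<in> pos_cone M \<Longrightarrow> positive_op (b - a) \<Longrightarrow> tau_real a \<le> tau_real b"
  unfolding tau_real_def using tau_mono tau_finite by (intro enn2real_mono) auto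

lemma tau_real_tracial: "y \<in> M \<Longrightarrow> tau_real (adj y o\<^sub>L y) = tau_real (y o\<^sub>L adj y)"
  by (simp add: tau_real_def tau_tracial)

text \<open>The real part of the linear extension of \<open>tau\<close> to \<open>M\<close>.\<close>

definition re_trace :: "'h op \<Rightarrow> real" where
  "re_trace T = tau_real ((1/2) *\<^sub>R (T + adj T) + norm T *\<^sub>R id_blinfun) - tau_real (norm T *\<^sub>R id_blinfun)"

lemma re_part:
  assumes T: "T \<in> M"
  shows "selfadjoint ((1/2) *\<^sub>R (T + adj T))" "norm ((1/2) *\<^sub>R (T + adj T)) \<le> norm T"
    "(1/2) *\<^sub>R (T + adj T) \<in> M"
proof -
  note b = M_bounded[OF T]
  show "selfadjoint ((1/2) *\<^sub>R (T + adj T))"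
    using b by (simp add: selfadjoint_def bounded_ops_scaleR bounded_ops_add adj_bounded_ops adj_scaleR adj_add adj_adj add.commute)
  have "norm (T + adj T) \<le> norm T + norm (adj T)" by (rule norm_triangle_ineq)
  also have "\<dots> \<le> 2 * norm T" using norm_adj_le[OF b] by simp
  finally show "norm ((1/2) *\<^sub>R (T + adj T)) \<le> norm T" by simp
  show "(1/2) *\<^sub>R (T + adj T) \<in> M" by (intro M_scaleR M_add M_adj T)
qed

lemma re_trace_decomposition:
  assumes T: "T \<in> M"
  shows "(1/2) *\<^sub>R (T + adj T) + norm T *\<^sub>R id_blinfun \<in> pos_cone M"
    "norm T *\<^sub>R id_blinfun \<in> pos_cone M"
  using re_part[OF T] positive_norm_minus(2)[OF re_part(1,2)[OF T]]
  by (auto simp: pos_cone_def M_add M_scaleR M_id positive_op_scaleR positive_op_id)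

text \<open>The value does not depend on how the real part is written as a difference of positive
  elements, since the crosswise sums agree. Linearity then comes from choosing a convenient
  decomposition.\<close>

lemma re_trace_eqI:
  assumes T: "T \<in> M" and ab: "a \<in> pos_cone M" "b \<in> pos_cone M" "T + adj T = 2 *\<^sub>R (a - b)"
  shows "re_trace T = tau_real a - tau_real b"
proof -
  note d = re_trace_decomposition[OF T]
  have "((1/2) *\<^sub>R (T + adj T) + norm T *\<^sub>R id_blinfun) + b = a + norm T *\<^sub>R id_blinfun"
    by (simp add: ab(3))
  then have "tau_real ((1/2) *\<^sub>R (T + adj T) + norm T *\<^sub>R id_blinfun) + tau_real b
      = tau_real a + tau_real (norm T *\<^sub>R id_blinfun)"
    by (simp only: tau_real_add[OF d(1) ab(2), symmetric] tau_real_add[OF ab(1) d(2), symmetric])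
  then show ?thesis unfolding re_trace_def by linarith
qed

lemma re_trace_obtain:
  assumes T: "T \<in> M"
  obtains a b where "a \<in> pos_cone M" "b \<in> pos_cone M" "T + adj T = 2 *\<^sub>R (a - b)" "re_trace T = tau_real a - tau_real b"
proof
  note d = re_trace_decomposition[OF T]
  show "(1/2) *\<^sub>R (T + adj T) + norm T *\<^sub>R id_blinfun \<in> pos_cone M" "norm T *\<^sub>R id_blinfun \<in> pos_cone M" by (fact d)+
  show "T + adj T = 2 *\<^sub>R ((1/2) *\<^sub>R (T + adj T) + norm T *\<^sub>R id_blinfun - norm T *\<^sub>R id_blinfun)" by simp
qed (simp add: re_trace_def)

lemma re_trace_cong: "S \<in> M \<Longrightarrow> T \<in> M \<Longrightarrow> S + adj S = T + adj T \<Longrightarrow> re_trace S = re_trace T"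
  by (metis re_trace_obtain re_trace_eqI)

lemma re_trace_pos: "a \<in> pos_cone M \<Longrightarrow> re_trace a = tau_real a"
  using re_trace_eqI[of a a 0] pos_cone_0 positive_op_selfadjoint[of a]
  by (simp add: pos_cone_def selfadjoint_def tau_real_def tau_0 scaleR_2)

lemma re_trace_add:
  assumes S: "S \<in> M" and T: "T \<in> M"
  shows "re_trace (S + T) = re_trace S + re_trace T"
proof -
  obtain a b where S': "a \<in> pos_cone M" "b \<in> pos_cone M" "S + adj S = 2 *\<^sub>R (a - b)" "re_trace S = tau_real a - tau_real b"
    using re_trace_obtain[OF S] .
  obtain c d where T': "c \<in> pos_cone M" "d \<in> pos_cone M" "T + adj T = 2 *\<^sub>R (c - d)" "re_trace T = tau_real c - tau_real d"
    using re_trace_obtain[OF T] .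
  have "(S + T) + adj (S + T) = (S + adj S) + (T + adj T)"
    using S T by (simp add: adj_add M_bounded)
  also have "\<dots> = 2 *\<^sub>R ((a + c) - (b + d))" unfolding S'(3) T'(3) by (simp add: algebra_simps)
  finally have "re_trace (S + T) = tau_real (a + c) - tau_real (b + d)"
    using S T S' T' by (intro re_trace_eqI M_add pos_cone_add)
  then show ?thesis using S' T' by (simp add: tau_real_add)
qed

lemma re_trace_scaleR:
  assumes T: "T \<in> M"
  shows "re_trace (r *\<^sub>R T) = r * re_trace T"
proof -
  obtain a b where T': "a \<in> pos_cone M" "b \<in> pos_cone M" "T + adj T = 2 *\<^sub>R (a - b)" "re_trace T = tau_real a - tau_real b"
    using re_trace_obtain[OF T] .
  have "r *\<^sub>R T + adj (r *\<^sub>R T) = r *\<^sub>R (T + adj T)"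
    using T by (simp add: adj_scaleR M_bounded scaleR_add_right)
  then have eq: "r *\<^sub>R T + adj (r *\<^sub>R T) = r *\<^sub>R 2 *\<^sub>R (a - b)" by (simp only: T'(3))
  show ?thesis
  proof (cases "0 \<le> r")
    case True
    have "re_trace (r *\<^sub>R T) = tau_real (r *\<^sub>R a) - tau_real (r *\<^sub>R b)"
      using True T T' eq by (intro re_trace_eqI M_scaleR pos_cone_scaleR) (auto simp: algebra_simps)
    then show ?thesis using True T' by (simp add: tau_real_scaleR right_diff_distrib)
  next
    case False
    have "re_trace (r *\<^sub>R T) = tau_real ((- r) *\<^sub>R b) - tau_real ((- r) *\<^sub>R a)"
      using False T T' eq by (intro re_trace_eqI M_scaleR pos_cone_scaleR) (auto simp: algebra_simps)
    also have "\<dots> = (- r) * tau_real b - (- r) * tau_real a"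
      using False T' tau_real_scaleR[of b "- r"] tau_real_scaleR[of a "- r"] by simp
    finally show ?thesis unfolding T'(4) by (simp add: right_diff_distrib)
  qed
qed

text \<open>Polarisation: with \<open>y = adj S\<close>, the real part of
  \<open>adj y o\<^sub>L T\<close> is half of the square \<open>adj v o\<^sub>L v\<close> at
  \<open>v = y + T\<close> minus those at \<open>y\<close> and \<open>T\<close>. Each square may be
  reversed by \<open>tau_tracial\<close>, and the same identity read backwards gives the other
  side.\<close>

lemma re_trace_cyclic:
  assumes S: "S \<in> M" and T: "T \<in> M"
  shows "re_trace (S o\<^sub>L T) = re_trace (T o\<^sub>L S)"
proof -
  define y where "y = adj S"
  have y: "y \<in> M" "adj y = S" using S by (simp_all add: y_def M_adj adj_adj M_bounded)
  note b = M_bounded[OF y(1)] M_bounded[OF T] M_bounded[OF M_add[OF y(1) T]]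
  have "re_trace (adj y o\<^sub>L T) = tau_real ((1/2) *\<^sub>R (adj (y + T) o\<^sub>L (y + T))) - tau_real ((1/2) *\<^sub>R ((adj y o\<^sub>L y) + (adj T o\<^sub>L T)))"
  proof (rule re_trace_eqI)
    show "(adj y o\<^sub>L T) + adj (adj y o\<^sub>L T) = 2 *\<^sub>R ((1/2) *\<^sub>R (adj (y + T) o\<^sub>L (y + T)) - (1/2) *\<^sub>R ((adj y o\<^sub>L y) + (adj T o\<^sub>L T)))"
      using b by (simp add: adj_compose adj_bounded_ops adj_adj adj_add blinfun_compose.add_left blinfun_compose.add_right flip: scaleR_diff_right)
  qed (intro M_compose M_adj y T pos_cone_scaleR pos_cone_add pos_cone_adj_self M_add; simp)+
  also have "\<dots> = tau_real ((1/2) *\<^sub>R ((y + T) o\<^sub>L adj (y + T))) - tau_real ((1/2) *\<^sub>R ((y o\<^sub>L adj y) + (T o\<^sub>L adj T)))"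
    using y(1) T by (simp add: tau_real_scaleR tau_real_add tau_real_tracial pos_cone_adj_self pos_cone_self_adj pos_cone_add M_add)
  also have "\<dots> = re_trace (T o\<^sub>L adj y)"
  proof (rule re_trace_eqI[symmetric])
    show "(T o\<^sub>L adj y) + adj (T o\<^sub>L adj y) = 2 *\<^sub>R ((1/2) *\<^sub>R ((y + T) o\<^sub>L adj (y + T)) - (1/2) *\<^sub>R ((y o\<^sub>L adj y) + (T o\<^sub>L adj T)))"
      using b by (simp add: adj_compose adj_bounded_ops adj_adj adj_add blinfun_compose.add_left blinfun_compose.add_right flip: scaleR_diff_right)
  qed (intro M_compose M_adj y T pos_cone_scaleR pos_cone_add pos_cone_self_adj M_add; simp)+
  finally show ?thesis by (simp add: y)
qed

text \<open>The shifted real part lies between 0 and twice \<open>norm T\<close>, and the shift is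
  subtracted again.\<close>

lemma re_trace_bound:
  assumes T: "T \<in> M"
  shows "\<bar>re_trace T\<bar> \<le> tau_real id_blinfun * norm T"
proof -
  note d = re_trace_decomposition[OF T] and r = re_part[OF T]
  let ?H = "(1/2) *\<^sub>R (T + adj T)" and ?n = "norm T *\<^sub>R (id_blinfun :: 'h op)"
  have n: "tau_real ?n = norm T * tau_real id_blinfun" by (intro tau_real_scaleR pos_cone_id) simp
  have "tau_real (?H + ?n) \<le> tau_real (?n + ?n)"
    using positive_norm_minus(1)[OF r(1,2)] by (intro tau_real_mono d pos_cone_add) (simp add: algebra_simps)
  also have "\<dots> = 2 * (norm T * tau_real id_blinfun)" using d by (simp add: tau_real_add n)
  finally show ?thesis using tau_real_nonneg[of "?H + ?n"] by (simp add: re_trace_def n mult.commute)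
qed

lemma tracial_functional_re_trace: "tracial_functional M re_trace (tau_real id_blinfun)"
proof
  show "M \<subseteq> bounded_ops" using M_bounded by blast
  show "0 \<le> re_trace T" if "T \<in> M" "positive_op T" for T
    using that re_trace_pos[of T] by (simp add: pos_cone_def tau_real_nonneg)
qed (auto intro: M_id M_add M_scaleR M_compose M_limit re_trace_cyclic re_trace_bound simp: re_trace_add re_trace_scaleR)

lemma re_trace_scalar:
  assumes a: "a \<in> pos_cone M"
  shows "re_trace (scalar_op c o\<^sub>L a) = Re c * tau_real a"
proof -
  have aM: "a \<in> M" and sa: "selfadjoint a" using a by (auto simp: pos_cone_def positive_op_selfadjoint)
  have ab: "a \<in> bounded_ops" by (rule M_bounded[OF aM])
  have adj: "adj (scalar_op c o\<^sub>L a) = scalar_op (cnj c) o\<^sub>L a"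
    by (intro adj_eqI bounded_ops_compose bounded_ops_scalar ab)
      (simp add: inner_scaleC_left selfadjoint_inner[OF sa] bounded_opsD[OF ab])
  have "re_trace (scalar_op c o\<^sub>L a) = re_trace (Re c *\<^sub>R a)"
  proof (rule re_trace_cong)
    have "adj (Re c *\<^sub>R a) = Re c *\<^sub>R a" using sa selfadjoint_scaleR unfolding selfadjoint_def by blast
    moreover have "(scalar_op c o\<^sub>L a) + (scalar_op (cnj c) o\<^sub>L a) = Re c *\<^sub>R a + Re c *\<^sub>R a"
    proof (rule blinfun_eqI)
      fix v
      have "c *C a v + cnj c *C a v = complex_of_real (2 * Re c) *C a v"
        by (simp add: scaleC_add_left[symmetric] complex_add_cnj)
      then show "((scalar_op c o\<^sub>L a) + (scalar_op (cnj c) o\<^sub>L a)) v = (Re c *\<^sub>R a + Re c *\<^sub>R a) v"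
        by (simp add: blinfun.bilinear_simps scaleC_of_real scaleR_2 scaleR_add_left[symmetric] del: of_real_mult)
    qed
    ultimately show "(scalar_op c o\<^sub>L a) + adj (scalar_op c o\<^sub>L a) = Re c *\<^sub>R a + adj (Re c *\<^sub>R a)" by (simp add: adj)
  qed (intro M_compose M_scalar M_scaleR aM)+
  also have "\<dots> = Re c * tau_real a" by (simp add: re_trace_scaleR aM re_trace_pos[OF a])
  finally show ?thesis .
qed

lemma re_trace_sum:
  assumes "\<And>i. i < (n::nat) \<Longrightarrow> a i \<in> pos_cone M"
  shows "(\<Sum>i<n. scalar_op (c i) o\<^sub>L a i) \<in> M"
    "re_trace (\<Sum>i<n. scalar_op (c i) o\<^sub>L a i) = (\<Sum>i<n. Re (c i) * tau_real (a i))"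
  using assms
proof (induction n)
  case 0
  { case 1 show ?case using M_scaleR[OF M_id, of 0] by simp }
  { case 2 show ?case using re_trace_scaleR[OF M_id, of 0] by simp }
next
  case (Suc n)
  { case 1 then show ?case using Suc(1) by (auto simp: pos_cone_def intro!: M_add M_compose M_scalar) }
  { case 2 then show ?case using Suc by (simp add: re_trace_add re_trace_scalar M_compose M_scalar pos_cone_def) }
qed

text \<open>The description in \<open>tau_ext\<close> is unambiguous because every representation of
  \<open>y\<close> yields the same real and imaginary part: the first is \<open>re_trace y\<close>,
  the second is \<open>re_trace\<close> of \<open>y\<close> multiplied by \<open>- \<i>\<close>,
  which is zero for selfadjoint \<open>y\<close>.\<close>

lemma selfadjoint_in_M_tau:
  assumes y: "y \<in> M" "selfadjoint y"
  shows "y \<in> M_tau M tau" "tau_ext M tau y = complex_of_real (re_trace y)"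
proof -
  \<comment> \<open>A two-term representation: \<open>y\<close> is \<open>y + norm y\<close> minus
    \<open>norm y\<close>, both positive.\<close>
  define c :: "nat \<Rightarrow> complex" where "c i = (if i = 0 then 1 else - 1)" for i
  define a where "a i = (if i = 0 then y + norm y *\<^sub>R id_blinfun else norm y *\<^sub>R id_blinfun)" for i :: nat
  have "y + norm y *\<^sub>R id_blinfun \<in> pos_cone M" "norm y *\<^sub>R id_blinfun \<in> pos_cone M"
    using y positive_norm_minus(2)[OF y(2) order_refl] pos_cone_scaleR[OF pos_cone_id]
    by (auto simp: pos_cone_def M_add M_scaleR M_id)
  then have a: "a i \<in> fin_pos M tau" for i using tau_finite by (simp add: fin_pos_def a_def)
  have s: "scalar_op (1::complex) = (id_blinfun :: 'h op)" "scalar_op (- 1) = (- id_blinfun :: 'h op)"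
    using scalar_op_of_real[of 1, where 'h = 'h] scalar_op_of_real[of "- 1", where 'h = 'h] by simp_all
  have yeq: "y = (\<Sum>i<2. scalar_op (c i) o\<^sub>L a i)"
    by (intro blinfun_eqI) (simp add: numeral_2_eq_2 c_def a_def s blinfun.bilinear_simps)
  have rep: "\<exists>(n::nat) c a. (\<forall>i<n. a i \<in> fin_pos M tau) \<and> y = (\<Sum>i<n. scalar_op (c i) o\<^sub>L a i)"
    using a yeq by blast
  then show "y \<in> M_tau M tau" unfolding M_tau_def by blast
  have uniq: "z = complex_of_real (re_trace y)"
    if a: "\<forall>i<n. a i \<in> fin_pos M tau" and yeq: "y = (\<Sum>i<n. scalar_op (c i) o\<^sub>L a i)"
      and z: "z = (\<Sum>i<n. c i * complex_of_real (enn2real (tau (a i))))" for n :: nat and c a z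
  proof (rule complex_eqI)
    have ap: "\<And>i. i < n \<Longrightarrow> a i \<in> pos_cone M" using a by (simp add: fin_pos_def)
    show "Re z = Re (complex_of_real (re_trace y))"
      using re_trace_sum(2)[of n a c, OF ap] by (simp add: z yeq[symmetric] tau_real_def)
    \<comment> \<open>Multiplication by \<open>- \<i>\<close> moves the imaginary parts of the
      coefficients into the real parts, where \<open>re_trace\<close> sees them.\<close>
    let ?y = "scalar_op (- \<i>) o\<^sub>L y"
    have "re_trace ?y = 0"
    proof -
      have yb: "y \<in> bounded_ops" by (rule M_bounded[OF y(1)])
      have "adj ?y = scalar_op \<i> o\<^sub>L y"
        by (intro adj_eqI bounded_ops_compose bounded_ops_scalar yb)
          (simp add: inner_scaleC_left selfadjoint_inner[OF y(2)] bounded_opsD[OF yb])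
      moreover have "?y + (scalar_op \<i> o\<^sub>L y) = 0"
      proof (rule blinfun_eqI)
        fix v
        have "(- \<i>) *C y v + \<i> *C y v = complex_of_real 0 *C y v"
          by (simp add: scaleC_add_left[symmetric])
        then show "(?y + (scalar_op \<i> o\<^sub>L y)) v = (0 :: 'h op) v"
          by (simp add: blinfun.bilinear_simps scaleC_of_real del: of_real_0)
      qed
      ultimately have "?y + adj ?y = 2 *\<^sub>R (0 - 0 :: 'h op)" by simp
      from re_trace_eqI[OF _ pos_cone_0 pos_cone_0 this] y show ?thesis by (simp add: M_compose M_scalar)
    qed
    moreover have "?y = (\<Sum>i<n. scalar_op (- \<i> * c i) o\<^sub>L a i)"
    proof (rule blinfun_eqI)
      fix v
      have "(- \<i>) *C (\<Sum>i<n. c i *C a i v) = (\<Sum>i<n. (- \<i> * c i) *C a i v)"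
        by (induction n) (auto simp: scaleC_zero_right scaleC_add_right scaleC_scaleC)
      then show "?y v = (\<Sum>i<n. scalar_op (- \<i> * c i) o\<^sub>L a i) v"
        by (simp add: yeq blinfun.sum_left)
    qed
    ultimately show "Im z = Im (complex_of_real (re_trace y))"
      using re_trace_sum(2)[of n a "\<lambda>i. - \<i> * c i", OF ap] by (simp add: z tau_real_def)
  qed
  show "tau_ext M tau y = complex_of_real (re_trace y)"
    unfolding tau_ext_def
  proof (rule the_equality)
    have a': "\<forall>i<2::nat. a i \<in> fin_pos M tau" using a by simp
    show "\<exists>(n::nat) c a. (\<forall>i<n. a i \<in> fin_pos M tau) \<and> y = (\<Sum>i<n. scalar_op (c i) o\<^sub>L a i) \<and>
        complex_of_real (re_trace y) = (\<Sum>i<n. c i * complex_of_real (enn2real (tau (a i))))"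
      using a' yeq uniq[OF a' yeq refl] by (intro exI[of _ 2] exI[of _ c] exI[of _ a]) auto
  qed (use uniq in blast)
qed

end

section \<open>Consequences of membership in \<open>L1\<close>\<close>

lemma affiliated_bounded_in_M:
  assumes "affiliated M (op_graph T)" "T \<in> bounded_ops"
  shows "T \<in> M"
  unfolding M_iff
proof (intro conjI ballI assms(2) blinfun_eqI)
  fix U x assume "U \<in> commutant M"
  \<comment> \<open>Invariance of the graph of an everywhere defined operator under \<open>U\<close>
    is commutation with \<open>U\<close>.\<close>
  then have "(U x, U (T x)) \<in> op_graph T" using assms(1) by (force simp: affiliated_def op_graph_def)
  then show "(T o\<^sub>L U) x = (U o\<^sub>L T) x" by (simp add: op_graph_def)
qed

text \<open>Elements of \<open>M_tau\<close> are square-integrable. For a positive \<open>a\<close>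
  of finite trace, the square of \<open>a\<close> is at most \<open>norm a *\<^sub>R a\<close>; the
  parallelogram law extends this to sums.\<close>

lemma tau_adj_self_finite_M_tau:
  assumes "y \<in> M_tau M tau"
  shows "y \<in> M" "tau (adj y o\<^sub>L y) < \<infinity>"
proof -
  define P where "P y \<longleftrightarrow> y \<in> M \<and> tau (adj y o\<^sub>L y) < \<infinity>" for y
  have P_add: "P (u + v)" if u: "P u" and v: "P v" for u v
  proof -
    have M: "u \<in> M" "v \<in> M" "u + v \<in> M" "u - v \<in> M" using u v by (auto simp: P_def M_add M_diff)
    note b = M(1,2)[THEN M_bounded]
    \<comment> \<open>Both terms on the left are positive, so finiteness of the right side bounds
      the first one.\<close>
    have "(adj (u + v) o\<^sub>L (u + v)) + (adj (u - v) o\<^sub>L (u - v)) = 2 *\<^sub>R ((adj u o\<^sub>L u) + (adj v o\<^sub>L v))"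
      using b by (simp add: adj_add adj_diff blinfun_compose.add_left blinfun_compose.add_right
          blinfun_compose.diff_left blinfun_compose.diff_right scaleR_2)
    then have "tau (adj (u + v) o\<^sub>L (u + v)) + tau (adj (u - v) o\<^sub>L (u - v)) = tau (2 *\<^sub>R ((adj u o\<^sub>L u) + (adj v o\<^sub>L v)))"
      using M by (simp add: tau_add[symmetric] pos_cone_adj_self)
    also have "\<dots> = 2 * (tau (adj u o\<^sub>L u) + tau (adj v o\<^sub>L v))"
      using M by (simp add: tau_scale tau_add pos_cone_adj_self pos_cone_add)
    also have "\<dots> < \<infinity>" using u v by (simp add: P_def ennreal_mult_less_top)
    finally have "tau (adj (u + v) o\<^sub>L (u + v)) < \<infinity>" by (simp add: less_top)
    then show ?thesis using M by (simp add: P_def)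
  qed
  have P_scalar: "P (scalar_op c o\<^sub>L a)" if a: "a \<in> fin_pos M tau" for c a
  proof -
    have aM: "a \<in> M" and pa: "positive_op a" and ta: "tau a < \<infinity>" using a by (auto simp: fin_pos_def pos_cone_def)
    have sa: "selfadjoint a" by (rule positive_op_selfadjoint[OF pa])
    let ?y = "scalar_op c o\<^sub>L a"
    have yM: "?y \<in> M" by (intro M_compose M_scalar aM)
    have "tau (adj ?y o\<^sub>L ?y) \<le> tau (((norm c)\<^sup>2 * norm a) *\<^sub>R a)"
    proof (rule tau_mono)
      show "adj ?y o\<^sub>L ?y \<in> pos_cone M" by (rule pos_cone_adj_self[OF yM])
      show "((norm c)\<^sup>2 * norm a) *\<^sub>R a \<in> pos_cone M" using aM pa by (simp add: pos_cone_def M_scaleR positive_op_scaleR)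
      have "0 \<le> inner x ((((norm c)\<^sup>2 * norm a) *\<^sub>R a - (adj ?y o\<^sub>L ?y)) x)" for x
      proof -
        have "inner x ((adj ?y o\<^sub>L ?y) x) = (norm (?y x))\<^sup>2"
          using inner_adj_right[OF M_bounded[OF yM], of x "?y x"] by (simp add: dot_square_norm)
        also have "\<dots> = (norm c)\<^sup>2 * (norm (a x))\<^sup>2" by (simp add: norm_scaleC power_mult_distrib)
        also have "\<dots> \<le> (norm c)\<^sup>2 * (norm a * inner x (a x))"
          using inner_op_le_norm[of _ a] by (intro mult_left_mono positive_op_norm_sq_le[OF pa]) (auto intro: order_trans[OF abs_ge_self])
        finally show ?thesis by (simp add: blinfun.bilinear_simps inner_simps)
      qed
      then show "positive_op (((norm c)\<^sup>2 * norm a) *\<^sub>R a - (adj ?y o\<^sub>L ?y))"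
        using positive_op_adj_self[OF M_bounded[OF yM]] sa
        by (simp add: positive_op_iff selfadjoint_diff selfadjoint_scaleR)
    qed
    also have "\<dots> = ennreal ((norm c)\<^sup>2 * norm a) * tau a"
      using aM pa by (intro tau_scale) (auto simp: pos_cone_def)
    also have "\<dots> < \<infinity>" using ta by (simp add: ennreal_mult_less_top)
    finally show ?thesis using yM by (simp add: P_def)
  qed
  obtain n :: nat and c a where y: "y = (\<Sum>i<n. scalar_op (c i) o\<^sub>L a i)" "\<forall>i<n. a i \<in> fin_pos M tau"
    using assms unfolding M_tau_def by blast
  have "P (\<Sum>i<m. scalar_op (c i) o\<^sub>L a i)" if "m \<le> n" for m
    using that
  proof (induction m)
    case 0
    have "adj 0 = (0 :: 'h op)" by (intro adj_eqI bounded_ops_0) simp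
    then show ?case using M_scaleR[OF M_id, of 0] by (simp add: P_def tau_0)
  next
    case (Suc m)
    then show ?case using y(2) by (auto intro!: P_add P_scalar)
  qed
  from this[OF order_refl] show "y \<in> M" "tau (adj y o\<^sub>L y) < \<infinity>" by (auto simp: P_def y(1))
qed

text \<open>If \<open>y\<close> is close to \<open>T\<close> on the range of \<open>p\<close>, then \<open>p\<close> is dominated by a multiple of
  \<open>p y\<^sup>* y p\<close>, whose trace is finite.\<close>

lemma tau_id_finite:
  assumes T: "op_graph T \<in> L1 M tau" and d: "0 < d" and low: "\<And>x. d * norm x \<le> norm (T x)"
  shows "tau id_blinfun < \<infinity>"
proof -
  obtain y where yM: "\<And>n. y n \<in> M_tau M tau" and yT: "tends_in_measure M tau y (op_graph T)"
    using T unfolding L1_def by blast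
  \<comment> \<open>Spending half of the lower bound \<open>d\<close> on the approximation leaves
    \<open>y N\<close> bounded below by \<open>d / 2\<close> on the range of
    \<open>p\<close>.\<close>
  have "d / 2 > 0" using d by simp
  with yT obtain N where "\<forall>n\<ge>N. \<exists>p\<in>projections M. tau (id_blinfun - p) \<le> ennreal 1 \<and>
      (\<forall>x u. (p x, u) \<in> op_graph T \<longrightarrow> norm (u - y n (p x)) \<le> d / 2 * norm x)"
    unfolding tends_in_measure_def by (metis zero_less_one)
  then obtain p where p: "p \<in> projections M" "tau (id_blinfun - p) \<le> ennreal 1"
    and close: "\<And>x. norm (T (p x) - y N (p x)) \<le> d / 2 * norm x"
    unfolding op_graph_def by blast
  have pM: "p \<in> M" and padj: "adj p = p" and pp: "p o\<^sub>L p = p" using p by (auto simp: projections_def)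
  have psa: "selfadjoint p" using pM padj by (simp add: selfadjoint_def M_bounded)
  have ppx: "p (p x) = p x" for x using pp by (metis blinfun_apply_blinfun_compose)
  have pin: "inner x (p x) = (norm (p x))\<^sup>2" for x
    using selfadjoint_inner[OF psa, of x "p x"] by (simp add: ppx dot_square_norm)
  note Y = tau_adj_self_finite_M_tau[OF yM[of N]]
  let ?z = "y N o\<^sub>L p"
  have zM: "?z \<in> M" by (intro M_compose Y pM)
  have pos_p: "p \<in> pos_cone M" using pM psa by (simp add: pos_cone_def positive_op_iff pin)
  have pos_q: "id_blinfun - p \<in> pos_cone M"
  proof -
    have "selfadjoint (id_blinfun - p)" by (intro selfadjoint_diff selfadjoint_id psa)
    moreover have "0 \<le> inner x ((id_blinfun - p) x)" for x
    proof -
      have "norm (p x) * norm (p x) \<le> norm x * norm (p x)"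
        using pin[of x] norm_cauchy_schwarz[of x "p x"] by (simp add: power2_eq_square)
      then have "norm (p x) \<le> norm x" by (cases "p x = 0") auto
      then show ?thesis by (simp add: blinfun.bilinear_simps inner_simps pin dot_square_norm power_mono)
    qed
    ultimately show ?thesis using pM by (simp add: pos_cone_def positive_op_iff M_diff M_id)
  qed
  \<comment> \<open>The constant is the inverse square of the remaining lower bound
    \<open>d / 2\<close>.\<close>
  have "tau p \<le> tau ((4 / d\<^sup>2) *\<^sub>R (adj ?z o\<^sub>L ?z))"
  proof (rule tau_mono[OF pos_p])
    show "(4 / d\<^sup>2) *\<^sub>R (adj ?z o\<^sub>L ?z) \<in> pos_cone M" by (intro pos_cone_scaleR pos_cone_adj_self zM) simp
    have "0 \<le> inner x (((4 / d\<^sup>2) *\<^sub>R (adj ?z o\<^sub>L ?z) - p) x)" for x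
    proof -
      have "norm (T (p x)) \<le> norm (T (p x) - y N (p x)) + norm (y N (p x))" by (metis norm_triangle_sub add.commute norm_minus_commute)
      moreover have "norm (T (p x) - y N (p x)) \<le> d / 2 * norm (p x)" using close[of "p x"] by (simp add: ppx)
      ultimately have "d / 2 * norm (p x) \<le> norm (y N (p x))" using low[of "p x"] by simp
      then have "(d / 2 * norm (p x))\<^sup>2 \<le> (norm (y N (p x)))\<^sup>2" using d by (intro power_mono) auto
      then have "(norm (p x))\<^sup>2 \<le> (4 / d\<^sup>2) * (norm (y N (p x)))\<^sup>2"
        using d by (simp add: power_mult_distrib power_divide field_simps)
      moreover have "inner x ((adj ?z o\<^sub>L ?z) x) = (norm (y N (p x)))\<^sup>2"
        using inner_adj_right[OF M_bounded[OF zM], of x "?z x"] by (simp add: dot_square_norm)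
      ultimately show ?thesis by (simp add: blinfun.bilinear_simps inner_simps pin)
    qed
    then show "positive_op ((4 / d\<^sup>2) *\<^sub>R (adj ?z o\<^sub>L ?z) - p)"
      using positive_op_adj_self[OF M_bounded[OF zM]] psa
      by (simp add: positive_op_iff selfadjoint_diff selfadjoint_scaleR)
  qed
  also have "\<dots> = ennreal (4 / d\<^sup>2) * tau (adj ?z o\<^sub>L ?z)" by (intro tau_scale pos_cone_adj_self zM) simp
  also have "\<dots> < \<infinity>"
  proof -
    \<comment> \<open>Reversing the product puts \<open>p\<close> in the middle, where it can be
      bounded by the identity; reversing again returns to
      \<open>adj (y N) o\<^sub>L y N\<close>.\<close>
    have "tau (adj ?z o\<^sub>L ?z) = tau (?z o\<^sub>L adj ?z)" by (rule tau_tracial[OF zM])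
    also have "\<dots> \<le> tau (y N o\<^sub>L adj (y N))"
    proof (rule tau_mono)
      have z: "?z o\<^sub>L adj ?z = adj (adj (y N)) o\<^sub>L p o\<^sub>L adj (y N)"
        using Y(1) pM by (simp add: adj_compose adj_adj M_bounded padj blinfun_compose_assoc) (metis blinfun_compose_assoc pp)
      have "(y N o\<^sub>L adj (y N)) - (?z o\<^sub>L adj ?z) = adj (adj (y N)) o\<^sub>L (id_blinfun - p) o\<^sub>L adj (y N)"
        unfolding z using Y(1) by (intro blinfun_eqI) (simp add: adj_adj M_bounded blinfun.bilinear_simps)
      then show "positive_op ((y N o\<^sub>L adj (y N)) - (?z o\<^sub>L adj ?z))"
        using pos_q Y(1) by (simp add: positive_op_sandwich adj_bounded_ops M_bounded pos_cone_def del: adj_adj)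
    qed (intro pos_cone_self_adj zM Y)+
    also have "\<dots> = tau (adj (y N) o\<^sub>L y N)" by (rule tau_tracial[OF Y(1), symmetric])
    also have "\<dots> < \<infinity>" by (rule Y)
    finally show ?thesis by (simp add: ennreal_mult_less_top)
  qed
  finally have "tau p < \<infinity>" .
  moreover have "tau (id_blinfun - p) < \<infinity>" using p(2) by (simp add: order_le_less_trans)
  moreover have "tau id_blinfun = tau p + tau (id_blinfun - p)" using tau_add[OF pos_p pos_q] by simp
  ultimately show ?thesis by simp
qed

end

section \<open>The formula on a semifinite algebra\<close>

lemma positive_invertible_bounds:
  fixes A Ainv :: "'h::complex_hilbert op"
  assumes A: "positive_op A" and inv: "Ainv o\<^sub>L A = id_blinfun"
  obtains d c where "0 < d" "\<And>x. d * norm x \<le> norm (A x)" "0 < c" "op_between c (norm A + c) A"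
proof
  define k where "k = norm Ainv + 1"
  have k: "0 < k" by (simp add: k_def add_nonneg_pos)
  define d where "d = 1 / k"
  show d: "0 < d" using k by (simp add: d_def)
  show low: "d * norm x \<le> norm (A x)" for x
  proof -
    have "norm x = norm (Ainv (A x))" using inv by (metis blinfun_apply_blinfun_compose blinfun_apply_id_blinfun)
    also have "\<dots> \<le> norm Ainv * norm (A x)" by (rule norm_blinfun)
    also have "\<dots> \<le> k * norm (A x)" by (intro mult_right_mono) (auto simp: k_def)
    finally show ?thesis using k by (simp add: d_def pos_divide_le_eq mult.commute)
  qed
  define n where "n = norm A + 1"
  have n: "0 < n" by (simp add: n_def add_nonneg_pos)
  \<comment> \<open>A lower bound on \<open>norm (A x)\<close> becomes one on the quadratic form,
    because the squared norm of \<open>A x\<close> is at most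
    \<open>norm A * inner x (A x)\<close>.\<close>
  define c where "c = d\<^sup>2 / n"
  show c: "0 < c" using d n by (simp add: c_def)
  have upper: "inner x (A x) \<le> norm A * (norm x)\<^sup>2" for x
    using inner_op_le_norm[of x A] by (rule order_trans[OF abs_ge_self])
  have lower: "c * (norm x)\<^sup>2 \<le> inner x (A x)" for x
  proof -
    have "(d * norm x)\<^sup>2 \<le> (norm (A x))\<^sup>2" using d by (intro power_mono low) simp
    also have "\<dots> \<le> norm A * inner x (A x)" by (rule positive_op_norm_sq_le[OF A upper])
    also have "\<dots> \<le> n * inner x (A x)" using positive_opD[OF A] by (intro mult_right_mono) (auto simp: n_def)
    finally show ?thesis using n by (simp add: c_def power_mult_distrib pos_divide_le_eq mult_ac)
  qed
  \<comment> \<open>Enlarging the upper bound by \<open>c\<close> makes the interval nonempty even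
    on the trivial space.\<close>
  have "norm A * (norm x)\<^sup>2 \<le> (norm A + c) * (norm x)\<^sup>2" for x :: 'h using c by (intro mult_right_mono) auto
  with upper have "inner x (A x) \<le> (norm A + c) * (norm x)\<^sup>2" for x using order_trans by blast
  then show "op_between c (norm A + c) A"
    using lower positive_op_selfadjoint[OF A] by (simp add: op_between_def)
qed

theorem proposition4p8:
  fixes M :: "'h::complex_hilbert op set" and tau :: "'h op \<Rightarrow> ennreal"
    and A B Ainv x :: "'h op" and f :: "real \<Rightarrow> real"
  assumes "semifinite_von_neumann_algebra M tau"
    and "op_graph A \<in> L1 M tau" and "op_graph B \<in> L1 M tau"
    and "selfadjoint A" and "selfadjoint B"
    and "positive_op A" and "positive_op B"
    and "A o\<^sub>L Ainv = id_blinfun" and "Ainv o\<^sub>L A = id_blinfun" and "positive_op Ainv"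
    and "x \<in> M"
    and "continuous_on {0..} f"
  shows "let
      L = (\<lambda>t. adj x o\<^sub>L (f t *\<^sub>R pos_part (B - t *\<^sub>R A)) o\<^sub>L x);
      R = (\<lambda>s. adj x o\<^sub>L sqrt_ratio A s o\<^sub>L (C_op A B s o\<^sub>L C_op A B s)
                 o\<^sub>L fun_calc f (C_op A B s) o\<^sub>L sqrt_ratio A s o\<^sub>L x)
    in (\<forall>s\<ge>0. positive_op (C_op A B s)) \<and>
       (\<forall>t\<ge>0. L t \<in> M_tau M tau) \<and> (\<forall>s\<ge>0. R s \<in> M_tau M tau) \<and>
       set_integrable lborel {0..} (\<lambda>t. tau_ext M tau (L t)) \<and>
       set_integrable lborel {0..} (\<lambda>s. tau_ext M tau (R s)) \<and>
       (LINT t:{0..}|lborel. tau_ext M tau (L t)) = (LINT s:{0..}|lborel. tau_ext M tau (R s))"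
proof -
  interpret semifinite_von_neumann_algebra M tau by fact
  note f = assms(12) and xM = assms(11) and posB = assms(7)
  obtain d c where d: "0 < d" "\<And>v. d * norm v \<le> norm (A v)" and c: "0 < c" and bA: "op_between c (norm A + c) A"
    using positive_invertible_bounds[OF assms(6,9)] by metis
  define a where "a = norm A + c"
  have bA: "op_between c a A" and ca: "c \<le> a" using bA by (simp_all add: a_def)
  \<comment> \<open>For bounded operators, affiliation already means membership in
    \<open>M\<close>.\<close>
  have aff: "affiliated M (op_graph A)" "affiliated M (op_graph B)"
    using assms(2,3) by (auto simp: L1_def tau_measurable_def)
  have AM: "A \<in> M" and BM: "B \<in> M"
    using aff assms(4,5) by (auto intro!: affiliated_bounded_in_M selfadjoint_bounded_ops)
  have fin: "tau id_blinfun < \<infinity>" by (rule tau_id_finite[OF assms(2) d])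
  interpret t: tracial_functional M re_trace "tau_real id_blinfun" by (rule tracial_functional_re_trace[OF fin])
  \<comment> \<open>By cyclicity \<open>x\<close> enters both sides only through this positive
    operator.\<close>
  define X where "X = x o\<^sub>L adj x"
  have xb: "x \<in> bounded_ops" by (rule M_bounded[OF xM])
  have X: "X \<in> M" "positive_op X"
    by (simp_all add: X_def xM xb M_compose M_adj positive_op_self_adj)
  define l where "l r = f r * re_trace (pos_part (B - r *\<^sub>R A) o\<^sub>L X)" for r
  define k where "k s = s * re_trace (fun_calc (\<lambda>r. r\<^sup>2 * f r) (t.inv_sqrt A s o\<^sub>L B o\<^sub>L t.inv_sqrt A s)
                      o\<^sub>L (t.inv_sqrt A s o\<^sub>L X o\<^sub>L t.inv_sqrt A s))" for s
  have F: "set_integrable lborel {0..} l" "set_integrable lborel {0..} k"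
    "(LINT r:{0..}|lborel. l r) = (LINT s:{0..}|lborel. k s)"
    using t.trace_formula[OF AM bA c ca BM posB X f] unfolding l_def[abs_def] k_def[abs_def] by auto
  define L where "L r = adj x o\<^sub>L (f r *\<^sub>R pos_part (B - r *\<^sub>R A)) o\<^sub>L x" for r
  define R where "R s = adj x o\<^sub>L sqrt_ratio A s o\<^sub>L (C_op A B s o\<^sub>L C_op A B s)
                 o\<^sub>L fun_calc f (C_op A B s) o\<^sub>L sqrt_ratio A s o\<^sub>L x" for s
  have sandwich: "re_trace (adj x o\<^sub>L T o\<^sub>L x) = re_trace (T o\<^sub>L X)" if "T \<in> M" for T
    using re_trace_cyclic[OF fin, of "adj x" "T o\<^sub>L x"] that xM
    by (simp add: X_def M_compose M_adj blinfun_compose_assoc)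
  have L: "L r \<in> M_tau M tau" "tau_ext M tau (L r) = complex_of_real (l r)" for r
  proof -
    let ?Y = "B - r *\<^sub>R A"
    have Y: "?Y \<in> M" by (intro M_diff M_scaleR AM BM)
    have bY: "op_between (- norm ?Y) (norm ?Y) ?Y"
      by (intro op_between_norm selfadjoint_diff selfadjoint_scaleR assms order_refl)
    have cm: "continuous_on S (\<lambda>r. max r 0 :: real)" for S by (intro continuous_intros)
    have P: "pos_part ?Y \<in> M" "selfadjoint (pos_part ?Y)"
      unfolding pos_part_def by (intro t.M_fun_calc[OF Y bY cm] selfadjoint_fun_calc[OF bY cm])+
    have LM: "L r \<in> M" unfolding L_def by (intro M_compose M_adj M_scaleR xM P)
    have Lsa: "selfadjoint (L r)" unfolding L_def by (intro selfadjoint_sandwich selfadjoint_scaleR P xb)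
    have "(f r *\<^sub>R pos_part ?Y) o\<^sub>L X = f r *\<^sub>R (pos_part ?Y o\<^sub>L X)"
      by (rule blinfun_compose.scaleR_left)
    then have "re_trace (L r) = l r"
      unfolding L_def l_def by (simp add: sandwich M_scaleR P re_trace_scaleR[OF fin] M_compose X)
    then show "L r \<in> M_tau M tau" "tau_ext M tau (L r) = complex_of_real (l r)"
      using selfadjoint_in_M_tau[OF fin LM Lsa] by simp_all
  qed
  have C: "C_op A B s = t.inv_sqrt A s o\<^sub>L B o\<^sub>L t.inv_sqrt A s" for s
    by (simp add: C_op_def Let_def t.inv_sqrt_def[OF AM bA c ca])
  have R: "positive_op (C_op A B s)" "R s \<in> M_tau M tau" "tau_ext M tau (R s) = complex_of_real (k s)"
    if s: "0 \<le> s" for s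
  proof -
    let ?S = "t.inv_sqrt A s" and ?C = "C_op A B s"
    let ?h = "fun_calc (\<lambda>r. r\<^sup>2 * f r) ?C"
    note S = t.inv_sqrt_in_M[OF AM bA c ca s] t.selfadjoint_inv_sqrt[OF AM bA c ca s]
    show pC: "positive_op ?C" unfolding C by (intro positive_op_conj posB S)
    have CM: "?C \<in> M" unfolding C by (intro M_compose S BM)
    have bC: "op_between 0 (norm ?C) ?C" by (intro positive_op_between pC order_refl)
    have cf: "continuous_on {0..norm ?C} f" by (rule continuous_on_subset[OF f]) auto
    have ch: "continuous_on {0..norm ?C} (\<lambda>r. r\<^sup>2 * f r)" by (intro continuous_intros cf)
    have h: "?h \<in> M" "selfadjoint ?h" by (intro t.M_fun_calc[OF CM bC ch] selfadjoint_fun_calc[OF bC ch])+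
    have hC: "(?C o\<^sub>L ?C) o\<^sub>L fun_calc f ?C = ?h"
    proof -
      have "?h = fun_calc (\<lambda>r. r * r) ?C o\<^sub>L fun_calc f ?C"
        unfolding power2_eq_square by (intro fun_calc_mult[OF bC] continuous_intros cf)
      also have "fun_calc (\<lambda>r. r * r) ?C = ?C o\<^sub>L ?C"
        by (simp add: fun_calc_mult[OF bC continuous_on_id continuous_on_id] fun_calc_ident[OF bC])
      finally show ?thesis by simp
    qed
    \<comment> \<open>The two outer factors of \<open>R s\<close> together supply the scalar
      \<open>s\<close> in \<open>k s\<close>.\<close>
    have ratio: "sqrt_ratio A s = sqrt s *\<^sub>R ?S"
    proof -
      have cs: "continuous_on {c + s..a + s} (\<lambda>r. 1 / sqrt r)" using c s by (intro continuous_intros) auto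
      have cs': "continuous_on {c..a} (\<lambda>r. 1 / sqrt (r + s))" using c s by (intro continuous_intros) auto
      have "?S = fun_calc (\<lambda>r. 1 / sqrt (r + s)) A"
        unfolding t.inv_sqrt_def[OF AM bA c ca] by (rule fun_calc_shift[OF bA cs])
      then show ?thesis
        by (simp add: sqrt_ratio_def fun_calc_scale[OF bA cs', symmetric] real_sqrt_divide)
    qed
    have Req: "R s = s *\<^sub>R (adj x o\<^sub>L (?S o\<^sub>L ?h o\<^sub>L ?S) o\<^sub>L x)"
      unfolding R_def hC[symmetric] ratio
      by (intro blinfun_eqI) (simp add: blinfun.bilinear_simps s)
    have ShS: "?S o\<^sub>L ?h o\<^sub>L ?S \<in> M" by (intro M_compose S h)
    have RM: "R s \<in> M" unfolding Req by (intro M_compose M_adj M_scaleR xM ShS)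
    have Rsa: "selfadjoint (R s)"
      unfolding Req by (intro selfadjoint_scaleR selfadjoint_sandwich selfadjoint_conj h S xb)
    have "re_trace (R s) = s * re_trace (?S o\<^sub>L (?h o\<^sub>L ?S o\<^sub>L X))"
      unfolding Req using xM ShS
      by (simp add: re_trace_scaleR[OF fin] M_compose M_adj sandwich) (simp add: blinfun_compose_assoc)
    \<comment> \<open>Moving the leading \<open>?S\<close> to the end wraps \<open>X\<close> between
      two copies of it, the form in which the derivative of the integrated formula delivers
      it.\<close>
    also have "re_trace (?S o\<^sub>L (?h o\<^sub>L ?S o\<^sub>L X)) = re_trace (?h o\<^sub>L ?S o\<^sub>L X o\<^sub>L ?S)"
      by (intro re_trace_cyclic[OF fin] M_compose S h X)
    also have "s * \<dots> = k s" by (simp add: k_def C blinfun_compose_assoc)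
    finally show "R s \<in> M_tau M tau" "tau_ext M tau (R s) = complex_of_real (k s)"
      using selfadjoint_in_M_tau[OF fin RM Rsa] by simp_all
  qed
  have of_real_int: "set_integrable lborel {0..} (\<lambda>r. complex_of_real (g r))" if "set_integrable lborel {0..} g" for g :: "real \<Rightarrow> real"
  proof -
    have "(\<lambda>r. indicator {0..} r *\<^sub>R complex_of_real (g r)) = (\<lambda>r. complex_of_real (indicator {0..} r *\<^sub>R g r))"
      by (simp add: scaleR_conv_of_real)
    then show ?thesis using that by (simp only: set_integrable_def complex_of_real_integrable_eq)
  qed
  have "set_integrable lborel {0..} (\<lambda>r. tau_ext M tau (L r))" by (simp add: L of_real_int F)
  moreover have "set_integrable lborel {0..} (\<lambda>s. tau_ext M tau (R s)) \<longleftrightarrow> set_integrable lborel {0..} (\<lambda>s. complex_of_real (k s))"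
    by (rule set_integrable_cong) (use R(3) in auto)
  moreover have "(LINT s:{0..}|lborel. tau_ext M tau (R s)) = (LINT s:{0..}|lborel. complex_of_real (k s))"
    by (rule set_lebesgue_integral_cong) (use R(3) in auto)
  moreover have "(LINT r:{0..}|lborel. tau_ext M tau (L r)) = (LINT s:{0..}|lborel. complex_of_real (k s))"
    by (simp add: L set_integral_complex_of_real F)
  ultimately have "(\<forall>s\<ge>0. positive_op (C_op A B s)) \<and>
       (\<forall>t\<ge>0. L t \<in> M_tau M tau) \<and> (\<forall>s\<ge>0. R s \<in> M_tau M tau) \<and>
       set_integrable lborel {0..} (\<lambda>t. tau_ext M tau (L t)) \<and>
       set_integrable lborel {0..} (\<lambda>s. tau_ext M tau (R s)) \<and>
       (LINT t:{0..}|lborel. tau_ext M tau (L t)) = (LINT s:{0..}|lborel. tau_ext M tau (R s))"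
    using L R of_real_int[OF F(2)] by simp
  then show ?thesis unfolding Let_def L_def[abs_def] R_def[abs_def] .
qed

end
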